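(* Let $\mathbb{F}$ be an algebraically closed field, let $m,p$ be positive integers, and let $n(y),d(y)\in\mathbb{F}[y]$ be nonzero coprime polynomials with $G:=\max(\deg n(y),\deg d(y))\ge 1$. Let $P(x)\in(\mathbb{F}[x])^{m\times p}$ have grade $g$, and let $Q(y):=[d(y)]^g P\!\left(\frac{n(y)}{d(y)}\right)\in(\mathbb{F}[y])^{m\times p}$, regarded as a polynomial matrix of grade $gG$. (1) Let $x_0\in\mathbb{F}\cup\{\infty\}$ be a characteristic value of $P(x)$, and let $(x-x_0)^{\ell_1},\dots,(x-x_0)^{\ell_j}$ be the corresponding elementary divisors. Then for any $y_0\in T_{x_0}$, with multiplicity $m_0$ as an element of $T_{x_0}$: $y_0$ is a characteristic value of $Q(y)$, and $(y-y_0)^{m_0\ell_1},\dots,(y-y_0)^{m_0\ell_j}$ are elementary divisors corresponding to $y_0$ for $Q(y)$. (2) Conversely, if $y_0\in\mathbb{F}\cup\{\infty\}$ is a characteristic value of $Q(y)$ with corresponding elementary divisors $(y-y_0)^{\kappa_1},\dots,(y-y_0)^{\kappa_j}$, then $x_0:=\frac{n(y_0)}{d(y_0)}$ is a characteristic value of $P(x)$; and, if $m_0$ denotes the multiplicity of $y_0$ as an element of $T_{x_0}$, then $m_0\mid\kappa_i$ for all $i\le j$, and $(x-x_0)^{\kappa_1/m_0},\dots,(x-x_0)^{\kappa_j/m_0}$ are elementary divisors corresponding to $x_0$ for $P(x)$. (3) The right minimal indices of $P(x)$ are $\beta_1,\dots,\beta_s$ if and only if the right minimal indices of $Q(y)$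 are $G\beta_1,\dots,G\beta_s$. (4) The left minimal indices of $P(x)$ are $\gamma_1,\dots,\gamma_r$ if and only if the left minimal indices of $Q(y)$ are $G\gamma_1,\dots,G\gamma_r$.
   Context: Grade and reversal. The degree of a polynomial matrix is the maximum of the degrees of its entries. A grade of a polynomial matrix is any chosen integer $g\ge 0$ that is at least its degree. For $P(x)=\sum_{i=0}^g P_i x^i$ of grade $g$, with constant matrices $P_i$, the reversal with respect to the grade is $\mathrm{Rev}_g P(x):=\sum_{i=0}^g P_{g-i}x^i$. Elementary divisors. By the Smith form theorem, for $P(x)\in(\mathbb{F}[x])^{m\times p}$ and $\nu=\min(m,p)$ there are unimodular (determinant a nonzero constant) matrices $A(x),B(x)$ with $A(x)P(x)B(x)=\mathrm{diag}(d_1(x),\dots,d_\nu(x))$ (an $m\times p$ matrix), where each $d_i$ is monic or zero and $d_i\mid d_{i+1}$; the $d_i$ are unique and are called the invariant polynomials. Factor each nonzero $d_i(x)=\prod_j(x-x_j)^{k_{j,(i)}}$; the factors $(x-x_j)^{k_{j,(i)}}$ with $k_{j,(i)}\geq 1$ (listed with repetition over $i$) are the elementary divisors corresponding to the characteristic value $x_j\in\mathbb{F}$. Thus $x_0\in\mathbb{F}$ is a characteristic value iff it is a root of some nonzero invariant polynomial. If $P(x)$ has grade $g$, then $\infty$ is a characteristic value of $P(x)$ iff $0$ is a characteristic value of $\mathrm{Rev}_gP(x)$, and one says that $(x-\infty)^\ell$ is an (infinite) elementary divisor of $P(x)$ iff $x^\ell$ is an elementary divisor of $\mathrm{Rev}_gP(x)$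 corresponding to $0$ (with the same repetitions). For $Q(y)$ the grade used is $gG$. Minimal indices. Let $\mathbb{F}(x)$ be the field of fractions of $\mathbb{F}[x]$ and $\mathcal{V}$ a subspace of $(\mathbb{F}(x))^p$ of dimension $s$. A polynomial basis of $\mathcal{V}$ is a basis $v_1,\dots,v_s$ consisting of vectors with entries in $\mathbb{F}[x]$, ordered so that $\deg v_1\le\dots\le\deg v_s$; its order is $\sum_i\deg v_i$. It is minimal if its order is minimal among all polynomial bases of $\mathcal{V}$; the degrees $\deg v_i$ of a minimal basis depend only on $\mathcal{V}$ and are called the minimal indices of $\mathcal{V}$. The right (resp. left) minimal indices of $P(x)$ are the minimal indices of $\ker P(x)$ (resp. $\ker P(x)^T$), with kernels taken over $\mathbb{F}(x)$. The sets $T_{x_0}$ and multiplicities. Consider $x(y)=n(y)/d(y)$ as a function from $\mathbb{F}\cup\{\infty\}$ to itself. For $x_0\in\mathbb{F}\cup\{\infty\}$, $T_{x_0}$ is the preimage of $x_0$ under $x(y)$. Explicitly, let $(\alpha,\beta)=(x_0,1)$ if $x_0\in\mathbb{F}$ and $(\alpha,\beta)=(1,0)$ if $x_0=\infty$, and let $S$ be the degree of $\alpha d(y)-\beta n(y)$. The finite elements of $T_{x_0}$ are the roots in $\mathbb{F}$ of $\alpha d(y)-\beta n(y)$, with multiplicity equal to their multiplicity as roots of this polynomial; and $\infty\in T_{x_0}$ iff $S<G$, in which case its multiplicity is $G-S$. Accordingly, $\frac{n(y_0)}{d(y_0)}$ denotes, for every $y_0\in\mathbb{F}\cup\{\infty\}$,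 the unique $x_0\in\mathbb{F}\cup\{\infty\}$ with $y_0\in T_{x_0}$ (in particular it is $\infty$ if $y_0\in\mathbb{F}$ and $d(y_0)=0$). *)

theory Defs
  imports
    "Jordan_Normal_Form.Matrix_Kernel"
    "HOL-Computational_Algebra.Polynomial_Factorial"
begin

text \<open>The line over the field with a point at infinity adjoined.\<close>

datatype 'a ext_point = Finite 'a | Infinite

section \<open>Degree, grade, reversal\<close>

definition mat_degree :: "'a::zero poly mat \<Rightarrow> nat" where
  "mat_degree P = Max (degree ` elements_mat P)"

definition has_grade :: "nat \<Rightarrow> 'a::zero poly mat \<Rightarrow> bool" where
  "has_grade g P \<longleftrightarrow> mat_degree P \<le> g"

definition reversal :: "nat \<Rightarrow> 'a::comm_monoid_add poly mat \<Rightarrow> 'a poly mat" where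
  "reversal g P = map_mat (\<lambda>q. \<Sum>i\<le>g. monom (coeff q (g - i)) i) P"

section \<open>Smith form and elementary divisors\<close>

definition unimodular :: "nat \<Rightarrow> 'a::field poly mat \<Rightarrow> bool" where
  "unimodular k A \<longleftrightarrow> A \<in> carrier_mat k k \<and> (\<exists>c. c \<noteq> 0 \<and> det A = [:c:])"

definition rect_diag :: "nat \<Rightarrow> nat \<Rightarrow> 'a::zero list \<Rightarrow> 'a mat" where
  "rect_diag m p ds = mat m p (\<lambda>(i, j). if i = j then ds ! i else 0)"

definition is_smith_diagonal :: "'a::field poly mat \<Rightarrow> 'a poly list \<Rightarrow> bool" where
  "is_smith_diagonal P ds \<longleftrightarrow>
     length ds = min (dim_row P) (dim_col P) \<and>
     (\<forall>q\<in>set ds. q = 0 \<or> lead_coeff q = 1) \<and>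
     (\<forall>i. Suc i < length ds \<longrightarrow> ds ! i dvd ds ! Suc i) \<and>
     (\<exists>A B. unimodular (dim_row P) A \<and> unimodular (dim_col P) B \<and>
        A * P * B = rect_diag (dim_row P) (dim_col P) ds)"

definition invariant_polys :: "'a::field poly mat \<Rightarrow> 'a poly list" where
  "invariant_polys P = (THE ds. is_smith_diagonal P ds)"

text \<open>
  An elementary divisor \<open>(x - x0)^l\<close> is represented by its exponent \<open>l\<close>; the point \<open>x0\<close>
  is an argument, so that \<open>(x - \<infinity>)^l\<close> needs no separate treatment.  Multisets keep the
  repetitions.
\<close>

definition finite_elem_divs :: "'a::field poly mat \<Rightarrow> 'a \<Rightarrow> nat multiset" where
  "finite_elem_divs P x0 =
     {#l \<in># {#Polynomial.order x0 q. q \<in># {#q \<in># mset (invariant_polys P). q \<noteq> 0#}#}. 1 \<le> l#}"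

definition finite_char_value :: "'a::field poly mat \<Rightarrow> 'a \<Rightarrow> bool" where
  "finite_char_value P x0 \<longleftrightarrow> (\<exists>q\<in>set (invariant_polys P). q \<noteq> 0 \<and> poly q x0 = 0)"

text \<open>The grade \<open>g\<close> only matters at infinity.\<close>

fun elem_divs :: "nat \<Rightarrow> 'a::field poly mat \<Rightarrow> 'a ext_point \<Rightarrow> nat multiset" where
  "elem_divs g P (Finite x0) = finite_elem_divs P x0"
| "elem_divs g P Infinite = finite_elem_divs (reversal g P) 0"

fun char_value :: "nat \<Rightarrow> 'a::field poly mat \<Rightarrow> 'a ext_point \<Rightarrow> bool" where
  "char_value g P (Finite x0) \<longleftrightarrow> finite_char_value P x0"
| "char_value g P Infinite \<longleftrightarrow> finite_char_value (reversal g P) 0"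

section \<open>Minimal indices\<close>

definition vec_degree :: "'a::zero poly vec \<Rightarrow> nat" where
  "vec_degree v = Max (degree ` set\<^sub>v v)"

text \<open>\<open>V\<close> is a subspace of the space of \<open>p\<close>-vectors over the field of rational functions.\<close>

definition poly_basis :: "nat \<Rightarrow> 'a::field poly fract vec set \<Rightarrow> 'a poly vec list \<Rightarrow> bool" where
  "poly_basis p V vs \<longleftrightarrow>
     set vs \<subseteq> carrier_vec p \<and> distinct vs \<and> sorted (map vec_degree vs) \<and>
     vectorspace.basis class_ring (module_vec TYPE('a poly fract) p \<lparr>carrier := V\<rparr>)
       (map_vec to_fract ` set vs)"

definition basis_order :: "'a::zero poly vec list \<Rightarrow> nat" where
  "basis_order vs = sum_list (map vec_degree vs)"

definition minimal_basis :: "nat \<Rightarrow> 'a::field poly fract vec set \<Rightarrow> 'a poly vec list \<Rightarrow> bool" where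
  "minimal_basis p V vs \<longleftrightarrow>
     poly_basis p V vs \<and> (\<forall>ws. poly_basis p V ws \<longrightarrow> basis_order vs \<le> basis_order ws)"

definition minimal_indices :: "nat \<Rightarrow> 'a::field poly fract vec set \<Rightarrow> nat list" where
  "minimal_indices p V = (THE ks. \<exists>vs. minimal_basis p V vs \<and> ks = map vec_degree vs)"

definition right_minimal_indices :: "'a::field poly mat \<Rightarrow> nat list" where
  "right_minimal_indices P = minimal_indices (dim_col P) (mat_kernel (map_mat to_fract P))"

definition left_minimal_indices :: "'a::field poly mat \<Rightarrow> nat list" where
  "left_minimal_indices P =
     minimal_indices (dim_row P) (mat_kernel (transpose_mat (map_mat to_fract P)))"

section \<open>The rational function \<open>n/d\<close>\<close>

fun fibre_poly :: "'a::field poly \<Rightarrow> 'a poly \<Rightarrow> 'a ext_point \<Rightarrow> 'a poly" where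
  "fibre_poly n d (Finite x0) = Polynomial.smult x0 d - n"
| "fibre_poly n d Infinite = d"

fun fibre_mult :: "'a::field poly \<Rightarrow> 'a poly \<Rightarrow> 'a ext_point \<Rightarrow> 'a ext_point \<Rightarrow> nat" where
  "fibre_mult n d x0 (Finite y0) = Polynomial.order y0 (fibre_poly n d x0)"
| "fibre_mult n d x0 Infinite = max (degree n) (degree d) - degree (fibre_poly n d x0)"

definition fibre :: "'a::field poly \<Rightarrow> 'a poly \<Rightarrow> 'a ext_point \<Rightarrow> 'a ext_point set" where
  "fibre n d x0 =
     {Finite y0 | y0. poly (fibre_poly n d x0) y0 = 0} \<union>
     {y0. y0 = Infinite \<and> degree (fibre_poly n d x0) < max (degree n) (degree d)}"

definition ratfun_value :: "'a::field poly \<Rightarrow> 'a poly \<Rightarrow> 'a ext_point \<Rightarrow> 'a ext_point" where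
  "ratfun_value n d y0 = (THE x0. y0 \<in> fibre n d x0)"

lemma ex1_fibre:
  fixes n d :: "'a::field poly"
  assumes "coprime n d" and G: "1 \<le> max (degree n) (degree d)"
  shows "\<exists>!x0. y0 \<in> fibre n d x0"
proof (cases y0)
  case (Finite y)
  have nz: "poly n y \<noteq> 0 \<or> poly d y \<noteq> 0"
  proof (rule ccontr)
    assume "\<not> ?thesis"
    then have "[:-y, 1:] dvd n" "[:-y, 1:] dvd d" by (auto simp: poly_eq_0_iff_dvd)
    with assms(1) have "[:-y, 1:] dvd 1" by (rule coprime_common_divisor)
    then show False by (simp add: poly_eq_0_iff_dvd[symmetric])
  qed
  show ?thesis
  proof (cases "poly d y = 0")
    case True
    have "x0 = Infinite" if "y0 \<in> fibre n d x0" for x0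
      using that nz True by (cases x0) (auto simp: Finite fibre_def)
    moreover have "y0 \<in> fibre n d Infinite" by (simp add: Finite fibre_def True)
    ultimately show ?thesis by blast
  next
    case False
    have "y0 \<in> fibre n d x0 \<longleftrightarrow> x0 = Finite (poly n y / poly d y)" for x0
      using False by (cases x0) (auto simp: Finite fibre_def field_simps)
    then show ?thesis by simp
  qed
next
  case Infinite
  define N where "N = max (degree n) (degree d)"
  have *: "degree q < N \<longleftrightarrow> coeff q N = 0" if "degree q \<le> N" for q :: "'a poly"
  proof
    assume "coeff q N = 0"
    show "degree q < N"
    proof (rule ccontr)
      assume "\<not> degree q < N"
      with that have "degree q = N" by simp
      with \<open>coeff q N = 0\<close> have "q = 0" using leading_coeff_0_iff[of q] by simp
      with \<open>degree q = N\<close> G show False by (simp add: N_def)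
    qed
  qed (rule coeff_eq_0)
  have deg: "degree (fibre_poly n d x0) \<le> N" for x0
    by (cases x0) (auto simp: N_def intro!: degree_diff_le order.trans[OF degree_smult_le])
  have iff: "y0 \<in> fibre n d x0 \<longleftrightarrow> coeff (fibre_poly n d x0) N = 0" for x0
    using *[OF deg] by (auto simp: Infinite fibre_def N_def)
  have nz: "coeff n N \<noteq> 0 \<or> coeff d N \<noteq> 0"
    using *[of n] *[of d] by (auto simp: N_def)
  show ?thesis
  proof (cases "coeff d N = 0")
    case True
    have "x0 = Infinite" if "y0 \<in> fibre n d x0" for x0
      using that nz True by (cases x0) (auto simp: iff)
    moreover have "y0 \<in> fibre n d Infinite" by (simp add: iff True)
    ultimately show ?thesis by blast
  next
    case False
    have "y0 \<in> fibre n d x0 \<longleftrightarrow> x0 = Finite (coeff n N / coeff d N)" for x0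
      using False by (cases x0) (auto simp: iff field_simps)
    then show ?thesis by simp
  qed
qed

text \<open>\<open>P(n(y)/d(y))\<close>, a matrix over the field of rational functions in \<open>y\<close>.\<close>

definition ratfun_eval :: "'a::field poly \<Rightarrow> 'a poly \<Rightarrow> 'a poly \<Rightarrow> 'a poly fract" where
  "ratfun_eval n d q = poly (map_poly (\<lambda>c. to_fract [:c:]) q) (to_fract n / to_fract d)"

text \<open>\<open>Q(y) = d(y)^g P(n(y)/d(y))\<close>, an equation between matrices of rational functions.\<close>

definition is_rational_transform ::
    "'a::field poly \<Rightarrow> 'a poly \<Rightarrow> nat \<Rightarrow> 'a poly mat \<Rightarrow> 'a poly mat \<Rightarrow> bool" where
  "is_rational_transform n d g P Q \<longleftrightarrow>
     map_mat to_fract Q = (to_fract d ^ g) \<cdot>\<^sub>m map_mat (ratfun_eval n d) P"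

lemma ex1_rational_transform:
  fixes P :: "'a::field poly mat"
  assumes d: "d \<noteq> 0" and P: "has_grade g P"
  shows "\<exists>!Q. is_rational_transform n d g P Q"
proof -
  let ?Q = "map_mat (\<lambda>q. \<Sum>k\<le>g. Polynomial.smult (coeff q k) (n ^ k * d ^ (g - k))) P"
  have pow: "to_fract (q ^ k) = to_fract q ^ k" for q :: "'a poly" and k
    by (induction k) auto
  have sum: "to_fract (\<Sum>k\<in>A. f k) = (\<Sum>k\<in>A. to_fract (f k))" for f :: "nat \<Rightarrow> 'a poly" and A
    by (induction A rule: infinite_finite_induct) auto
  have entry: "to_fract (\<Sum>k\<le>g. Polynomial.smult (coeff q k) (n ^ k * d ^ (g - k))) =
      to_fract d ^ g * ratfun_eval n d q" if "degree q \<le> g" for q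
  proof -
    let ?q = "map_poly (\<lambda>c. to_fract [:c:]) q"
    have "ratfun_eval n d q = (\<Sum>k\<le>g. coeff ?q k * (to_fract n / to_fract d) ^ k)"
      unfolding ratfun_eval_def
      unfolding poly_altdef
    proof (rule sum.mono_neutral_left)
      show "{..degree ?q} \<subseteq> {..g}"
        using that map_poly_degree_leq[of "\<lambda>c. to_fract [:c:]" q] by auto
    qed (auto intro!: coeff_eq_0)
    also have "\<dots> = (\<Sum>k\<le>g. to_fract [:coeff q k:] * (to_fract n / to_fract d) ^ k)"
      by (simp add: coeff_map_poly)
    also have "to_fract d ^ g * \<dots> =
        (\<Sum>k\<le>g. to_fract [:coeff q k:] * (to_fract n ^ k * to_fract d ^ (g - k)))"
      unfolding sum_distrib_left
    proof (rule sum.cong, goal_cases)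
      case (2 k)
      then have "to_fract d ^ g = to_fract d ^ k * to_fract d ^ (g - k)"
        by (simp flip: power_add)
      then show ?case using d by (simp add: field_simps)
    qed simp
    also have "\<dots> = to_fract (\<Sum>k\<le>g. [:coeff q k:] * (n ^ k * d ^ (g - k)))"
      by (simp only: sum pow to_fract_mult)
    finally show ?thesis by simp
  qed
  have "degree (P $$ (i, j)) \<le> g" if "i < dim_row P" "j < dim_col P" for i j
  proof -
    have "finite (elements_mat P)" by (simp add: elements_mat_def)
    moreover have "P $$ (i, j) \<in> elements_mat P" using that by auto
    ultimately have "degree (P $$ (i, j)) \<le> mat_degree P"
      unfolding mat_degree_def by (intro Max_ge finite_imageI imageI)
    with P show ?thesis unfolding has_grade_def by simp
  qed
  then have "is_rational_transform n d g P ?Q"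
    unfolding is_rational_transform_def by (intro eq_matI) (auto simp: entry[symmetric])
  moreover have "Q = Q'" if eq: "map_mat to_fract Q = map_mat to_fract Q'"
    for Q Q' :: "'a poly mat"
  proof (rule eq_matI)
    show "dim_row Q = dim_row Q'" "dim_col Q = dim_col Q'"
      using arg_cong[OF eq, of dim_row] arg_cong[OF eq, of dim_col] by simp_all
    then show "Q $$ (i, j) = Q' $$ (i, j)" if "i < dim_row Q'" "j < dim_col Q'" for i j
      using arg_cong[OF eq, of "\<lambda>A. A $$ (i, j)"] that by simp
  qed
  ultimately show ?thesis
    by (intro ex1I[of _ ?Q]) (simp_all only: is_rational_transform_def)
qed

end

theory Submission
  imports Defs "Jordan_Normal_Form.Char_Poly"
begin

text \<open>
  Elementary divisors at a point \<open>x\<close> are local data: the rank of a diagonal matrix modulo \<open>(X - x)^(k + 1)\<close>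
  after scaling to \<open>(X - x)^k\<close> counts the entries of order at most \<open>k\<close>, and this number does not change
  under multiplication by matrices whose determinants do not vanish at \<open>x\<close>.  Homogenizing a Smith
  decomposition \<open>A P B = D\<close> in the pair \<open>(n, d)\<close> therefore diagonalizes \<open>Q\<close> locally at every \<open>y\<close> with
  \<open>d(y) \<noteq> 0\<close>, where the order of a diagonal entry gets multiplied by the multiplicity of \<open>y\<close>.  Points over
  or at infinity reduce to this case, since the reversal is itself a homogenization, in the pair \<open>(1, X)\<close>.

  A polynomial basis is minimal iff the matrix of its homogenized columns has full column rank at every
  point of the projective line.  This property is inherited by the homogenized basis in \<open>(n, d)\<close>, whose
  degrees are multiplied by \<open>G\<close>; that the new vectors still span the kernel follows by substituting into
  a generalized inverse of \<open>P\<close>.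
\<close>

section \<open>Local invariants of polynomial matrices\<close>

text \<open>Substituting \<open>n / d\<close> into a Smith decomposition of \<open>P\<close> does
  not give one of \<open>Q\<close>: once denominators are cleared, the determinants of the outer
  factors are constants times powers of \<open>d\<close>, and the diagonal entries pick up such
  powers too. This is why everything is read off one point at a time, and why the roles of
  \<open>n\<close> and \<open>d\<close> are exchanged at zeros of \<open>d\<close>. The same local
  count yields the uniqueness that the \<open>THE\<close> in \<open>invariant_polys\<close> demands:
  over an algebraically closed field the orders at all points determine a monic polynomial, and the
  divisibility chain tells which orders belong to the same position.

  The factor \<open>G\<close> in the minimal indices is the degree of the self-map
  \<open>(n : d)\<close> of the projective line. Full rank at all points characterizes minimality
  because a drop of rank at a finite point permits division by \<open>X - x\<close>, and a drop at
  infinity permits cancellation of leading terms; both lower the order. Conversely, a combination of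
  a full-rank basis never has a smaller degree than its terms suggest.\<close>

lemma exists_linear_relation:
  fixes f :: "'i \<Rightarrow> 'j \<Rightarrow> 'b::idom"
  assumes "finite J" "finite I" "card J < card I"
  shows "\<exists>a. (\<exists>i\<in>I. a i \<noteq> 0) \<and> (\<forall>j\<in>J. (\<Sum>i\<in>I. a i * f i j) = 0)"
  using assms
proof (induction J arbitrary: I f rule: finite_induct)
  case empty
  then have "I \<noteq> {}" by auto
  then show ?case by (intro exI[of _ "\<lambda>_. 1"]) auto
next
  case (insert p J)
  show ?case
  proof (cases "\<forall>i\<in>I. f i p = 0")
    case True
    have "card J < card I" using insert by simp
    then obtain a where "\<exists>i\<in>I. a i \<noteq> 0" "\<forall>j\<in>J. (\<Sum>i\<in>I. a i * f i j) = 0"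
      using insert.IH[of I f] insert.prems by blast
    with True show ?thesis by (intro exI[of _ a]) auto
  next
    case False
    then obtain k where k: "k \<in> I" "f k p \<noteq> 0" by auto
    let ?I = "I - {k}"
    \<comment> \<open>Fraction-free elimination of coordinate \<open>p\<close> with pivot
      \<open>f k p\<close>: cross multiplication replaces division, so the relation stays in the
      domain, and the coefficient of \<open>k\<close> is recovered in \<open>a\<close>.\<close>
    define h where "h i j = f k p * f i j - f i p * f k j" for i j
    have "card J < card ?I" using insert k by simp
    then obtain b where b: "\<exists>i\<in>?I. b i \<noteq> 0" "\<And>j. j \<in> J \<Longrightarrow> (\<Sum>i\<in>?I. b i * h i j) = 0"
      using insert.IH[of ?I h] insert.prems by auto
    define a where "a i = (if i = k then - (\<Sum>i\<in>?I. b i * f i p) else f k p * b i)" for i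
    have "(\<Sum>i\<in>I. a i * f i j) = (\<Sum>i\<in>?I. b i * h i j)" for j
    proof -
      have "(\<Sum>i\<in>I. a i * f i j) = a k * f k j + (\<Sum>i\<in>?I. a i * f i j)"
        using k insert.prems by (simp add: sum.remove)
      also have "(\<Sum>i\<in>?I. a i * f i j) = (\<Sum>i\<in>?I. f k p * b i * f i j)"
        by (intro sum.cong) (auto simp: a_def)
      also have "a k * f k j + \<dots> = (\<Sum>i\<in>?I. b i * h i j)"
        by (simp add: a_def h_def algebra_simps sum_subtractf sum_distrib_left)
      finally show ?thesis .
    qed
    moreover have "h i p = 0" for i by (simp add: h_def)
    moreover have "\<exists>i\<in>I. a i \<noteq> 0" using b(1) k by (auto simp: a_def)
    ultimately show ?thesis using b(2) by (intro exI[of _ a]) auto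
  qed
qed

lemma order_eqI:
  fixes q :: "'a::field poly"
  assumes "q = [:-x, 1:] ^ e * r" "poly r x \<noteq> 0"
  shows "order x q = e"
proof -
  have "r \<noteq> 0" using assms by auto
  then have "order x q = order x ([:-x, 1:] ^ e) + order x r"
    using assms by (simp add: order_mult)
  then show ?thesis using assms by (simp add: order_power_n_n order_0I)
qed

lemma order_factor:
  fixes q :: "'a::field poly"
  assumes "q \<noteq> 0"
  obtains r where "q = [:-x, 1:] ^ order x q * r" "poly r x \<noteq> 0"
proof -
  from order_decomp[OF assms, of x] obtain r where
    "q = [:-x, 1:] ^ order x q * r" "\<not> [:-x, 1:] dvd r" by auto
  then show ?thesis using that by (auto simp: poly_eq_0_iff_dvd)
qed

text \<open>A nontrivial polynomial relation can become trivial when evaluated at \<open>x\<close>.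
  Cancelling the largest common power of \<open>X - x\<close> prevents this, since a coefficient of
  minimal order then has a nonzero value.\<close>

lemma divide_common_root:
  fixes z :: "'i \<Rightarrow> 'a::field poly"
  assumes "finite I" "\<exists>i\<in>I. z i \<noteq> 0"
  obtains e w where "\<And>i. i \<in> I \<Longrightarrow> z i = [:-x, 1:] ^ e * w i" "\<exists>i\<in>I. poly (w i) x \<noteq> 0"
proof -
  define S where "S = order x ` z ` {i \<in> I. z i \<noteq> 0}"
  have S: "finite S" "S \<noteq> {}" using assms by (auto simp: S_def)
  define e where "e = Min S"
  have "e \<in> S" unfolding e_def using S by (rule Min_in)
  then obtain i where i: "i \<in> I" "z i \<noteq> 0" "order x (z i) = e" by (auto simp: S_def)
  have "[:-x, 1:] ^ e dvd z j" if "j \<in> I" for j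
  proof (cases "z j = 0")
    case False
    then have "e \<le> order x (z j)" unfolding e_def using S that by (intro Min_le) (auto simp: S_def)
    then show ?thesis using False by (simp add: order_divides)
  qed simp
  then have "\<forall>j\<in>I. \<exists>v. z j = [:-x, 1:] ^ e * v" by (auto elim: dvdE)
  then obtain w where w: "\<And>j. j \<in> I \<Longrightarrow> z j = [:-x, 1:] ^ e * w j" by metis
  have "poly (w i) x \<noteq> 0"
  proof
    assume "poly (w i) x = 0"
    then have "[:-x, 1:] dvd w i" by (simp add: poly_eq_0_iff_dvd)
    then have "[:-x, 1:] ^ e * [:-x, 1:] dvd z i"
      unfolding w[OF i(1)] by (intro mult_dvd_mono dvd_refl)
    then have "[:-x, 1:] ^ Suc e dvd z i" by (simp only: power_Suc mult.commute)
    then show False using i order_divides[of x "Suc e" "z i"] by simp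
  qed
  with w i show ?thesis using that by blast
qed

section \<open>Counting local invariant factors by a rank condition\<close>

lemma rect_diag_carrier [simp]: "rect_diag m p ds \<in> carrier_mat m p"
  by (simp add: rect_diag_def)

lemma rect_diag_index [simp]:
  "i < m \<Longrightarrow> j < p \<Longrightarrow> rect_diag m p ds $$ (i, j) = (if i = j then ds ! i else 0)"
  by (simp add: rect_diag_def)

lemma rect_diag_dims [simp]:
  "dim_row (rect_diag m p ds) = m" "dim_col (rect_diag m p ds) = p"
  by (simp_all add: rect_diag_def)

text \<open>For \<open>s = X - x\<close> this says that at least \<open>r\<close> nonzero local
  invariant factors have order at most \<open>k\<close>: some compression of \<open>P\<close> to
  size \<open>r\<close> is \<open>s ^ k\<close> times a matrix invertible over the local ring at
  \<open>s\<close>. \<open>U\<close> and \<open>W\<close> are arbitrary, so factors multiplied onto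
  \<open>P\<close> can be absorbed into them.\<close>

definition local_size :: "nat \<Rightarrow> 'a::field poly \<Rightarrow> 'a poly mat \<Rightarrow> nat \<Rightarrow> bool" where
  "local_size r s P k \<longleftrightarrow>
     (\<exists>U W C. U \<in> carrier_mat r (dim_row P) \<and> W \<in> carrier_mat (dim_col P) r \<and>
        C \<in> carrier_mat r r \<and> U * P * W = s ^ k \<cdot>\<^sub>m C \<and> \<not> s dvd det C)"

lemma mult_mat_assoc5:
  fixes U :: "'b::comm_ring_1 mat"
  assumes "U \<in> carrier_mat r m" "A \<in> carrier_mat m m'" "P \<in> carrier_mat m' p'"
    "B \<in> carrier_mat p' p" "W \<in> carrier_mat p r'"
  shows "U * (A * P * B) * W = (U * A) * P * (B * W)"
proof -
  note UA = mult_carrier_mat[OF assms(1,2)] and PB = mult_carrier_mat[OF assms(3,4)]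
    and BW = mult_carrier_mat[OF assms(4,5)]
  show ?thesis
    unfolding assoc_mult_mat[OF assms(2,3,4)] assoc_mult_mat[OF assms(1,2) PB, symmetric]
      assoc_mult_mat[OF UA PB assms(5)] assoc_mult_mat[OF assms(3,4,5)]
      assoc_mult_mat[OF UA assms(3) BW] ..
qed

lemma local_size_multD:
  assumes "P \<in> carrier_mat m p" "A \<in> carrier_mat m m" "B \<in> carrier_mat p p"
    and "local_size r s (A * P * B) k"
  shows "local_size r s P k"
proof -
  have "dim_row (A * P * B) = m" "dim_col (A * P * B) = p" using assms(2,3) by auto
  with assms(4) obtain U W C where *: "U \<in> carrier_mat r m" "W \<in> carrier_mat p r"
    "C \<in> carrier_mat r r" "U * (A * P * B) * W = s ^ k \<cdot>\<^sub>m C" "\<not> s dvd det C"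
    unfolding local_size_def by metis
  have "(U * A) * P * (B * W) = s ^ k \<cdot>\<^sub>m C"
    using *(4) mult_mat_assoc5[OF *(1) assms(2,1,3) *(2)] by simp
  moreover have "U * A \<in> carrier_mat r m" "B * W \<in> carrier_mat p r"
    using * assms(2,3) by auto
  moreover have "dim_row P = m" "dim_col P = p" using assms(1) by auto
  ultimately show ?thesis using *(3,5) unfolding local_size_def by metis
qed

text \<open>The adjugates serve as polynomial inverses up to the scalar
  \<open>det A * det B\<close>, which is absorbed or cancelled later.\<close>

lemma adj_mult_mult_adj:
  fixes A :: "'b::comm_ring_1 mat"
  assumes "P \<in> carrier_mat m p" "A \<in> carrier_mat m m" "B \<in> carrier_mat p p"
  shows "adj_mat A * (A * P * B) * adj_mat B = (det A * det B) \<cdot>\<^sub>m P"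
proof -
  note a = adj_mat[OF assms(2)] and b = adj_mat[OF assms(3)]
  have "adj_mat A * (A * P * B) * adj_mat B = (adj_mat A * A) * P * (B * adj_mat B)"
    using mult_mat_assoc5[OF a(1) assms(2,1,3) b(1)] .
  also have "\<dots> = (det A * det B) \<cdot>\<^sub>m P"
    unfolding a b using assms
    by (simp add: mult_smult_assoc_mat[of "1\<^sub>m m" m m P p] mult_smult_distrib[of P m p "1\<^sub>m p" p]
        mult_smult_distrib[of "_ \<cdot>\<^sub>m P" m p "1\<^sub>m p" p])
      (auto simp: mult_ac)
  finally show ?thesis .
qed

text \<open>When both determinants are prime to \<open>s\<close>, the scalar
  \<open>det A * det B\<close> produced by the adjugates goes into \<open>C\<close> without making
  \<open>det C\<close> divisible by \<open>s\<close>.\<close>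

lemma local_size_mult:
  assumes P: "P \<in> carrier_mat m p" and A: "A \<in> carrier_mat m m" and B: "B \<in> carrier_mat p p"
    and s: "prime_elem s" and d: "\<not> s dvd det A" "\<not> s dvd det B"
  shows "local_size r s (A * P * B) k \<longleftrightarrow> local_size r s P k"
proof
  assume "local_size r s P k"
  moreover have "dim_row P = m" "dim_col P = p" using P by auto
  ultimately obtain U W C where *: "U \<in> carrier_mat r m" "W \<in> carrier_mat p r"
    "C \<in> carrier_mat r r" "U * P * W = s ^ k \<cdot>\<^sub>m C" "\<not> s dvd det C"
    unfolding local_size_def by metis
  let ?c = "det A * det B"
  note a = adj_mat[OF A] and b = adj_mat[OF B]
  have "(U * adj_mat A) * (A * P * B) * (adj_mat B * W) = U * (adj_mat A * (A * P * B) * adj_mat B) * W"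
    using mult_mat_assoc5[OF *(1) a(1) mult_carrier_mat[OF mult_carrier_mat[OF A P] B] b(1) *(2)] ..
  also have "\<dots> = U * (?c \<cdot>\<^sub>m P) * W" unfolding adj_mult_mult_adj[OF P A B] ..
  also have "\<dots> = ?c \<cdot>\<^sub>m (U * P * W)" using * P
    by (simp add: mult_smult_assoc_mat[of "U * P" r p W r] mult_smult_distrib[of U r m P p])
  also have "\<dots> = s ^ k \<cdot>\<^sub>m (?c \<cdot>\<^sub>m C)" unfolding *(4) by (auto simp: mult_ac)
  finally have "(U * adj_mat A) * (A * P * B) * (adj_mat B * W) = s ^ k \<cdot>\<^sub>m (?c \<cdot>\<^sub>m C)" .
  moreover have "\<not> s dvd det (?c \<cdot>\<^sub>m C)"
    using *(5) d s by (auto simp: prime_elem_dvd_mult_iff dest!: prime_elem_dvd_power[OF s])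
  moreover have "U * adj_mat A \<in> carrier_mat r m" "adj_mat B * W \<in> carrier_mat p r" "?c \<cdot>\<^sub>m C \<in> carrier_mat r r"
    using * a b by auto
  moreover have "dim_row (A * P * B) = m" "dim_col (A * P * B) = p" using A B by auto
  ultimately show "local_size r s (A * P * B) k" unfolding local_size_def by metis
qed (use local_size_multD[OF P A B] in auto)

lemma mat_mult_index:
  assumes "A \<in> carrier_mat r m" "B \<in> carrier_mat m r'" "a < r" "b < r'"
  shows "(A * B) $$ (a, b) = (\<Sum>i<m. A $$ (a, i) * B $$ (i, b))"
  using assms by (simp add: scalar_prod_def atLeast0LessThan)

lemma mat_mult3_index:
  assumes "U \<in> carrier_mat r m" "P \<in> carrier_mat m p" "W \<in> carrier_mat p r'" "a < r" "b < r'"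
  shows "(U * P * W) $$ (a, b) = (\<Sum>j<p. (\<Sum>i<m. U $$ (a, i) * P $$ (i, j)) * W $$ (j, b))"
  unfolding mat_mult_index[OF mult_carrier_mat[OF assms(1,2)] assms(3-5)]
  by (intro sum.cong refl) (simp add: mat_mult_index[OF assms(1,2,4)] del: index_mult_mat)

lemma mult_rect_diag_index:
  fixes U :: "'b::comm_ring_1 mat"
  assumes "U \<in> carrier_mat r m" "W \<in> carrier_mat p r'" "a < r" "b < r'"
  shows "(U * rect_diag m p ds * W) $$ (a, b) = (\<Sum>i<min m p. U $$ (a, i) * ds ! i * W $$ (i, b))"
proof -
  have "(U * rect_diag m p ds * W) $$ (a, b) =
      (\<Sum>j<p. (\<Sum>i<m. U $$ (a, i) * (if i = j then ds ! i else 0)) * W $$ (j, b))"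
    unfolding mat_mult3_index[OF assms(1) rect_diag_carrier assms(2-4)]
    by (intro sum.cong refl arg_cong2[of _ _ _ _ "(*)"]) auto
  also have "\<dots> = (\<Sum>j<p. (if j < m then U $$ (a, j) * ds ! j else 0) * W $$ (j, b))"
    by (simp add: if_distrib[of "\<lambda>x. _ * x"] cong: if_cong)
  also have "\<dots> = (\<Sum>j<min m p. U $$ (a, j) * ds ! j * W $$ (j, b))"
    by (intro sum.mono_neutral_cong_right) auto
  finally show ?thesis .
qed

text \<open>If \<open>r\<close> exceeded the number of diagonal entries of order at most
  \<open>k\<close>, some polynomial vector \<open>w\<close>, nonzero at \<open>x\<close>, would
  annihilate all rows of \<open>W\<close> belonging to these entries. The remaining entries are
  divisible by \<open>s ^ (k + 1)\<close>, hence so is \<open>s ^ k\<close> times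
  \<open>C w\<close>, and \<open>C\<close> would be singular at \<open>x\<close>.\<close>

lemma local_size_rect_diag_le:
  fixes ds :: "'a::field poly list"
  assumes len: "length ds = min m p" and "local_size r [:-x, 1:] (rect_diag m p ds) k"
  shows "r \<le> card {i. i < length ds \<and> ds ! i \<noteq> 0 \<and> order x (ds ! i) \<le> k}"
proof (rule ccontr)
  let ?s = "[:-x, 1:]" and ?D = "rect_diag m p ds"
  define I where "I = {i. i < length ds \<and> ds ! i \<noteq> 0 \<and> order x (ds ! i) \<le> k}"
  assume "\<not> ?thesis"
  then have less: "card I < card {..<r}" by (simp add: I_def)
  from assms(2) obtain U W C where *: "U \<in> carrier_mat r m" "W \<in> carrier_mat p r"
    "C \<in> carrier_mat r r" "U * ?D * W = ?s ^ k \<cdot>\<^sub>m C" "\<not> ?s dvd det C"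
    unfolding local_size_def rect_diag_dims by metis
  have "finite I" by (simp add: I_def)
  from exists_linear_relation[OF this _ less, of "\<lambda>c i. W $$ (i, c)"]
  obtain z where z: "\<exists>c\<in>{..<r}. z c \<noteq> 0" "\<forall>i\<in>I. (\<Sum>c<r. z c * W $$ (i, c)) = 0" by auto
  from divide_common_root[OF finite_lessThan z(1), of x] obtain e w where
    w: "\<And>c. c < r \<Longrightarrow> z c = ?s ^ e * w c" "\<exists>c<r. poly (w c) x \<noteq> 0"
    by (metis lessThan_iff finite_lessThan)
  have wI: "(\<Sum>c<r. w c * W $$ (i, c)) = 0" if "i \<in> I" for i
  proof -
    have "?s ^ e * (\<Sum>c<r. w c * W $$ (i, c)) = (\<Sum>c<r. z c * W $$ (i, c))"
      by (simp add: w sum_distrib_left mult.assoc)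
    then show ?thesis using z(2) that by simp
  qed
  \<comment> \<open>Zero entries fall under this case as well, being divisible by every
    power.\<close>
  have high: "?s ^ Suc k dvd ds ! i" if "i < length ds" "i \<notin> I" for i
    using that order_divides[of x "Suc k" "ds ! i"] by (auto simp: I_def)
  have dvd: "?s dvd (\<Sum>c<r. C $$ (a, c) * w c)" if a: "a < r" for a
  proof -
    have "?s ^ k * (\<Sum>c<r. C $$ (a, c) * w c) = (\<Sum>c<r. (?s ^ k \<cdot>\<^sub>m C) $$ (a, c) * w c)"
      using * a by (simp add: sum_distrib_left mult.assoc)
    also have "\<dots> = (\<Sum>c<r. (\<Sum>i<min m p. U $$ (a, i) * ds ! i * W $$ (i, c)) * w c)"
      using a by (simp add: *(4)[symmetric] mult_rect_diag_index[OF *(1,2)] del: index_mult_mat)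
    also have "\<dots> = (\<Sum>i<min m p. U $$ (a, i) * ds ! i * (\<Sum>c<r. w c * W $$ (i, c)))"
      unfolding sum_distrib_right sum_distrib_left
      by (subst sum.swap) (simp add: mult_ac)
    also have "?s ^ Suc k dvd \<dots>"
    proof (rule dvd_sum)
      fix i assume "i \<in> {..<min m p}"
      then show "?s ^ Suc k dvd U $$ (a, i) * ds ! i * (\<Sum>c<r. w c * W $$ (i, c))"
        using wI[of i] high[of i] len
        by (cases "i \<in> I") (auto simp del: power_Suc intro!: dvd_mult2[OF dvd_mult])
    qed
    finally have "?s ^ k * ?s dvd ?s ^ k * (\<Sum>c<r. C $$ (a, c) * w c)" by (simp only: power_Suc mult.commute)
    then show ?thesis by (subst (asm) dvd_mult_cancel_left) auto
  qed
  define C0 where "C0 = map_mat (\<lambda>q. poly q x) C"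
  define v where "v = vec r (\<lambda>c. poly (w c) x)"
  have "C0 *\<^sub>v v = 0\<^sub>v r"
  proof (rule eq_vecI)
    fix a assume "a < dim_vec (0\<^sub>v r :: 'a vec)"
    then have a: "a < r" by simp
    have "(C0 *\<^sub>v v) $ a = poly (\<Sum>c<r. C $$ (a, c) * w c) x"
      using a * by (simp add: C0_def v_def scalar_prod_def poly_sum atLeast0LessThan)
    then show "(C0 *\<^sub>v v) $ a = 0\<^sub>v r $ a" using dvd[OF a] a by (simp add: poly_eq_0_iff_dvd)
  qed (use * in \<open>auto simp: C0_def\<close>)
  moreover have "v \<noteq> 0\<^sub>v r"
    using w(2) by (metis v_def index_vec index_zero_vec(1))
  moreover have "v \<in> carrier_vec r" "C0 \<in> carrier_mat r r" using * by (auto simp: v_def C0_def)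
  ultimately have "det C0 = 0" using det_0_iff_vec_prod_zero_field by blast
  then have "poly (det C) x = 0" unfolding C0_def by (simp add: comm_ring_hom.hom_det[OF poly_hom.comm_ring_hom_axioms])
  then show False using * by (simp add: poly_eq_0_iff_dvd)
qed

lemma poly_prod_list_map: "poly (prod_list ps) x = prod_list (map (\<lambda>q. poly q x) ps)"
  by (induction ps) auto

lemma local_size_rect_diag:
  fixes ds :: "'a::field poly list"
  assumes len: "length ds = min m p"
  shows "local_size (card {i. i < length ds \<and> ds ! i \<noteq> 0 \<and> order x (ds ! i) \<le> k}) [:-x, 1:]
           (rect_diag m p ds) k"
proof -
  let ?s = "[:-x, 1:]" and ?D = "rect_diag m p ds"
  define I where "I = {i. i < length ds \<and> ds ! i \<noteq> 0 \<and> order x (ds ! i) \<le> k}"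
  define r where "r = card I"
  define js where "js = sorted_list_of_set I"
  have "finite I" by (simp add: I_def)
  then have js: "length js = r" "set js = I" "distinct js" by (auto simp: js_def r_def)
  have jsI: "js ! a \<in> I" if "a < r" for a using that js by (metis nth_mem)
  have js_eq: "js ! a = js ! b \<longleftrightarrow> a = b" if "a < r" "b < r" for a b
    using that js by (simp add: nth_eq_iff_index_eq)
  have "\<forall>i\<in>I. \<exists>q. ds ! i = ?s ^ order x (ds ! i) * q \<and> poly q x \<noteq> 0"
    unfolding I_def using order_factor by blast
  then obtain q where q: "\<And>i. i \<in> I \<Longrightarrow> ds ! i = ?s ^ order x (ds ! i) * q i \<and> poly (q i) x \<noteq> 0"
    by metis
  \<comment> \<open>\<open>W\<close> selects the columns with index in \<open>I\<close>;
    \<open>U\<close> selects the rows and pads each entry up to order exactly \<open>k\<close>,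
    leaving cofactors that do not vanish at \<open>x\<close>.\<close>
  define U where "U = mat r m (\<lambda>(a, i). if i = js ! a then ?s ^ (k - order x (ds ! i)) else 0)"
  define W where "W = mat p r (\<lambda>(i, a). if i = js ! a then 1 else (0 :: 'a poly))"
  define C where "C = mat r r (\<lambda>(a, b). if a = b then q (js ! a) else 0)"
  have "U * ?D * W = ?s ^ k \<cdot>\<^sub>m C"
  proof (rule eq_matI)
    fix a b assume "a < dim_row (?s ^ k \<cdot>\<^sub>m C)" "b < dim_col (?s ^ k \<cdot>\<^sub>m C)"
    then have a: "a < r" and b: "b < r" by (auto simp: C_def)
    have UW: "U \<in> carrier_mat r m" "W \<in> carrier_mat p r" by (auto simp: U_def W_def)
    have lt: "js ! a < min m p" using jsI[OF a] len by (auto simp: I_def)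
    have "(U * ?D * W) $$ (a, b) =
        (\<Sum>i<min m p. if i = js ! a then ?s ^ (k - order x (ds ! i)) * ds ! i * (if a = b then 1 else 0) else 0)"
      unfolding mult_rect_diag_index[OF UW a b]
      by (intro sum.cong refl) (use a b js_eq[OF a b] in \<open>auto simp: U_def W_def\<close>)
    also have "\<dots> = ?s ^ (k - order x (ds ! (js ! a))) * ds ! (js ! a) * (if a = b then 1 else 0)"
      using lt by simp
    also have "?s ^ (k - order x (ds ! (js ! a))) * ds ! (js ! a) =
        ?s ^ (k - order x (ds ! (js ! a))) * (?s ^ order x (ds ! (js ! a)) * q (js ! a))"
      using q[OF jsI[OF a]] by simp
    also have "\<dots> = ?s ^ k * q (js ! a)"
      using jsI[OF a] by (simp add: I_def mult.assoc[symmetric] power_add[symmetric] del: mult_pCons_left)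
    finally show "(U * ?D * W) $$ (a, b) = (?s ^ k \<cdot>\<^sub>m C) $$ (a, b)"
      using a b by (simp add: C_def)
  qed (auto simp: U_def W_def C_def)
  moreover have "\<not> ?s dvd det C"
  proof -
    have "det C = prod_list (diag_mat C)"
      by (rule det_upper_triangular) (auto simp: C_def)
    moreover have "poly (prod_list (diag_mat C)) x \<noteq> 0"
      using q[OF jsI] by (auto simp: poly_prod_list_map prod_list_zero_iff diag_mat_def C_def)
    ultimately show ?thesis by (simp add: poly_eq_0_iff_dvd)
  qed
  moreover have "U \<in> carrier_mat r m" "W \<in> carrier_mat p r" "C \<in> carrier_mat r r"
    by (auto simp: U_def W_def C_def)
  ultimately show ?thesis
    unfolding local_size_def r_def[symmetric] I_def[symmetric] rect_diag_dims by blast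
qed

text \<open>Order 0 is kept: the multiset then also records the number of nonzero diagonal entries,
  and the zeros are dropped only when elementary divisors are read off.\<close>

definition diag_orders :: "'a::field \<Rightarrow> 'a poly list \<Rightarrow> nat multiset" where
  "diag_orders x ds = {#order x q. q \<in># {#q \<in># mset ds. q \<noteq> 0#}#}"

lemma multiset_eqI_size_filter_le:
  fixes M N :: "nat multiset"
  assumes "\<And>k. size {#x \<in># M. x \<le> k#} = size {#x \<in># N. x \<le> k#}"
  shows "M = N"
proof (rule multiset_eqI)
  have *: "size {#x \<in># K. x \<le> Suc j#} = count K (Suc j) + size {#x \<in># K. x \<le> j#}"
    "size {#x \<in># K. x \<le> 0#} = count K 0" for K :: "nat multiset" and j
    by (induction K) auto
  show "count M j = count N j" for j
    using assms[of j] assms[of "j - 1"] *(1)[of "j - 1" M] *(1)[of "j - 1" N] *(2)[of M] *(2)[of N]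
    by (cases j) (simp_all only: diff_Suc_1 add_right_cancel)
qed

lemma size_filter_mset_nth: "size {#x \<in># mset xs. Q x#} = card {i. i < length xs \<and> Q (xs ! i)}"
  by (simp add: length_filter_conv_card flip: mset_filter)

lemma diag_orders_unique:
  fixes P :: "'a::field poly mat"
  assumes P: "P \<in> carrier_mat m p"
    and "A \<in> carrier_mat m m" "B \<in> carrier_mat p p" "A' \<in> carrier_mat m m" "B' \<in> carrier_mat p p"
    and "poly (det A) x \<noteq> 0" "poly (det B) x \<noteq> 0" "poly (det A') x \<noteq> 0" "poly (det B') x \<noteq> 0"
    and eq: "A * P * B = rect_diag m p ds" "A' * P * B' = rect_diag m p ds'"
    and len: "length ds = min m p" "length ds' = min m p"
  shows "diag_orders x ds = diag_orders x ds'"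
proof (rule multiset_eqI_size_filter_le)
  fix k
  have prime: "prime_elem [:-x, 1:]" by (rule prime_elem_linear_field_poly) simp
  have *: "local_size r [:-x, 1:] (rect_diag m p ds) k \<longleftrightarrow> local_size r [:-x, 1:] (rect_diag m p ds') k" for r
    unfolding eq[symmetric]
    using local_size_mult[OF P assms(2,3) prime] local_size_mult[OF P assms(4,5) prime] assms(6-9)
    by (simp add: poly_eq_0_iff_dvd del: assoc_mult_mat)
  have size: "size {#e \<in># diag_orders x es. e \<le> k#} =
      card {i. i < length es \<and> es ! i \<noteq> 0 \<and> order x (es ! i) \<le> k}" for es
    unfolding diag_orders_def
    by (simp add: filter_mset_image_mset filter_filter_mset size_filter_mset_nth conj_commute)
  show "size {#e \<in># diag_orders x ds. e \<le> k#} = size {#e \<in># diag_orders x ds'. e \<le> k#}"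
    unfolding size using * local_size_rect_diag[OF len(1), of x k] local_size_rect_diag[OF len(2), of x k]
      local_size_rect_diag_le[OF len(1), of _ x k] local_size_rect_diag_le[OF len(2), of _ x k]
    by (metis (no_types, lifting) le_antisym)
qed

section \<open>Smith form: existence\<close>

lemma unimodular_one [simp]: "unimodular k (1\<^sub>m k)"
  by (auto simp: unimodular_def intro!: exI[of _ 1] simp flip: one_pCons)

lemma unimodular_carrier: "unimodular k A \<Longrightarrow> A \<in> carrier_mat k k"
  by (simp add: unimodular_def)

lemma unimodular_mult:
  assumes "unimodular k A" "unimodular k B"
  shows "unimodular k (A * B)"
proof -
  from assms obtain a b where "A \<in> carrier_mat k k" "B \<in> carrier_mat k k"
    "a \<noteq> 0" "b \<noteq> 0" "det A = [:a:]" "det B = [:b:]" by (auto simp: unimodular_def)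
  then show ?thesis
    by (auto simp: unimodular_def det_mult intro!: exI[of _ "a * b"])
qed

text \<open>Extends a transformation of the lower right block to the whole matrix; the constant
  \<open>c\<close> serves to make the pivot monic.\<close>

lemma unimodular_const_block:
  assumes "unimodular k A" "c \<noteq> 0"
  shows "unimodular (Suc k) (four_block_mat (mat 1 1 (\<lambda>_. [:c:])) (0\<^sub>m 1 k) (0\<^sub>m k 1) A)"
proof -
  from assms obtain a where a: "A \<in> carrier_mat k k" "a \<noteq> 0" "det A = [:a:]"
    by (auto simp: unimodular_def)
  have "det (four_block_mat (mat 1 1 (\<lambda>_. [:c:])) (0\<^sub>m 1 k) (0\<^sub>m k 1) A) = [:c * a:]"
    using a by (subst det_four_block_mat_lower_left_zero[of _ 1 _ k]) (auto simp: det_single)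
  then show ?thesis using a assms(2)
    by (auto simp: unimodular_def intro!: exI[of _ "c * a"])
qed

lemma unimodular_swaprows_mat: "k < n \<Longrightarrow> l < n \<Longrightarrow> unimodular n (swaprows_mat n k l :: 'a::field poly mat)"
proof (cases "k = l")
  case True
  then have "swaprows_mat n k l = (1\<^sub>m n :: 'a poly mat)" by (intro eq_matI) auto
  then show ?thesis by simp
next
  case False
  assume "k < n" "l < n"
  then have "det (swaprows_mat n k l :: 'a poly mat) = [:-1:]"
    using False by (simp add: det_swaprows_mat one_pCons)
  then show ?thesis by (auto simp: unimodular_def swaprows_mat_def)
qed

lemma unimodular_addrow_mat: "k \<noteq> l \<Longrightarrow> unimodular n (addrow_mat n a k l)"
  by (auto simp: unimodular_def det_addrow_mat intro!: exI[of _ 1] simp flip: one_pCons)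

definition smith_equiv :: "nat \<Rightarrow> nat \<Rightarrow> 'a::field poly mat \<Rightarrow> 'a poly mat \<Rightarrow> bool" where
  "smith_equiv m p P Q \<longleftrightarrow> P \<in> carrier_mat m p \<and> (\<exists>A B. unimodular m A \<and> unimodular p B \<and> A * P * B = Q)"

lemma smith_equivI:
  "P \<in> carrier_mat m p \<Longrightarrow> unimodular m A \<Longrightarrow> unimodular p B \<Longrightarrow> smith_equiv m p P (A * P * B)"
  unfolding smith_equiv_def by blast

lemma smith_equivE:
  assumes "smith_equiv m p P Q"
  obtains A B where "unimodular m A" "unimodular p B" "A * P * B = Q"
  using assms unfolding smith_equiv_def by blast

lemma smith_equiv_carrier:
  assumes "smith_equiv m p P Q"
  shows "P \<in> carrier_mat m p" "Q \<in> carrier_mat m p"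
  using assms unfolding smith_equiv_def by (auto dest!: unimodular_carrier)

lemma smith_equiv_refl: "P \<in> carrier_mat m p \<Longrightarrow> smith_equiv m p P P"
  using smith_equivI[OF _ unimodular_one unimodular_one, of P m p] by simp

lemma smith_equiv_trans:
  assumes "smith_equiv m p P Q" "smith_equiv m p Q R"
  shows "smith_equiv m p P R"
proof -
  from assms(1) obtain A B where 1: "unimodular m A" "unimodular p B" "A * P * B = Q" by (rule smith_equivE)
  from assms(2) obtain A' B' where 2: "unimodular m A'" "unimodular p B'" "A' * Q * B' = R" by (rule smith_equivE)
  have P: "P \<in> carrier_mat m p" using assms smith_equiv_carrier by blast
  have "R = (A' * A) * P * (B * B')"
    unfolding 2(3)[symmetric] 1(3)[symmetric]
    using mult_mat_assoc5[OF 2(1)[THEN unimodular_carrier] 1(1)[THEN unimodular_carrier] P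
        1(2)[THEN unimodular_carrier] 2(2)[THEN unimodular_carrier]] .
  then show ?thesis
    using smith_equivI[OF P unimodular_mult[OF 2(1) 1(1)] unimodular_mult[OF 1(2) 2(2)]] by simp
qed

lemma smith_equiv_left:
  assumes "smith_equiv m p P Q" "unimodular m A"
  shows "smith_equiv m p P (A * Q)"
proof -
  note Q = smith_equiv_carrier(2)[OF assms(1)]
  have "A * Q * 1\<^sub>m p = A * Q"
    by (rule right_mult_one_mat[OF mult_carrier_mat[OF unimodular_carrier[OF assms(2)] Q]])
  with smith_equiv_trans[OF assms(1) smith_equivI[OF Q assms(2) unimodular_one]]
  show ?thesis by (simp only:)
qed

lemma smith_equiv_right:
  assumes "smith_equiv m p P Q" "unimodular p B"
  shows "smith_equiv m p P (Q * B)"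
proof -
  note Q = smith_equiv_carrier(2)[OF assms(1)]
  from smith_equiv_trans[OF assms(1) smith_equivI[OF Q unimodular_one assms(2)]]
  show ?thesis unfolding left_mult_one_mat[OF Q] .
qed

lemma smith_equiv_swaprows:
  "smith_equiv m p P Q \<Longrightarrow> k < m \<Longrightarrow> l < m \<Longrightarrow> smith_equiv m p P (swaprows k l Q)"
  using smith_equiv_left[OF _ unimodular_swaprows_mat] swaprows_mat smith_equiv_carrier by metis

lemma smith_equiv_swapcols:
  "smith_equiv m p P Q \<Longrightarrow> k < p \<Longrightarrow> l < p \<Longrightarrow> smith_equiv m p P (swapcols k l Q)"
  using smith_equiv_right[OF _ unimodular_swaprows_mat] swapcols_mat smith_equiv_carrier by metis

lemma smith_equiv_addrow:
  "smith_equiv m p P Q \<Longrightarrow> k \<noteq> l \<Longrightarrow> l < m \<Longrightarrow> smith_equiv m p P (addrow a k l Q)"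
  using smith_equiv_left[OF _ unimodular_addrow_mat] addrow_mat smith_equiv_carrier by metis

lemma smith_equiv_addcol:
  "smith_equiv m p P Q \<Longrightarrow> k \<noteq> l \<Longrightarrow> l < p \<Longrightarrow> smith_equiv m p P (addcol a k l Q)"
  using smith_equiv_right[OF _ unimodular_addrow_mat[of l k p a]] addcol_mat smith_equiv_carrier by metis

text \<open>An entry of minimal degree among all entries of all equivalent matrices divides its column and
  its row, as otherwise division with remainder would produce an entry of smaller degree.\<close>

lemma exists_smith_pivot:
  fixes P :: "'a::field poly mat"
  assumes P: "P \<in> carrier_mat m p" and nz: "P \<noteq> 0\<^sub>m m p"
  obtains Q where "smith_equiv m p P Q" "Q $$ (0, 0) \<noteq> 0"
    "\<And>R i. smith_equiv m p P R \<Longrightarrow> R $$ (0, 0) = Q $$ (0, 0) \<Longrightarrow> i < m \<Longrightarrow> Q $$ (0, 0) dvd R $$ (i, 0)"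
    "\<And>R j. smith_equiv m p P R \<Longrightarrow> R $$ (0, 0) = Q $$ (0, 0) \<Longrightarrow> j < p \<Longrightarrow> Q $$ (0, 0) dvd R $$ (0, j)"
proof -
  let ?ok = "\<lambda>Q. smith_equiv m p P Q \<and> Q $$ (0, 0) \<noteq> 0"
  from nz P obtain i j where ij: "i < m" "j < p" "P $$ (i, j) \<noteq> 0"
    by (metis (no_types, lifting) carrier_matD eq_matI index_zero_mat)
  \<comment> \<open>Swaps carry any nonzero entry to the corner, so minimality of the corner degree
    is minimality over all entries.\<close>
  have front: "?ok (swaprows 0 i (swapcols 0 j R)) \<and> swaprows 0 i (swapcols 0 j R) $$ (0, 0) = R $$ (i, j)"
    if "smith_equiv m p P R" "i < m" "j < p" "R $$ (i, j) \<noteq> 0" for R i j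
  proof -
    have R: "R \<in> carrier_mat m p" using that smith_equiv_carrier by blast
    have "swaprows 0 i (swapcols 0 j R) $$ (0, 0) = R $$ (i, j)" using that R by auto
    moreover have "smith_equiv m p P (swaprows 0 i (swapcols 0 j R))"
      using that by (intro smith_equiv_swaprows smith_equiv_swapcols) auto
    ultimately show ?thesis using that by simp
  qed
  then have "\<exists>Q. ?ok Q" using ij smith_equiv_refl[OF P] by blast
  then obtain Q where Q: "?ok Q" and least: "\<And>R. ?ok R \<Longrightarrow> degree (Q $$ (0, 0)) \<le> degree (R $$ (0, 0))"
    using ex_has_least_nat[of ?ok _ "\<lambda>Q. degree (Q $$ (0, 0))"] by blast
  have least': "degree (Q $$ (0, 0)) \<le> degree (R $$ (i, j))"
    if "smith_equiv m p P R" "i < m" "j < p" "R $$ (i, j) \<noteq> 0" for R i j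
    using front[OF that] least by metis
  have divides: "c dvd q" if "c \<noteq> 0" "q mod c \<noteq> 0 \<Longrightarrow> degree c \<le> degree (q mod c)" for c q :: "'a poly"
    using that degree_mod_less'[of c q] by (force simp: dvd_eq_mod_eq_0)
  show ?thesis
  proof (rule that[of Q])
    fix R i assume R: "smith_equiv m p P R" "R $$ (0, 0) = Q $$ (0, 0)" and i: "i < m"
    note car = smith_equiv_carrier(2)[OF R(1)]
    show "Q $$ (0, 0) dvd R $$ (i, 0)"
    proof (cases "i = 0")
      case False
      let ?R = "addrow (- (R $$ (i, 0) div Q $$ (0, 0))) i 0 R"
      have "?R $$ (i, 0) = R $$ (i, 0) mod Q $$ (0, 0)"
        using i car ij R(2) by (simp add: minus_div_mult_eq_mod[symmetric])
      moreover have "smith_equiv m p P ?R" using R i False by (intro smith_equiv_addrow) auto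
      ultimately show ?thesis using least'[of ?R i 0] i ij Q by (intro divides) auto
    qed (use R in simp)
  next
    fix R j assume R: "smith_equiv m p P R" "R $$ (0, 0) = Q $$ (0, 0)" and j: "j < p"
    note car = smith_equiv_carrier(2)[OF R(1)]
    show "Q $$ (0, 0) dvd R $$ (0, j)"
    proof (cases "j = 0")
      case False
      let ?R = "addcol (- (R $$ (0, j) div Q $$ (0, 0))) j 0 R"
      have "?R $$ (0, j) = R $$ (0, j) mod Q $$ (0, 0)"
        using j car ij R(2) by (simp add: minus_div_mult_eq_mod[symmetric])
      moreover have "smith_equiv m p P ?R" using R j False by (intro smith_equiv_addcol) auto
      ultimately show ?thesis using least'[of ?R 0 j] j ij Q by (intro divides) auto
    qed (use R in simp)
  qed (use Q in auto)
qed

text \<open>Left multiplication by this matrix adds \<open>c i\<close> times row 0 to every row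
  \<open>i > 0\<close> at once; it is lower triangular with unit diagonal. Its transpose, acting
  from the right, clears row 0.\<close>

lemma unimodular_clear_column:
  "unimodular m (mat m m (\<lambda>(i, k). if i = k then 1 else if k = 0 then c i else 0))" (is "unimodular m ?L")
proof -
  have "det ?L = prod_list (diag_mat ?L)"
    by (rule det_lower_triangular[of m]) auto
  also have "diag_mat ?L = map (\<lambda>_. 1) [0..<m]" by (auto simp: diag_mat_def)
  finally have "det ?L = 1" by (simp add: map_replicate_const)
  then show ?thesis by (auto simp: unimodular_def intro!: exI[of _ 1] simp flip: one_pCons)
qed

lemma unimodular_transpose: "unimodular k A \<Longrightarrow> unimodular k (transpose_mat A)"
  by (auto simp: unimodular_def det_transpose)

lemma clear_column_index:
  fixes Q :: "'a::comm_ring_1 mat"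
  assumes "Q \<in> carrier_mat m p" "i < m" "j < p"
  shows "(mat m m (\<lambda>(i, k). if i = k then 1 else if k = 0 then c i else 0) * Q) $$ (i, j) =
    Q $$ (i, j) + (if i = 0 then 0 else c i * Q $$ (0, j))"
proof -
  let ?L = "mat m m (\<lambda>(i, k). if i = k then 1 else if k = 0 then c i else 0)"
  have "(?L * Q) $$ (i, j) = (\<Sum>k<m. ?L $$ (i, k) * Q $$ (k, j))"
    by (rule mat_mult_index[OF _ assms(1-3)]) simp
  also have "\<dots> = (\<Sum>k<m. (if k = i then Q $$ (i, j) else 0) + (if k = 0 then (if i = 0 then 0 else c i * Q $$ (0, j)) else 0))"
    using assms by (intro sum.cong) auto
  also have "\<dots> = Q $$ (i, j) + (if i = 0 then 0 else c i * Q $$ (0, j))"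
    using assms by (simp add: sum.distrib)
  finally show ?thesis .
qed

text \<open>The pivot property speaks of all equivalent matrices with the same corner because it is
  applied again after each change: to \<open>Q\<close> for the column, to \<open>M\<close> for the
  row, and to \<open>N\<close> with a row added to row 0 for the other entries.\<close>

lemma exists_smith_step:
  fixes P :: "'a::field poly mat"
  assumes P: "P \<in> carrier_mat m p" and nz: "P \<noteq> 0\<^sub>m m p"
  obtains N where "smith_equiv m p P N" "N $$ (0, 0) \<noteq> 0"
    "\<And>i. 0 < i \<Longrightarrow> i < m \<Longrightarrow> N $$ (i, 0) = 0" "\<And>j. 0 < j \<Longrightarrow> j < p \<Longrightarrow> N $$ (0, j) = 0"
    "\<And>i j. i < m \<Longrightarrow> j < p \<Longrightarrow> N $$ (0, 0) dvd N $$ (i, j)"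
proof -
  from exists_smith_pivot[OF P nz] obtain Q where Q: "smith_equiv m p P Q" "Q $$ (0, 0) \<noteq> 0"
    "\<And>R i. smith_equiv m p P R \<Longrightarrow> R $$ (0, 0) = Q $$ (0, 0) \<Longrightarrow> i < m \<Longrightarrow> Q $$ (0, 0) dvd R $$ (i, 0)"
    "\<And>R j. smith_equiv m p P R \<Longrightarrow> R $$ (0, 0) = Q $$ (0, 0) \<Longrightarrow> j < p \<Longrightarrow> Q $$ (0, 0) dvd R $$ (0, j)"
    by metis
  have pos: "0 < m" "0 < p" using P nz by (auto intro!: eq_matI gr0I)
  let ?a = "Q $$ (0, 0)"
  define L where "L = mat m m (\<lambda>(i, k). if i = k then 1 else if k = 0 then - (Q $$ (i, 0) div ?a) else 0)"
  define M where "M = L * Q"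
  define L' where "L' = mat p p (\<lambda>(i, k). if i = k then 1 else if k = 0 then - (M $$ (0, i) div ?a) else 0)"
  define N where "N = M * transpose_mat L'"
  have Qc: "Q \<in> carrier_mat m p" using Q smith_equiv_carrier by blast
  have M: "smith_equiv m p P M" unfolding M_def L_def
    by (intro smith_equiv_left Q unimodular_clear_column)
  have N: "smith_equiv m p P N" unfolding N_def L'_def
    by (intro smith_equiv_right M unimodular_transpose unimodular_clear_column)
  have Mc: "M \<in> carrier_mat m p" and Nc: "N \<in> carrier_mat m p" using M N smith_equiv_carrier by blast+
  have Mi: "M $$ (i, j) = Q $$ (i, j) + (if i = 0 then 0 else - (Q $$ (i, 0) div ?a) * Q $$ (0, j))"
    if "i < m" "j < p" for i j
    unfolding M_def L_def clear_column_index[OF Qc that] ..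
  have L'c: "transpose_mat L' \<in> carrier_mat p p" by (simp add: L'_def)
  \<comment> \<open>The column operation is read as a row operation on the transpose, so that
    \<open>clear_column_index\<close> applies to it.\<close>
  have "transpose_mat N = L' * transpose_mat M"
    unfolding N_def using transpose_mult[OF Mc L'c] by simp
  note trN = this
  have Ni: "N $$ (i, j) = M $$ (i, j) + (if j = 0 then 0 else - (M $$ (0, j) div ?a) * M $$ (i, 0))"
    if "i < m" "j < p" for i j
  proof -
    have Mt: "transpose_mat M \<in> carrier_mat p m" using Mc by simp
    have "N $$ (i, j) = transpose_mat N $$ (j, i)" using Nc that by simp
    also have "\<dots> = (L' * transpose_mat M) $$ (j, i)" by (simp only: trN)
    also have "\<dots> = transpose_mat M $$ (j, i) +
        (if j = 0 then 0 else - (M $$ (0, j) div ?a) * transpose_mat M $$ (0, i))"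
      unfolding L'_def by (rule clear_column_index[OF Mt that(2,1)])
    finally show ?thesis using Mc that pos by simp
  qed
  have M00: "M $$ (0, 0) = ?a" using Mi pos by simp
  have Mcol: "M $$ (i, 0) = 0" if "0 < i" "i < m" for i
    using Mi[of i 0] that pos Q(3)[OF Q(1) refl, of i] by simp
  have N00: "N $$ (0, 0) = ?a" using Ni pos M00 by simp
  have Ncol: "N $$ (i, 0) = 0" if "0 < i" "i < m" for i
    using Ni[of i 0] that pos Mcol by simp
  have Nrow: "N $$ (0, j) = 0" if "0 < j" "j < p" for j
    using Ni[of 0 j] that pos Q(4)[OF M M00, of j] M00 by simp
  show ?thesis
  proof (rule that[of N])
    fix i j assume i: "i < m" and j: "j < p"
    show "N $$ (0, 0) dvd N $$ (i, j)"
    proof (cases "i = 0")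
      case True
      then show ?thesis using Q(4)[OF N N00 j] N00 by simp
    next
      case False
      \<comment> \<open>Adding row \<open>i\<close> to row 0 keeps the corner, since column 0 is
        already cleared, and puts \<open>N $$ (i, j) + N $$ (0, j)\<close> into row 0, where the
        pivot divides it.\<close>
      let ?R = "addrow 1 0 i N"
      have R: "smith_equiv m p P ?R" using N i False by (intro smith_equiv_addrow) auto
      have "?R $$ (0, 0) = ?a" using Nc i pos N00 Ncol False by simp
      from Q(4)[OF R this j] have "?a dvd N $$ (i, j) + N $$ (0, j)" using Nc pos i j by simp
      moreover have "?a dvd N $$ (0, j)" using Q(4)[OF N N00 j] .
      ultimately show ?thesis using N00 by (simp add: dvd_add_left_iff)
    qed
  qed (use Q N N00 Ncol Nrow in auto)
qed

lemma exists_smith_diagonal: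
  fixes P :: "'a::field poly mat"
  assumes "P \<in> carrier_mat m p"
  shows "\<exists>ds. length ds = min m p \<and> (\<forall>q\<in>set ds. q = 0 \<or> lead_coeff q = 1) \<and>
     (\<forall>i. Suc i < length ds \<longrightarrow> ds ! i dvd ds ! Suc i) \<and> smith_equiv m p P (rect_diag m p ds)"
  using assms
proof (induction m arbitrary: p P)
  case 0
  then have "P = rect_diag 0 p []" by (intro eq_matI) auto
  then show ?case using smith_equiv_refl[OF 0] by (intro exI[of _ "[]"]) auto
next
  case (Suc m)
  show ?case
  proof (cases "P = 0\<^sub>m (Suc m) p")
    case True
    let ?ds = "replicate (min (Suc m) p) (0 :: 'a poly)"
    have "P = rect_diag (Suc m) p ?ds" using True by (intro eq_matI) auto
    then show ?thesis using smith_equiv_refl[OF Suc.prems]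
      by (intro exI[of _ "?ds"]) (auto simp del: replicate_Suc)
  next
    case False
    from exists_smith_step[OF Suc.prems False] obtain N where N: "smith_equiv (Suc m) p P N" "N $$ (0, 0) \<noteq> 0"
      "\<And>i. 0 < i \<Longrightarrow> i < Suc m \<Longrightarrow> N $$ (i, 0) = 0" "\<And>j. 0 < j \<Longrightarrow> j < p \<Longrightarrow> N $$ (0, j) = 0"
      "\<And>i j. i < Suc m \<Longrightarrow> j < p \<Longrightarrow> N $$ (0, 0) dvd N $$ (i, j)" by metis
    have "p \<noteq> 0" using False Suc.prems by (auto intro!: eq_matI)
    then obtain p' where p: "p = Suc p'" by (cases p) auto
    have Nc: "N \<in> carrier_mat (Suc m) (Suc p')" using smith_equiv_carrier(2)[OF N(1)] p by simp
    let ?a = "N $$ (0, 0)"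
    define D where "D = mat m p' (\<lambda>(i, j). N $$ (Suc i, Suc j))"
    have Dc: "D \<in> carrier_mat m p'" by (simp add: D_def)
    have N_eq: "N = four_block_mat (mat 1 1 (\<lambda>_. ?a)) (0\<^sub>m 1 p') (0\<^sub>m m 1) D"
      using Nc N(3,4) p by (intro eq_matI) (auto simp: D_def)
    from Suc.IH[OF Dc] obtain ds where ds: "length ds = min m p'" "\<forall>q\<in>set ds. q = 0 \<or> lead_coeff q = 1"
      "\<forall>i. Suc i < length ds \<longrightarrow> ds ! i dvd ds ! Suc i" "smith_equiv m p' D (rect_diag m p' ds)" by blast
    from ds(4) obtain A B where AB: "unimodular m A" "unimodular p' B" "A * D * B = rect_diag m p' ds"
      by (rule smith_equivE)
    note Ac = unimodular_carrier[OF AB(1)] and Bc = unimodular_carrier[OF AB(2)]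
    let ?c = "inverse (lead_coeff ?a)"
    define q where "q = [:?c:] * ?a"
    let ?A = "four_block_mat (mat 1 1 (\<lambda>_. [:?c:])) (0\<^sub>m 1 m) (0\<^sub>m m 1) A"
    let ?B = "four_block_mat (mat 1 1 (\<lambda>_. [:1:])) (0\<^sub>m 1 p') (0\<^sub>m p' 1) B"
    have "?A * four_block_mat (mat 1 1 (\<lambda>_. y)) (0\<^sub>m 1 p') (0\<^sub>m m 1) D * ?B =
        four_block_mat (mat 1 1 (\<lambda>_. [:?c:] * y)) (0\<^sub>m 1 p') (0\<^sub>m m 1) (A * D * B)" for y
      apply (subst mult_four_block_mat[of _ 1 1 _ m _ m _ _ 1 _ p'])
      using Ac Dc apply (auto simp del: assoc_mult_mat)[8]
      apply (subst mult_four_block_mat[of _ 1 1 _ p' _ m _ _ 1 _ p'])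
      using Ac Bc Dc apply (auto simp del: assoc_mult_mat)[8]
      using Ac Bc Dc
      apply (intro cong_four_block_mat)
         apply (intro eq_matI; auto simp: scalar_prod_def simp del: assoc_mult_mat)
        apply (auto simp: left_add_zero_mat right_add_zero_mat simp del: assoc_mult_mat)
      done
    from this[of ?a]
    have "?A * N * ?B = four_block_mat (mat 1 1 (\<lambda>_. q)) (0\<^sub>m 1 p') (0\<^sub>m m 1) (rect_diag m p' ds)"
      unfolding N_eq[symmetric] AB(3) q_def .
    also have "\<dots> = rect_diag (Suc m) p (q # ds)"
      by (intro eq_matI) (auto simp: p nth_Cons')
    finally have "smith_equiv (Suc m) p N (rect_diag (Suc m) p (q # ds))"
      using smith_equivI[OF Nc unimodular_const_block[OF AB(1), of ?c] unimodular_const_block[OF AB(2), of 1]] N(2)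
      by (simp only: p) simp
    then have "smith_equiv (Suc m) p P (rect_diag (Suc m) p (q # ds))"
      using smith_equiv_trans N(1) by blast
    moreover have "lead_coeff q = 1" using N(2) by (simp add: q_def)
    moreover have "q dvd ds ! 0" if "0 < length ds"
    proof -
      \<comment> \<open>The pivot divides all entries of the remaining block, hence all polynomial
        combinations of them, among these the first diagonal entry of the reduced block. This
        continues the divisibility chain.\<close>
      have D: "?a dvd D $$ (i, j)" if "i < m" "j < p'" for i j
        using N(5)[of "Suc i" "Suc j"] that p by (simp add: D_def)
      have "?a dvd (A * D * B) $$ (0, 0)"
        using that ds(1) D
        by (subst mat_mult3_index[OF Ac Dc Bc])
          (auto intro!: dvd_sum dvd_mult2[OF dvd_sum] intro: dvd_mult)
      then have "?a dvd ds ! 0" using that ds(1) by (simp add: AB(3) del: assoc_mult_mat)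
      then show ?thesis using N(2) by (simp add: q_def smult_dvd_iff)
    qed
    ultimately show ?thesis
      using ds(1-3) p by (intro exI[of _ "q # ds"]) (auto simp: nth_Cons' gr0_conv_Suc)
  qed
qed

section \<open>Smith form: uniqueness\<close>

text \<open>A root of one polynomial is a root of the other because the orders agree; cancelling
  common linear factors ends at two monic constants.\<close>

lemma monic_eqI_order:
  fixes p q :: "'a::alg_closed_field poly"
  assumes "lead_coeff p = 1" "lead_coeff q = 1" "\<And>x. order x p = order x q"
  shows "p = q"
  using assms
proof (induction "degree p" arbitrary: p q)
  case 0
  have "degree q = 0"
  proof (rule ccontr)
    assume "degree q \<noteq> 0"
    then obtain x where x: "poly q x = 0" using alg_closed_imp_poly_has_root[of q] by auto
    have "poly p x \<noteq> 0" using 0 by (auto elim!: degree_eq_zeroE)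
    moreover have "p \<noteq> 0" "q \<noteq> 0" using 0 by auto
    ultimately show False using x 0(4)[of x] by (simp add: order_root)
  qed
  then show ?case using 0 by (auto elim!: degree_eq_zeroE)
next
  case (Suc k)
  then obtain x where x: "poly p x = 0" using alg_closed_imp_poly_has_root[of p] by auto
  have nz: "p \<noteq> 0" "q \<noteq> 0" using Suc.prems by auto
  have "poly q x = 0" using x Suc.prems(3)[of x] nz by (simp add: order_root)
  with x obtain p' q' where eq: "p = [:-x, 1:] * p'" "q = [:-x, 1:] * q'"
    by (auto simp: poly_eq_0_iff_dvd elim!: dvdE)
  have nz': "p' \<noteq> 0" "q' \<noteq> 0" using nz eq by auto
  have "degree p = Suc (degree p')" using nz' by (simp add: eq(1) degree_mult_eq del: mult_pCons_left)
  then have "k = degree p'" using Suc.hyps(2) by simp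
  moreover have "lead_coeff p' = 1" "lead_coeff q' = 1"
    using Suc.prems(1,2) unfolding eq lead_coeff_mult by simp_all
  moreover have "order y p' = order y q'" for y
    using Suc.prems(3)[of y] nz unfolding eq order_mult[OF nz(1)[unfolded eq]] order_mult[OF nz(2)[unfolded eq]]
    by simp
  ultimately have "p' = q'" by (rule Suc.hyps(1))
  then show ?case using eq by simp
qed

text \<open>Zero divides only zero, so in a divisibility chain the zeros stand at the end, and the
  nonzero part together with the length determines the list.\<close>

lemma sorted_wrt_dvd_eq_filter_append_zeros:
  fixes ds :: "'b::idom list"
  assumes "sorted_wrt (dvd) ds"
  shows "ds = filter (\<lambda>q. q \<noteq> 0) ds @ replicate (length ds - length (filter (\<lambda>q. q \<noteq> 0) ds)) 0"
  using assms
proof (induction ds)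
  case (Cons d ds)
  show ?case
  proof (cases "d = 0")
    case True
    with Cons.prems have "\<forall>q\<in>set ds. q = 0" by auto
    then have "filter (\<lambda>q. q \<noteq> 0) ds = []" "ds = replicate (length ds) 0"
      by (auto simp: filter_empty_conv intro!: replicate_eqI)
    then show ?thesis using True by simp
  qed (use Cons in simp)
qed simp

text \<open>Because of this, a multiset of orders determines the list of orders, which ties the data
  from different points to the same positions.\<close>

lemma sorted_wrt_dvd_sorted_orders:
  fixes ds :: "'a::field poly list"
  assumes "sorted_wrt (dvd) ds"
  shows "sorted (map (order x) (filter (\<lambda>q. q \<noteq> 0) ds))"
proof -
  have "sorted_wrt (dvd) (filter (\<lambda>q. q \<noteq> 0) ds)" using assms by (rule sorted_wrt_filter)
  then show ?thesis
    unfolding sorted_wrt_map by (rule sorted_wrt_mono_rel[rotated]) (auto intro: dvd_imp_order_le)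
qed

lemma is_smith_diagonalD:
  assumes "is_smith_diagonal P ds" "P \<in> carrier_mat m p"
  obtains A B where "length ds = min m p" "\<And>q. q \<in> set ds \<Longrightarrow> q \<noteq> 0 \<Longrightarrow> lead_coeff q = 1"
    "sorted_wrt (dvd) ds" "unimodular m A" "unimodular p B" "A * P * B = rect_diag m p ds"
proof -
  have "dim_row P = m" "dim_col P = p" using assms by auto
  moreover have "sorted_wrt (dvd) ds"
    using assms by (subst sorted_wrt_iff_nth_Suc_transp) (auto simp: is_smith_diagonal_def intro: transpI dvd_trans)
  ultimately show ?thesis using assms(1) that unfolding is_smith_diagonal_def by metis
qed

lemma unimodular_poly_det: "unimodular k A \<Longrightarrow> poly (det A) x \<noteq> 0"
  by (auto simp: unimodular_def)

lemma smith_diag_orders: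
  assumes "is_smith_diagonal P ds" "P \<in> carrier_mat m p"
    and "A' \<in> carrier_mat m m" "B' \<in> carrier_mat p p" "poly (det A') x \<noteq> 0" "poly (det B') x \<noteq> 0"
    and "A' * P * B' = rect_diag m p ds'" "length ds' = min m p"
  shows "diag_orders x ds = diag_orders x ds'"
proof -
  from is_smith_diagonalD[OF assms(1,2)] obtain A B where "length ds = min m p"
    "unimodular m A" "unimodular p B" "A * P * B = rect_diag m p ds" by metis
  with assms show ?thesis
    by (intro diag_orders_unique[of P m p A B A' B'])
      (simp_all add: unimodular_carrier unimodular_poly_det del: assoc_mult_mat)
qed

text \<open>Equal multisets of orders, sorted along the divisibility chain, give equal orders at
  each position and each point; these determine the monic entries, and the length determines the
  zeros.\<close>

lemma is_smith_diagonal_unique: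
  fixes P :: "'a::alg_closed_field poly mat"
  assumes "is_smith_diagonal P ds" "is_smith_diagonal P ds'" "P \<in> carrier_mat m p"
  shows "ds = ds'"
proof -
  let ?f = "filter (\<lambda>q. q \<noteq> 0)"
  from is_smith_diagonalD[OF assms(1,3)] obtain A B where ds: "length ds = min m p"
    "\<And>q. q \<in> set ds \<Longrightarrow> q \<noteq> 0 \<Longrightarrow> lead_coeff q = 1" "sorted_wrt (dvd) ds"
    by metis
  from is_smith_diagonalD[OF assms(2,3)] obtain A' B' where ds': "length ds' = min m p"
    "\<And>q. q \<in> set ds' \<Longrightarrow> q \<noteq> 0 \<Longrightarrow> lead_coeff q = 1" "sorted_wrt (dvd) ds'"
    "unimodular m A'" "unimodular p B'" "A' * P * B' = rect_diag m p ds'" by metis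
  have "diag_orders x ds = diag_orders x ds'" for x
    using ds' by (intro smith_diag_orders[OF assms(1,3), of A' B'])
      (simp_all add: unimodular_carrier unimodular_poly_det del: assoc_mult_mat)
  then have eq: "map (order x) (?f ds) = map (order x) (?f ds')" for x
    using sorted_wrt_dvd_sorted_orders[OF ds(3), of x] sorted_wrt_dvd_sorted_orders[OF ds'(3), of x]
    by (metis diag_orders_def mset_filter mset_map sorted_list_of_multiset_mset sorted_sort_id)
  have "?f ds = ?f ds'"
  proof (rule nth_equalityI)
    show len: "length (?f ds) = length (?f ds')" using arg_cong[OF eq, of length] by simp
    fix i assume i: "i < length (?f ds)"
    then have "?f ds ! i \<in> set (?f ds)" "?f ds' ! i \<in> set (?f ds')"
      using len by (metis nth_mem)+
    then have "lead_coeff (?f ds ! i) = 1" "lead_coeff (?f ds' ! i) = 1"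
      using ds(2) ds'(2) by auto
    moreover have "order x (?f ds ! i) = order x (?f ds' ! i)" for x
      using arg_cong[OF eq[of x], of "\<lambda>l. l ! i"] i len by simp
    ultimately show "?f ds ! i = ?f ds' ! i" by (rule monic_eqI_order)
  qed
  then show ?thesis
    using sorted_wrt_dvd_eq_filter_append_zeros[OF ds(3)] sorted_wrt_dvd_eq_filter_append_zeros[OF ds'(3)]
      ds(1) ds'(1) by metis
qed

lemma is_smith_diagonal_exists:
  fixes P :: "'a::field poly mat"
  shows "\<exists>ds. is_smith_diagonal P ds"
  using exists_smith_diagonal[of P "dim_row P" "dim_col P"]
  unfolding is_smith_diagonal_def smith_equiv_def by auto

lemma is_smith_diagonal_invariant_polys:
  fixes P :: "'a::alg_closed_field poly mat"
  shows "is_smith_diagonal P (invariant_polys P)"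
  unfolding invariant_polys_def
  by (rule theI') (metis is_smith_diagonal_exists is_smith_diagonal_unique carrier_matI)

text \<open>A homogenized Smith decomposition is in general no Smith decomposition, but its factors
  are invertible at the points considered; this lemma lets the elementary divisors be read off
  it.\<close>

lemma finite_elem_divs_eq_diag_orders:
  fixes P :: "'a::alg_closed_field poly mat"
  assumes "P \<in> carrier_mat m p" "A \<in> carrier_mat m m" "B \<in> carrier_mat p p"
    and "poly (det A) x \<noteq> 0" "poly (det B) x \<noteq> 0"
    and "A * P * B = rect_diag m p ds" "length ds = min m p"
  shows "finite_elem_divs P x = {#l \<in># diag_orders x ds. 1 \<le> l#}"
  using smith_diag_orders[OF is_smith_diagonal_invariant_polys assms]
  unfolding finite_elem_divs_def diag_orders_def by simp

lemma finite_char_value_iff: "finite_char_value P x \<longleftrightarrow> finite_elem_divs P x \<noteq> {#}"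
proof -
  have "1 \<le> order x q \<longleftrightarrow> poly q x = 0" if "q \<noteq> 0" for q :: "'a poly"
    using that by (auto simp: order_root)
  then show ?thesis
    by (auto simp: finite_char_value_def finite_elem_divs_def simp flip: set_mset_eq_empty_iff)
qed

lemma char_value_iff: "char_value g P x0 \<longleftrightarrow> elem_divs g P x0 \<noteq> {#}"
  by (cases x0) (simp_all add: finite_char_value_iff)

section \<open>Homogenization\<close>

interpretation const_fract_hom: inj_idom_hom "\<lambda>c. to_fract [:c:] :: 'a::field poly fract"
proof
  show "to_fract [:x * y:] = to_fract [:x:] * to_fract [:y:]" for x y :: 'a
    by (simp flip: to_fract_mult)
qed (auto simp: one_pCons[symmetric] simp flip: to_fract_add)

interpretation ratfun_eval_hom: idom_hom "ratfun_eval n d" for n d :: "'a::field poly"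
proof
  interpret map_poly_idom_hom "\<lambda>c. to_fract [:c:] :: 'a poly fract" ..
  show "ratfun_eval n d 0 = 0" "ratfun_eval n d 1 = 1"
    "ratfun_eval n d (p + q) = ratfun_eval n d p + ratfun_eval n d q"
    "ratfun_eval n d (p * q) = ratfun_eval n d p * ratfun_eval n d q" for p q
    unfolding ratfun_eval_def by (simp_all add: hom_distribs)
qed

text \<open>For \<open>degree q <= N\<close> this is \<open>d^N q(n/d)\<close>, written without
  division so that it has values where \<open>d\<close> vanishes. The bound \<open>N\<close> is a
  parameter since all entries of a matrix share one grade.\<close>

definition homogenize :: "'a::field poly \<Rightarrow> 'a poly \<Rightarrow> nat \<Rightarrow> 'a poly \<Rightarrow> 'a poly" where
  "homogenize n d N q = (\<Sum>k\<le>N. smult (coeff q k) (n ^ k * d ^ (N - k)))"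

lemma to_fract_power: "to_fract (q ^ k) = to_fract q ^ k"
  by (induction k) auto

lemma to_fract_sum: "to_fract (\<Sum>k\<in>A. f k) = (\<Sum>k\<in>A. to_fract (f k))"
  by (induction A rule: infinite_finite_induct) auto

lemma to_fract_homogenize:
  assumes d: "d \<noteq> 0" and "degree q \<le> N"
  shows "to_fract (homogenize n d N q) = to_fract d ^ N * ratfun_eval n d q"
proof -
  let ?q = "map_poly (\<lambda>c. to_fract [:c:]) q"
  have "ratfun_eval n d q = (\<Sum>k\<le>N. coeff ?q k * (to_fract n / to_fract d) ^ k)"
    unfolding ratfun_eval_def
    unfolding poly_altdef
  proof (rule sum.mono_neutral_left)
    show "{..degree ?q} \<subseteq> {..N}"
      using assms(2) map_poly_degree_leq[of "\<lambda>c. to_fract [:c:]" q] by auto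
  qed (auto intro!: coeff_eq_0)
  also have "to_fract d ^ N * \<dots> =
      (\<Sum>k\<le>N. to_fract [:coeff q k:] * (to_fract n ^ k * to_fract d ^ (N - k)))"
    unfolding sum_distrib_left
  proof (rule sum.cong, goal_cases)
    case (2 k)
    then have "to_fract d ^ N = to_fract d ^ k * to_fract d ^ (N - k)"
      by (simp flip: power_add)
    then show ?case using d by (simp add: field_simps coeff_map_poly)
  qed simp
  also have "\<dots> = to_fract (\<Sum>k\<le>N. [:coeff q k:] * (n ^ k * d ^ (N - k)))"
    by (simp only: to_fract_sum to_fract_power to_fract_mult)
  finally show ?thesis by (simp add: homogenize_def)
qed

lemma homogenize_0 [simp]: "homogenize n d N 0 = 0"
  by (simp add: homogenize_def)

lemma homogenize_sum: "homogenize n d N (\<Sum>i\<in>A. f i) = (\<Sum>i\<in>A. homogenize n d N (f i))"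
  unfolding homogenize_def by (subst sum.swap) (simp add: coeff_sum smult_sum)

lemma homogenize_diff: "homogenize n d N (p - q) = homogenize n d N p - homogenize n d N q"
  by (simp add: homogenize_def smult_diff_left sum_subtractf)

lemma homogenize_smult: "homogenize n d N (smult c q) = smult c (homogenize n d N q)"
  by (simp add: homogenize_def smult_sum2 mult.assoc)

text \<open>In the field of fractions both sides are \<open>d^(N + M)\<close> times the value of a
  ring homomorphism at \<open>p * q\<close>, and the embedding of polynomials is injective.\<close>

lemma homogenize_mult:
  assumes d: "d \<noteq> 0" and "degree p \<le> N" "degree q \<le> M"
  shows "homogenize n d (N + M) (p * q) = homogenize n d N p * homogenize n d M q"
proof -
  have "degree (p * q) \<le> N + M" using assms degree_mult_le[of p q] by linarith
  then have "to_fract (homogenize n d (N + M) (p * q)) = to_fract (homogenize n d N p * homogenize n d M q)"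
    using assms by (simp add: to_fract_homogenize ratfun_eval_hom.hom_mult power_add)
  then show ?thesis by (simp only: to_fract_eq_iff)
qed

lemma homogenize_power:
  assumes d: "d \<noteq> 0" and "degree q \<le> N"
  shows "homogenize n d (k * N) (q ^ k) = homogenize n d N q ^ k"
proof (induction k)
  case 0
  then show ?case by (simp add: homogenize_def)
next
  case (Suc k)
  have "degree (q ^ k) \<le> k * N"
    using assms(2) by (intro order.trans[OF degree_power_le]) (simp add: mult.commute)
  then show ?case using homogenize_mult[OF d assms(2), of "q ^ k" "k * N"] Suc by simp
qed

lemma poly_homogenize:
  "poly (homogenize n d N q) y = (\<Sum>k\<le>N. coeff q k * (poly n y ^ k * poly d y ^ (N - k)))"
  by (simp add: homogenize_def poly_sum poly_power)

lemma homogeneous_sum_eq: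
  fixes a b :: "'a::field"
  assumes "b \<noteq> 0" "degree q \<le> N"
  shows "(\<Sum>k\<le>N. coeff q k * (a ^ k * b ^ (N - k))) = b ^ N * poly q (a / b)"
proof -
  have "poly q (a / b) = (\<Sum>k\<le>N. coeff q k * (a / b) ^ k)"
    unfolding poly_altdef using assms(2)
    by (intro sum.mono_neutral_left) (auto intro: coeff_eq_0)
  also have "b ^ N * \<dots> = (\<Sum>k\<le>N. coeff q k * (a ^ k * b ^ (N - k)))"
    unfolding sum_distrib_left
  proof (rule sum.cong, goal_cases)
    case (2 k)
    then have "b ^ N = b ^ k * b ^ (N - k)" by (simp flip: power_add)
    then show ?case using assms(1) by (simp add: field_simps)
  qed simp
  finally show ?thesis ..
qed

lemma poly_homogenize_nonzero:
  assumes "poly d y \<noteq> 0" "degree q \<le> N"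
  shows "poly (homogenize n d N q) y = poly d y ^ N * poly q (poly n y / poly d y)"
  unfolding poly_homogenize by (rule homogeneous_sum_eq[OF assms])

lemma homogenize_linear: "homogenize n d 1 [:-x, 1:] = n - smult x d"
  by (simp add: homogenize_def)

lemma order_power_eq: "q \<noteq> 0 \<Longrightarrow> order x (q ^ k) = k * order x (q :: 'a::field poly)"
  by (induction k) (simp_all add: order_mult)

text \<open>Write \<open>q = (X - x)^l r\<close> with \<open>r(x)\<close> nonzero and split
  \<open>N\<close> as \<open>l + (N - l)\<close>: homogenization gives \<open>(n - x d)^l\<close>
  times a polynomial that does not vanish at \<open>y\<close>. So each factor \<open>X - x\<close>
  contributes the multiplicity of \<open>y\<close> in its fibre.\<close>

lemma order_homogenize:
  fixes n d q :: "'a::field poly"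
  assumes y: "poly d y \<noteq> 0" and nd: "n \<noteq> smult (poly n y / poly d y) d"
    and q: "q \<noteq> 0" "degree q \<le> N"
  defines "x \<equiv> poly n y / poly d y"
  shows "homogenize n d N q \<noteq> 0" "order y (homogenize n d N q) = order y (n - smult x d) * order x q"
proof -
  have d: "d \<noteq> 0" using y by auto
  obtain r where r: "q = [:-x, 1:] ^ order x q * r" "poly r x \<noteq> 0" using order_factor[OF q(1)] by metis
  let ?l = "order x q"
  have "r \<noteq> 0" using r by auto
  have "degree q = degree ([:-x, 1:] ^ ?l) + degree r"
    using \<open>r \<noteq> 0\<close> by (subst r(1), subst degree_mult_eq) auto
  then have deg: "degree q = ?l + degree r" by (simp add: degree_linear_power)
  have "homogenize n d N q = homogenize n d (?l * 1 + (N - ?l)) ([:-x, 1:] ^ ?l * r)"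
    using q deg r(1) by simp
  also have "\<dots> = homogenize n d (?l * 1) ([:-x, 1:] ^ ?l) * homogenize n d (N - ?l) r"
    using d q deg by (intro homogenize_mult) (auto simp: degree_linear_power)
  also have "homogenize n d (?l * 1) ([:-x, 1:] ^ ?l) = (n - smult x d) ^ ?l"
    using homogenize_power[OF d, of "[:-x, 1:]" 1 n ?l] unfolding homogenize_linear by simp
  finally have eq: "homogenize n d N q = (n - smult x d) ^ ?l * homogenize n d (N - ?l) r" .
  have "poly (homogenize n d (N - ?l) r) y \<noteq> 0"
    using r y q deg by (subst poly_homogenize_nonzero) (auto simp: x_def)
  moreover from this have "homogenize n d (N - ?l) r \<noteq> 0" by auto
  moreover have "n - smult x d \<noteq> 0" using nd by (simp add: x_def)
  ultimately show "homogenize n d N q \<noteq> 0"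
    "order y (homogenize n d N q) = order y (n - smult x d) * order x q"
    unfolding eq by (simp_all add: order_mult order_power_eq order_0I)
qed

section \<open>Homogenized matrices and their elementary divisors\<close>

abbreviation homogenize_mat :: "'a::field poly \<Rightarrow> 'a poly \<Rightarrow> nat \<Rightarrow> 'a poly mat \<Rightarrow> 'a poly mat" where
  "homogenize_mat n d N P \<equiv> map_mat (homogenize n d N) P"

lemma degree_le_mat_degree: "i < dim_row P \<Longrightarrow> j < dim_col P \<Longrightarrow> degree (P $$ (i, j)) \<le> mat_degree P"
  unfolding mat_degree_def
  by (intro Max_ge finite_imageI imageI elements_matI[of _ "dim_row P" "dim_col P"])
    (auto simp: elements_mat_def)

lemma degree_le_grade:
  "has_grade g P \<Longrightarrow> i < dim_row P \<Longrightarrow> j < dim_col P \<Longrightarrow> degree (P $$ (i, j)) \<le> g"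
  unfolding has_grade_def by (rule order.trans[OF degree_le_mat_degree])

lemma has_gradeI:
  assumes "0 < dim_row P" "0 < dim_col P"
    "\<And>i j. i < dim_row P \<Longrightarrow> j < dim_col P \<Longrightarrow> degree (P $$ (i, j)) \<le> g"
  shows "has_grade g P"
  using assms unfolding has_grade_def mat_degree_def
  by (subst Max_le_iff) (auto simp: elements_mat_def)

lemma homogenize_mat_mult:
  assumes "d \<noteq> 0" "A \<in> carrier_mat m k" "B \<in> carrier_mat k p" "has_grade a A" "has_grade b B"
  shows "homogenize_mat n d (a + b) (A * B) = homogenize_mat n d a A * homogenize_mat n d b B"
proof (rule eq_matI)
  fix i j assume "i < dim_row (homogenize_mat n d a A * homogenize_mat n d b B)"
    "j < dim_col (homogenize_mat n d a A * homogenize_mat n d b B)"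
  with assms have ij: "i < m" "j < p" by auto
  have "homogenize_mat n d (a + b) (A * B) $$ (i, j) = homogenize n d (a + b) (\<Sum>l<k. A $$ (i, l) * B $$ (l, j))"
    using assms ij mat_mult_index[OF assms(2,3) ij] by simp
  also have "\<dots> = (\<Sum>l<k. homogenize n d a (A $$ (i, l)) * homogenize n d b (B $$ (l, j)))"
    unfolding homogenize_sum using assms ij
    by (intro sum.cong homogenize_mult degree_le_grade) auto
  also have "\<dots> = (homogenize_mat n d a A * homogenize_mat n d b B) $$ (i, j)"
    using mat_mult_index[of "homogenize_mat n d a A" m k "homogenize_mat n d b B" p i j] assms ij by simp
  finally show "homogenize_mat n d (a + b) (A * B) $$ (i, j) = (homogenize_mat n d a A * homogenize_mat n d b B) $$ (i, j)" .
qed (use assms in auto)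

lemma has_grade_mult:
  fixes A B :: "'a::field poly mat"
  assumes "0 < m" "0 < p" "A \<in> carrier_mat m k" "B \<in> carrier_mat k p" "has_grade a A" "has_grade b B"
  shows "has_grade (a + b) (A * B)"
proof (rule has_gradeI)
  fix i j assume "i < dim_row (A * B)" "j < dim_col (A * B)"
  with assms have ij: "i < m" "j < p" by auto
  have "degree (A $$ (i, l) * B $$ (l, j)) \<le> a + b" if "l < k" for l
    using assms ij that by (intro order.trans[OF degree_mult_le] add_mono degree_le_grade) auto
  then show "degree ((A * B) $$ (i, j)) \<le> a + b"
    unfolding mat_mult_index[OF assms(3,4) ij] by (intro degree_sum_le) auto
qed (use assms in auto)

lemma poly_det_homogenize_mat:
  assumes y: "poly d y \<noteq> 0" and A: "A \<in> carrier_mat m m" and "has_grade a A"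
  shows "poly (det (homogenize_mat n d a A)) y = (poly d y ^ a) ^ m * poly (det A) (poly n y / poly d y)"
proof -
  let ?x = "poly n y / poly d y"
  note hom_det = comm_ring_hom.hom_det[OF poly_hom.comm_ring_hom_axioms, symmetric]
  have "map_mat (\<lambda>q. poly q y) (homogenize_mat n d a A) = (poly d y ^ a) \<cdot>\<^sub>m map_mat (\<lambda>q. poly q ?x) A"
    using assms by (intro eq_matI) (auto simp: poly_homogenize_nonzero degree_le_grade)
  then show ?thesis using A by (simp add: hom_det)
qed

lemma finite_elem_divs_homogenize:
  fixes P :: "'a::alg_closed_field poly mat"
  assumes pos: "0 < m" "0 < p" and P: "P \<in> carrier_mat m p" "has_grade g P"
    and y: "poly d y \<noteq> 0" and nd: "n \<noteq> smult (poly n y / poly d y) d"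
  defines "x \<equiv> poly n y / poly d y"
  shows "finite_elem_divs (homogenize_mat n d g P) y =
    image_mset (\<lambda>l. order y (n - smult x d) * l) (finite_elem_divs P x)"
proof -
  let ?ds = "invariant_polys P" and ?m0 = "order y (n - smult x d)"
  from is_smith_diagonalD[OF is_smith_diagonal_invariant_polys P(1)] obtain A B where
    len: "length ?ds = min m p" and AB: "unimodular m A" "unimodular p B" "A * P * B = rect_diag m p ?ds" by metis
  note Ac = unimodular_carrier[OF AB(1)] and Bc = unimodular_carrier[OF AB(2)]
  define a b where "a = mat_degree A" and "b = mat_degree B"
  have gr: "has_grade a A" "has_grade b B" by (auto simp: a_def b_def has_grade_def)
  have d: "d \<noteq> 0" using y by auto
  let ?N = "a + g + b" and ?H = "homogenize_mat n d"
  have AP: "A * P \<in> carrier_mat m p" "has_grade (a + g) (A * P)"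
    using has_grade_mult[OF pos Ac P(1) gr(1) P(2)] Ac P(1) by auto
  \<comment> \<open>The diagonal entries inherit the bound \<open>?N\<close> from the product
    \<open>A * P * B\<close>; the orders of their homogenizations are computed under this
    bound.\<close>
  have gD: "has_grade ?N (rect_diag m p ?ds)"
    using has_grade_mult[OF pos AP(1) Bc AP(2) gr(2)] AB(3) by simp
  have "?H a A * ?H g P * ?H b B = ?H ?N (A * P * B)"
    using homogenize_mat_mult[OF d Ac P(1) gr(1) P(2)] homogenize_mat_mult[OF d AP(1) Bc AP(2) gr(2)] by simp
  also have "\<dots> = rect_diag m p (map (homogenize n d ?N) ?ds)"
    unfolding AB(3) using len by (intro eq_matI) auto
  finally have eq: "?H a A * ?H g P * ?H b B = rect_diag m p (map (homogenize n d ?N) ?ds)" .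
  have ok: "homogenize n d ?N q \<noteq> 0 \<longleftrightarrow> q \<noteq> 0" "q \<noteq> 0 \<Longrightarrow> order y (homogenize n d ?N q) = ?m0 * order x q"
    if "q \<in> set ?ds" for q
  proof -
    from that obtain i where "i < length ?ds" "q = ?ds ! i" by (metis in_set_conv_nth)
    then have "degree q \<le> ?N" using degree_le_grade[OF gD, of i i] len by simp
    then show "homogenize n d ?N q \<noteq> 0 \<longleftrightarrow> q \<noteq> 0" "q \<noteq> 0 \<Longrightarrow> order y (homogenize n d ?N q) = ?m0 * order x q"
      using order_homogenize[OF y nd, of q ?N] by (auto simp: x_def)
  qed
  have "n - smult x d \<noteq> 0" "poly (n - smult x d) y = 0" using y nd by (auto simp: x_def)
  \<comment> \<open>A positive multiplicity keeps order 0 and positive orders apart, so discarding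
    the zeros commutes with scaling by \<open>?m0\<close>.\<close>
  then have m0: "1 \<le> ?m0" using order_root[of "n - smult x d" y] by linarith
  have "diag_orders y (map (homogenize n d ?N) ?ds) = image_mset (\<lambda>l. ?m0 * l) (diag_orders x ?ds)"
  proof -
    have "{#q \<in># mset ?ds. homogenize n d ?N q \<noteq> 0#} = {#q \<in># mset ?ds. q \<noteq> 0#}"
      using ok(1) by (intro filter_mset_cong) auto
    then show ?thesis
      unfolding diag_orders_def mset_map filter_mset_image_mset multiset.map_comp
      by (auto simp: ok(2) intro!: image_mset_cong)
  qed
  moreover have "finite_elem_divs (?H g P) y = {#l \<in># diag_orders y (map (homogenize n d ?N) ?ds). 1 \<le> l#}"
    using Ac Bc P eq len y poly_det_homogenize_mat[OF y Ac gr(1), of n] poly_det_homogenize_mat[OF y Bc gr(2), of n]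
      AB(1,2)[THEN unimodular_poly_det]
    by (intro finite_elem_divs_eq_diag_orders[of _ m p "?H a A" "?H b B"]) auto
  moreover have "finite_elem_divs P x = {#l \<in># diag_orders x ?ds. 1 \<le> l#}"
    by (simp add: finite_elem_divs_def diag_orders_def)
  moreover have "1 \<le> ?m0 * l \<longleftrightarrow> 1 \<le> l" for l using m0 by (cases "l = 0") auto
  ultimately show ?thesis by (simp add: filter_mset_image_mset)
qed

section \<open>Reversal and the point at infinity\<close>

abbreviation rev_poly :: "nat \<Rightarrow> 'a::field poly \<Rightarrow> 'a poly" where
  "rev_poly \<equiv> homogenize 1 [:0, 1:]"

lemma rev_poly_altdef: "rev_poly g q = (\<Sum>i\<le>g. monom (coeff q (g - i)) i)"
proof -
  have "rev_poly g q = (\<Sum>k\<in>{0..g}. monom (coeff q k) (g - k))"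
    by (simp add: homogenize_def monom_altdef atMost_atLeast0)
  also have "\<dots> = (\<Sum>k\<in>{0..g}. monom (coeff q (g - k)) k)"
    by (subst sum.atLeastAtMost_rev) (auto intro!: sum.cong)
  finally show ?thesis by (simp add: atMost_atLeast0)
qed

lemma coeff_rev_poly: "coeff (rev_poly g q) k = (if k \<le> g then coeff q (g - k) else 0)"
  by (simp add: rev_poly_altdef coeff_sum)

lemma degree_rev_poly: "degree (rev_poly g q) \<le> g"
  by (rule degree_le) (simp add: coeff_rev_poly)

lemma poly_rev_poly_0: "poly (rev_poly g q) 0 = coeff q g"
  by (simp add: poly_0_coeff_0 coeff_rev_poly)

lemma rev_poly_eq_0_iff: "degree q \<le> g \<Longrightarrow> rev_poly g q = 0 \<longleftrightarrow> q = 0"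
proof
  assume "degree q \<le> g" "rev_poly g q = 0"
  then have "coeff (rev_poly g q) (g - degree q) = 0" by simp
  then show "q = 0" using \<open>degree q \<le> g\<close> by (simp add: coeff_rev_poly)
qed simp

lemma reversal_eq: "reversal g P = homogenize_mat 1 [:0, 1:] g P"
  unfolding reversal_def by (intro eq_matI) (auto simp: rev_poly_altdef)

text \<open>Formally \<open>d^g q(n/d) = n^g q'(d/n)\<close>, where \<open>q'\<close> is the
  reversal. At a zero of \<open>d\<close> the second form has denominator \<open>n\<close>, which is
  nonzero there when the pair is coprime.\<close>

lemma homogenize_swap: "homogenize n d g q = homogenize d n g (rev_poly g q)"
proof -
  have "homogenize n d g q = (\<Sum>k\<in>{0..g}. smult (coeff q (g - k)) (n ^ (g - k) * d ^ (g - (g - k))))"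
    unfolding homogenize_def atMost_atLeast0 by (subst sum.atLeastAtMost_rev) simp
  also have "\<dots> = homogenize d n g (rev_poly g q)"
    unfolding homogenize_def[of d n] atMost_atLeast0
    by (intro sum.cong) (auto simp: coeff_rev_poly mult.commute)
  finally show ?thesis .
qed

text \<open>Reversal is multiplicative when grades add, and every term \<open>n^k d^(g - k)\<close>
  has grade \<open>g * G\<close>. Hence \<open>Q\<close> at infinity becomes a homogenization of the
  same \<open>P\<close> in the reversed pair, at the point 0.\<close>

lemma rev_poly_homogenize:
  assumes "degree n \<le> G" "degree d \<le> G"
  shows "rev_poly (g * G) (homogenize n d g q) = homogenize (rev_poly G n) (rev_poly G d) g q"
proof -
  have "rev_poly (g * G) (n ^ k * d ^ (g - k)) = rev_poly G n ^ k * rev_poly G d ^ (g - k)" if "k \<le> g" for k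
  proof -
    have "degree (n ^ k) \<le> k * G" "degree (d ^ (g - k)) \<le> (g - k) * G"
      using assms by (auto intro!: order.trans[OF degree_power_le] simp: mult.commute)
    then have "rev_poly (k * G + (g - k) * G) (n ^ k * d ^ (g - k)) = rev_poly (k * G) (n ^ k) * rev_poly ((g - k) * G) (d ^ (g - k))"
      by (intro homogenize_mult) auto
    also have "k * G + (g - k) * G = g * G" using that by (simp flip: add_mult_distrib)
    finally show ?thesis using assms by (simp add: homogenize_power)
  qed
  then show ?thesis
    unfolding homogenize_def[of n d] homogenize_def[of "rev_poly G n"] homogenize_sum homogenize_smult
    by (intro sum.cong) auto
qed

text \<open>Reversing at the exact degree gives the constant term \<open>lead_coeff q\<close>, and
  the surplus \<open>G - degree q\<close> becomes a power of \<open>X\<close>. This matches the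
  multiplicity that \<open>fibre_mult\<close> assigns to infinity.\<close>

lemma order_rev_poly:
  assumes "q \<noteq> 0" "degree q \<le> G"
  shows "order 0 (rev_poly G q) = G - degree q"
proof (rule order_eqI)
  have "rev_poly ((G - degree q) + degree q) (1 * q) = rev_poly (G - degree q) 1 * rev_poly (degree q) q"
    by (intro homogenize_mult) auto
  moreover have "rev_poly (G - degree q) 1 = [:0, 1:] ^ (G - degree q)"
    by (simp add: rev_poly_altdef monom_altdef coeff_1 if_distrib[of "\<lambda>c. smult c _"] cong: if_cong)
      (subst sum.remove[of _ "G - degree q"]; auto intro!: sum.neutral)
  ultimately show "rev_poly G q = [:-0, 1:] ^ (G - degree q) * rev_poly (degree q) q"
    using assms by (metis le_add_diff_inverse2 minus_zero mult_1)
  show "poly (rev_poly (degree q) q) 0 \<noteq> 0" using assms by (simp add: poly_rev_poly_0)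
qed

lemma rational_transform_eq_homogenize:
  assumes "d \<noteq> 0" "has_grade g P" "is_rational_transform n d g P Q"
  shows "Q = homogenize_mat n d g P"
proof (rule eq_matI)
  from assms(3) have eq: "map_mat to_fract Q = (to_fract d ^ g) \<cdot>\<^sub>m map_mat (ratfun_eval n d) P"
    by (simp add: is_rational_transform_def)
  show dims: "dim_row Q = dim_row (homogenize_mat n d g P)" "dim_col Q = dim_col (homogenize_mat n d g P)"
    using arg_cong[OF eq, of dim_row] arg_cong[OF eq, of dim_col] by simp_all
  fix i j assume ij: "i < dim_row (homogenize_mat n d g P)" "j < dim_col (homogenize_mat n d g P)"
  then have "to_fract (Q $$ (i, j)) = to_fract (homogenize n d g (P $$ (i, j)))"
    using arg_cong[OF eq, of "\<lambda>A. A $$ (i, j)"] dims assms(1,2)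
    by (simp add: to_fract_homogenize degree_le_grade)
  then show "Q $$ (i, j) = homogenize_mat n d g P $$ (i, j)" using ij by simp
qed

lemma coprime_not_smult:
  fixes n d :: "'a::field poly"
  assumes "coprime n d" "1 \<le> max (degree n) (degree d)"
  shows "n \<noteq> smult x d"
proof
  assume n: "n = smult x d"
  then have "d dvd n" by (simp add: dvd_smult)
  with assms(1) have "d dvd 1" by (meson coprime_common_divisor dvd_refl)
  then have "degree d = 0" by (simp add: poly_dvd_1)
  then show False using assms(2) n by (simp split: if_splits)
qed

lemma coprime_no_common_root:
  fixes n d :: "'a::field poly"
  assumes "coprime n d"
  shows "poly n y \<noteq> 0 \<or> poly d y \<noteq> 0"
  using coprime_common_divisor[OF assms, of "[:-y, 1:]"] by (auto simp: poly_eq_0_iff_dvd poly_dvd_1)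

lemma order_diff_commute: "order x (p - q) = order x (q - p :: 'a::field poly)"
  by (metis minus_diff_eq order_uminus)

lemma coeff_max_degree_nonzero:
  assumes "1 \<le> max (degree n) (degree d)"
  shows "coeff n (max (degree n) (degree d)) \<noteq> 0 \<or> coeff d (max (degree n) (degree d)) \<noteq> 0"
  using assms by (cases "degree n \<le> degree d") (auto simp: max_def)

text \<open>Two moves reduce every case to a finite point where the denominator does not vanish:
  reversing the pair \<open>(n, d)\<close> takes \<open>y0 = Infinite\<close> to 0, and exchanging
  the pair while reversing \<open>P\<close> takes \<open>x0 = Infinite\<close> to 0. If both points
  are infinite, both moves are made.\<close>

lemma elem_divs_homogenize:
  fixes P :: "'a::alg_closed_field poly mat"
  assumes pos: "0 < m" "0 < p" and nz: "n \<noteq> 0" "d \<noteq> 0" and cop: "coprime n d"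
    and G: "G = max (degree n) (degree d)" "1 \<le> G"
    and P: "P \<in> carrier_mat m p" "has_grade g P"
    and fib: "y0 \<in> fibre n d x0"
  shows "elem_divs (g * G) (homogenize_mat n d g P) y0 =
    image_mset (\<lambda>l. fibre_mult n d x0 y0 * l) (elem_divs g P x0)"
proof -
  have ns: "n \<noteq> smult x d" for x using coprime_not_smult[OF cop] G by simp
  have deg: "degree n \<le> G" "degree d \<le> G" using G by auto
  have lead: "coeff n G \<noteq> 0 \<or> coeff d G \<noteq> 0" using coeff_max_degree_nonzero G by auto
  have revP: "homogenize_mat 1 [:0, 1:] g P \<in> carrier_mat m p" "has_grade g (homogenize_mat 1 [:0, 1:] g P)"
    using P pos by (auto intro!: has_gradeI degree_rev_poly)
  have swap: "homogenize_mat n d g P = homogenize_mat d n g (homogenize_mat 1 [:0, 1:] g P)" for n d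
    by (intro eq_matI) (auto simp: homogenize_swap[of n d])
  let ?n = "rev_poly G n" and ?d = "rev_poly G d"
  have rev: "reversal (g * G) (homogenize_mat n d g P) = homogenize_mat ?n ?d g P"
    unfolding reversal_eq by (intro eq_matI) (auto simp: rev_poly_homogenize[OF deg])
  show ?thesis
  proof (cases y0)
    case y: (Finite y)
    show ?thesis
    proof (cases x0)
      case x: (Finite x)
      have "poly n y = x * poly d y" using fib by (simp add: x y fibre_def)
      then have "poly d y \<noteq> 0" "poly n y / poly d y = x"
        using coprime_no_common_root[OF cop, of y] by auto
      then show ?thesis using finite_elem_divs_homogenize[OF pos P, of d y n] ns
        by (simp add: x y order_diff_commute[of y n])
    next
      case x: Infinite
      have "poly d y = 0" using fib by (simp add: x y fibre_def)
      then have "poly n y \<noteq> 0" using coprime_no_common_root[OF cop, of y] by auto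
      then show ?thesis using finite_elem_divs_homogenize[OF pos revP, of n y d] nz \<open>poly d y = 0\<close>
        by (simp add: x y reversal_eq swap[of n d])
    qed
  next
    case y: Infinite
    show ?thesis
    proof (cases x0)
      case x: (Finite x)
      have "degree (smult x d - n) < G" using fib G by (simp add: x y fibre_def)
      then have "coeff (smult x d - n) G = 0" by (rule coeff_eq_0)
      then have c: "coeff n G = x * coeff d G" by simp
      then have "poly ?d 0 \<noteq> 0" "poly ?n 0 / poly ?d 0 = x" using lead by (auto simp: poly_rev_poly_0)
      moreover have *: "?n - smult x ?d = rev_poly G (n - smult x d)"
        by (simp add: homogenize_diff homogenize_smult)
      have deg': "degree (n - smult x d) \<le> G" using deg by (intro degree_diff_le) (auto intro: order.trans[OF degree_smult_le])
      have "?n - smult x ?d \<noteq> 0" using ns[of x] rev_poly_eq_0_iff[OF deg'] unfolding * by simp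
      moreover have "order 0 (?n - smult x ?d) = G - degree (smult x d - n)"
        unfolding * using ns[of x] by (subst order_rev_poly[OF _ deg']) (use degree_minus[of "n - smult x d"] in auto)
      ultimately show ?thesis using finite_elem_divs_homogenize[OF pos P, of ?d 0 ?n]
        by (simp add: x y rev G(1)[symmetric])
    next
      case x: Infinite
      have "degree d < G" using fib G by (simp add: x y fibre_def)
      then have c: "coeff d G = 0" by (rule coeff_eq_0)
      then have "poly ?n 0 \<noteq> 0" "poly ?d 0 = 0" using lead by (auto simp: poly_rev_poly_0)
      moreover have "?d \<noteq> 0" using nz rev_poly_eq_0_iff[OF deg(2)] by simp
      ultimately show ?thesis using finite_elem_divs_homogenize[OF pos revP, of ?n 0 ?d] nz
        by (simp add: x y rev G(1)[symmetric] swap[of ?n ?d] order_rev_poly deg flip: reversal_eq)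
    qed
  qed
qed

lemma fibre_mult_pos:
  fixes n d :: "'a::field poly"
  assumes "n \<noteq> 0" "d \<noteq> 0" "coprime n d" "1 \<le> max (degree n) (degree d)" "y0 \<in> fibre n d x0"
  shows "0 < fibre_mult n d x0 y0"
proof -
  have "fibre_poly n d x0 \<noteq> 0"
    using assms(2) coprime_not_smult[OF assms(3,4)] by (cases x0) auto
  then show ?thesis
    using assms(5) by (cases y0) (auto simp: fibre_def order_root)
qed

section \<open>Minimal polynomial bases\<close>

text \<open>Coefficients are taken in the domain of the entries; clearing denominators makes this
  independence over its field of fractions. Lists rather than sets make a repeated vector
  dependent.\<close>

definition vecs_indep :: "nat \<Rightarrow> 'b::idom vec list \<Rightarrow> bool" where
  "vecs_indep p vs \<longleftrightarrow>
     (\<forall>a. (\<forall>j<p. (\<Sum>i<length vs. a i * vs ! i $ j) = 0) \<longrightarrow> (\<forall>i<length vs. a i = 0))"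

definition maximal_indep :: "nat \<Rightarrow> 'b::idom vec set \<Rightarrow> 'b vec list \<Rightarrow> bool" where
  "maximal_indep p W vs \<longleftrightarrow> set vs \<subseteq> W \<and> vecs_indep p vs \<and>
     (\<forall>ws. set ws \<subseteq> W \<longrightarrow> vecs_indep p ws \<longrightarrow> length ws \<le> length vs)"

text \<open>Over polynomials this describes the polynomial vectors of a subspace over the rational
  functions: coefficients \<open>a i / q\<close> are allowed whenever the combination has polynomial
  entries.\<close>

definition saturated :: "nat \<Rightarrow> 'b::idom vec set \<Rightarrow> bool" where
  "saturated p W \<longleftrightarrow> W \<subseteq> carrier_vec p \<and>
     (\<forall>vs a q w. set vs \<subseteq> W \<longrightarrow> w \<in> carrier_vec p \<longrightarrow> q \<noteq> 0 \<longrightarrow>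
        (\<forall>j<p. q * w $ j = (\<Sum>i<length vs. a i * vs ! i $ j)) \<longrightarrow> w \<in> W)"

lemma vecs_indepD:
  "vecs_indep p vs \<Longrightarrow> (\<And>j. j < p \<Longrightarrow> (\<Sum>i<length vs. a i * vs ! i $ j) = 0) \<Longrightarrow> i < length vs \<Longrightarrow> a i = 0"
  unfolding vecs_indep_def by blast

lemma saturatedD:
  assumes "saturated p W" "set vs \<subseteq> W" "w \<in> carrier_vec p" "q \<noteq> 0"
    "\<And>j. j < p \<Longrightarrow> q * w $ j = (\<Sum>i<length vs. a i * vs ! i $ j)"
  shows "w \<in> W"
proof -
  from assms(1) have "\<forall>vs a q w. set vs \<subseteq> W \<longrightarrow> w \<in> carrier_vec p \<longrightarrow> q \<noteq> 0 \<longrightarrow>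
      (\<forall>j<p. q * w $ j = (\<Sum>i<length vs. a i * vs ! i $ j)) \<longrightarrow> w \<in> W"
    unfolding saturated_def by (rule conjunct2)
  then show ?thesis
    by (elim allE[of _ vs] allE[of _ a] allE[of _ q] allE[of _ w] impE) (use assms in simp_all)
qed

lemma vecs_indep_length_le:
  assumes "vecs_indep p vs"
  shows "length vs \<le> p"
proof (rule ccontr)
  assume "\<not> length vs \<le> p"
  then have "card {..<p} < card {..<length vs}" by simp
  from exists_linear_relation[OF finite_lessThan finite_lessThan this, of "\<lambda>i j. vs ! i $ j"]
  obtain a where a: "\<exists>i\<in>{..<length vs}. a i \<noteq> 0"
    "\<forall>j\<in>{..<p}. (\<Sum>i<length vs. a i * vs ! i $ j) = 0" by (elim exE conjE)
  have "a i = 0" if "i < length vs" for i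
    by (rule vecs_indepD[OF assms _ that]) (use a(2) in simp)
  with a(1) show False by simp
qed

lemma exists_maximal_indep: "\<exists>vs. maximal_indep p W vs"
proof -
  let ?Q = "\<lambda>vs. set vs \<subseteq> W \<and> vecs_indep p vs"
  have "?Q []" by (simp add: vecs_indep_def)
  moreover have "\<forall>vs. ?Q vs \<longrightarrow> length vs < Suc p" using vecs_indep_length_le by (auto simp: less_Suc_eq_le)
  ultimately obtain vs where "?Q vs" "\<forall>ws. ?Q ws \<longrightarrow> length ws \<le> length vs"
    using ex_has_greatest_nat[of ?Q "[]" length "Suc p"] by metis
  then show ?thesis unfolding maximal_indep_def by blast
qed

lemma maximal_indep_dependent:
  assumes "maximal_indep p W vs" "w \<in> W"
  shows "\<exists>q a. q \<noteq> 0 \<and> (\<forall>j<p. q * w $ j = (\<Sum>i<length vs. a i * vs ! i $ j))"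
proof -
  have "\<not> vecs_indep p (vs @ [w])"
    using assms unfolding maximal_indep_def by (auto dest!: spec[of _ "vs @ [w]"])
  then obtain b where b: "\<And>j. j < p \<Longrightarrow> (\<Sum>i<length (vs @ [w]). b i * (vs @ [w]) ! i $ j) = 0"
    "\<exists>i<length (vs @ [w]). b i \<noteq> 0" unfolding vecs_indep_def by blast
  have eq: "(\<Sum>i<length vs. b i * vs ! i $ j) + b (length vs) * w $ j = 0" if "j < p" for j
    using b(1)[OF that] by (simp add: nth_append)
  show ?thesis
  proof (intro exI[of _ "b (length vs)"] exI[of _ "\<lambda>i. - b i"] conjI allI impI)
    show "b (length vs) \<noteq> 0"
    proof
      assume 0: "b (length vs) = 0"
      then have "b i = 0" if "i < length vs" for i
        using vecs_indepD[of p vs b i] eq assms(1) that by (auto simp: maximal_indep_def)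
      then show False using b(2) 0 by (auto simp: less_Suc_eq)
    qed
    show "b (length vs) * w $ j = (\<Sum>i<length vs. - b i * vs ! i $ j)" if "j < p" for j
      using eq[OF that] by (simp add: sum_negf eq_neg_iff_add_eq_0 add.commute)
  qed
qed

lemma vecs_indep_length_le_span:
  assumes "vecs_indep p ws"
    and "\<And>w. w \<in> set ws \<Longrightarrow> \<exists>q a. q \<noteq> 0 \<and> (\<forall>j<p. q * w $ j = (\<Sum>i<length vs. a i * vs ! i $ j))"
  shows "length ws \<le> length vs"
proof (rule ccontr)
  assume "\<not> length ws \<le> length vs"
  then have less: "card {..<length vs} < card {..<length ws}" by simp
  let ?P = "\<lambda>k qa. fst qa \<noteq> 0 \<and> (\<forall>j<p. fst qa * ws ! k $ j = (\<Sum>i<length vs. snd qa i * vs ! i $ j))"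
  have "\<forall>k\<in>{..<length ws}. \<exists>qa. ?P k qa"
  proof
    fix k assume "k \<in> {..<length ws}"
    then have "ws ! k \<in> set ws" by simp
    from assms(2)[OF this] obtain q a where "q \<noteq> 0" "\<forall>j<p. q * ws ! k $ j = (\<Sum>i<length vs. a i * vs ! i $ j)"
      by (elim exE conjE)
    then show "\<exists>qa. ?P k qa" by (intro exI[of _ "(q, a)"]) simp
  qed
  from bchoice[OF this] obtain f where f: "\<forall>k\<in>{..<length ws}. ?P k (f k)" ..
  define q a where "q k = fst (f k)" and "a k = snd (f k)" for k
  have qa: "k < length ws \<Longrightarrow> q k \<noteq> 0"
    "k < length ws \<Longrightarrow> j < p \<Longrightarrow> q k * ws ! k $ j = (\<Sum>i<length vs. a k i * vs ! i $ j)" for k j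
    using f by (simp_all add: q_def a_def)
  \<comment> \<open>The coefficient vectors \<open>a k\<close> have fewer coordinates than there are
    vectors, so they satisfy a relation; weighted with the denominators \<open>q k\<close> it
    becomes a relation among \<open>ws\<close>.\<close>
  from exists_linear_relation[OF finite_lessThan finite_lessThan less, of a] obtain b where
    b: "\<exists>k<length ws. b k \<noteq> 0" "\<And>i. i < length vs \<Longrightarrow> (\<Sum>k<length ws. b k * a k i) = 0" by auto
  have "(\<Sum>k<length ws. (b k * q k) * ws ! k $ j) = 0" if "j < p" for j
  proof -
    have "(\<Sum>k<length ws. (b k * q k) * ws ! k $ j) = (\<Sum>k<length ws. \<Sum>i<length vs. b k * (a k i * vs ! i $ j))"
      using qa(2) that by (intro sum.cong) (auto simp: mult.assoc sum_distrib_left)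
    also have "\<dots> = (\<Sum>i<length vs. (\<Sum>k<length ws. b k * a k i) * vs ! i $ j)"
      by (subst sum.swap) (simp add: sum_distrib_right mult.assoc)
    finally show ?thesis using b(2) by simp
  qed
  then have "b k * q k = 0" if "k < length ws" for k
    using vecs_indepD[OF assms(1), of "\<lambda>k. b k * q k"] that by blast
  then show False using b(1) qa(1) by auto
qed

lemma maximal_indepI_span:
  assumes "set vs \<subseteq> W" "vecs_indep p vs"
    and "\<And>w. w \<in> W \<Longrightarrow> \<exists>q a. q \<noteq> 0 \<and> (\<forall>j<p. q * w $ j = (\<Sum>i<length vs. a i * vs ! i $ j))"
  shows "maximal_indep p W vs"
  unfolding maximal_indep_def
  using assms vecs_indep_length_le_span[of p _ vs] by blast

lemma vecs_indep_mset:
  assumes "vecs_indep p vs" "mset ws = mset vs"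
  shows "vecs_indep p ws"
proof -
  from mset_eq_permutation[OF assms(2)] obtain f where
    f: "f permutes {..<length vs}" "permute_list f vs = ws" by blast
  then have len: "length ws = length vs" by auto
  have nth: "ws ! i = vs ! f i" if "i < length vs" for i using f that permute_list_nth by metis
  show ?thesis unfolding vecs_indep_def
  proof (intro allI impI)
    fix a i assume a: "\<forall>j<p. (\<Sum>i<length ws. a i * ws ! i $ j) = 0" and i: "i < length ws"
    define b where "b = a \<circ> inv_into UNIV f"
    have "(\<Sum>k<length vs. b k * vs ! k $ j) = 0" if "j < p" for j
    proof -
      have "(\<Sum>k<length vs. b k * vs ! k $ j) = (\<Sum>i<length vs. b (f i) * vs ! f i $ j)"
        by (subst sum.permute[OF f(1)]) (simp add: o_def)
      also have "\<dots> = (\<Sum>i<length ws. a i * ws ! i $ j)"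
        using f(1) by (intro sum.cong) (auto simp: b_def len nth permutes_inverses)
      finally show ?thesis using a that by simp
    qed
    moreover have "f i < length vs" using permutes_in_image[OF f(1)] i len by auto
    ultimately have "b (f i) = 0" by (rule vecs_indepD[OF assms(1)])
    then show "a i = 0" using f(1) by (simp add: b_def permutes_inverses)
  qed
qed

lemma maximal_indep_mset:
  "maximal_indep p W vs \<Longrightarrow> mset ws = mset vs \<Longrightarrow> maximal_indep p W ws"
  using vecs_indep_mset[of p vs ws] mset_eq_setD[of ws vs] mset_eq_length[of ws vs]
  by (simp add: maximal_indep_def)

lemma vecs_indep_replace:
  assumes ind: "vecs_indep p vs" and i: "i < length vs" "a i \<noteq> 0" and q: "q \<noteq> 0"
    and w: "\<And>j. j < p \<Longrightarrow> q * w $ j = (\<Sum>k<length vs. a k * vs ! k $ j)"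
  shows "vecs_indep p (vs[i := w])"
  unfolding vecs_indep_def
proof (intro allI impI)
  fix b l assume b: "\<forall>j<p. (\<Sum>k<length (vs[i := w]). b k * vs[i := w] ! k $ j) = 0"
    and l: "l < length (vs[i := w])"
  \<comment> \<open>The relation \<open>b\<close> is multiplied by \<open>q\<close> and
    \<open>q * w\<close> is expanded; \<open>c\<close> collects the resulting coefficients of
    \<open>vs\<close>. At \<open>i\<close> only \<open>b i * a i\<close> remains, which forces
    \<open>b i = 0\<close> first.\<close>
  define c where "c k = (if k = i then 0 else q * b k) + b i * a k" for k
  have "(\<Sum>k<length vs. c k * vs ! k $ j) = 0" if j: "j < p" for j
  proof -
    have split: "(\<Sum>k<length vs. f k) = f i + (\<Sum>k\<in>{..<length vs} - {i}. f k)" for f :: "nat \<Rightarrow> 'a"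
      using i by (simp add: sum.remove)
    have "(\<Sum>k<length vs. c k * vs ! k $ j) =
        (\<Sum>k<length vs. if k = i then 0 else q * (b k * vs ! k $ j)) + b i * (\<Sum>k<length vs. a k * vs ! k $ j)"
      unfolding sum_distrib_left sum.distrib[symmetric]
      by (intro sum.cong) (auto simp: c_def algebra_simps)
    also have "(\<Sum>k<length vs. if k = i then 0 else q * (b k * vs ! k $ j)) =
        q * (\<Sum>k\<in>{..<length vs} - {i}. b k * vs[i := w] ! k $ j)"
      unfolding split[of "\<lambda>k. if k = i then 0 else _ k"] sum_distrib_left by (auto intro!: sum.cong)
    also have "b i * (\<Sum>k<length vs. a k * vs ! k $ j) = q * (b i * vs[i := w] ! i $ j)"
      using w[OF j] i by (simp add: mult_ac flip: w[OF j])
    also have "q * (\<Sum>k\<in>{..<length vs} - {i}. b k * vs[i := w] ! k $ j) + q * (b i * vs[i := w] ! i $ j) =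
        q * (\<Sum>k<length vs. b k * vs[i := w] ! k $ j)"
      unfolding split[of "\<lambda>k. b k * vs[i := w] ! k $ j"] by (simp add: distrib_left)
    finally show ?thesis using b j by simp
  qed
  then have c0: "c k = 0" if "k < length vs" for k using vecs_indepD[OF ind, of c k] that by blast
  from c0[OF i(1)] have "b i = 0" using i by (simp add: c_def)
  with c0[of l] q l show "b l = 0" by (simp add: c_def split: if_splits)
qed

section \<open>Reduced bases and the comparison of degrees\<close>

lemma degree_le_vec_degree: "v \<in> carrier_vec p \<Longrightarrow> j < p \<Longrightarrow> degree (v $ j) \<le> vec_degree v"
  unfolding vec_degree_def vec_set_def by (intro Max_ge) auto

lemma vec_degree_leI:
  "v \<in> carrier_vec p \<Longrightarrow> 0 < p \<Longrightarrow> (\<And>j. j < p \<Longrightarrow> degree (v $ j) \<le> D) \<Longrightarrow> vec_degree v \<le> D"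
  unfolding vec_degree_def vec_set_def by (subst Max_le_iff) auto

text \<open>The matrix with columns \<open>vs\<close> is column reduced: its highest-degree
  coefficients, taken column by column, form a matrix of full column rank.\<close>

definition lead_indep :: "nat \<Rightarrow> 'a::field poly vec list \<Rightarrow> bool" where
  "lead_indep p vs \<longleftrightarrow>
     (\<forall>c. (\<forall>j<p. (\<Sum>i<length vs. c i * coeff (vs ! i $ j) (vec_degree (vs ! i))) = 0) \<longrightarrow>
        (\<forall>i<length vs. c i = 0))"

text \<open>The matrix with columns \<open>vs\<close> keeps full column rank at every point of the
  field. Together with \<open>lead_indep\<close> this is Forney's criterion for minimal
  bases.\<close>

definition eval_indep :: "nat \<Rightarrow> 'a::field poly vec list \<Rightarrow> bool" where
  "eval_indep p vs \<longleftrightarrow>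
     (\<forall>x c. (\<forall>j<p. (\<Sum>i<length vs. c i * poly (vs ! i $ j) x) = 0) \<longrightarrow> (\<forall>i<length vs. c i = 0))"

lemma lead_indepD:
  assumes "lead_indep p vs"
    "\<And>j. j < p \<Longrightarrow> (\<Sum>i<length vs. c i * coeff (vs ! i $ j) (vec_degree (vs ! i))) = 0"
    "i < length vs"
  shows "c i = 0"
proof -
  from assms(1) have "(\<forall>j<p. (\<Sum>i<length vs. c i * coeff (vs ! i $ j) (vec_degree (vs ! i))) = 0) \<longrightarrow>
      (\<forall>i<length vs. c i = 0)"
    unfolding lead_indep_def by (rule spec)
  then have "\<forall>i<length vs. c i = 0"
    by (rule mp) (intro allI impI assms(2))
  with assms(3) show ?thesis by simp
qed

lemma eval_indepD:
  assumes "eval_indep p vs" "\<And>j. j < p \<Longrightarrow> (\<Sum>i<length vs. c i * poly (vs ! i $ j) x) = 0" "i < length vs"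
  shows "c i = 0"
proof -
  from assms(1) have "(\<forall>j<p. (\<Sum>i<length vs. c i * poly (vs ! i $ j) x) = 0) \<longrightarrow> (\<forall>i<length vs. c i = 0)"
    unfolding eval_indep_def by (elim allE[of _ x], elim allE[of _ c])
  then have "\<forall>i<length vs. c i = 0"
    by (rule mp) (intro allI impI assms(2))
  with assms(3) show ?thesis by simp
qed

lemma coeff_mult_at_bound:
  assumes "degree v \<le> b"
  shows "coeff (a * v) (degree a + b) = lead_coeff a * coeff v (b :: nat)"
proof (cases "degree v = b")
  case True
  then show ?thesis using coeff_mult_degree_sum[of a v] by simp
next
  case False
  then have "degree (a * v) < degree a + b" using assms degree_mult_le[of a v] by linarith
  then show ?thesis using False assms by (simp add: coeff_eq_0)
qed

text \<open>Predictable degree property: the terms of maximal degree \<open>D\<close> cannot cancel,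
  because their coefficients at \<open>D\<close> form a nontrivial combination of independent
  leading vectors.\<close>

lemma lead_indep_degree_bound:
  fixes vs :: "'a::field poly vec list"
  assumes "lead_indep p vs" "set vs \<subseteq> carrier_vec p" "k < length vs" "a k \<noteq> 0"
  shows "\<exists>j<p. (\<Sum>i<length vs. a i * vs ! i $ j) \<noteq> 0 \<and>
    degree (a k) + vec_degree (vs ! k) \<le> degree (\<Sum>i<length vs. a i * vs ! i $ j)"
proof -
  define S where "S = (\<lambda>i. degree (a i) + vec_degree (vs ! i)) ` {i. i < length vs \<and> a i \<noteq> 0}"
  have fin: "finite S" "S \<noteq> {}" using assms by (auto simp: S_def)
  define D where "D = Max S"
  have D: "degree (a i) + vec_degree (vs ! i) \<le> D" if "i < length vs" "a i \<noteq> 0" for i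
    unfolding D_def using fin that by (intro Max_ge) (auto simp: S_def)
  have "D \<in> S" unfolding D_def using fin by (rule Max_in)
  then obtain l where l: "l < length vs" "a l \<noteq> 0" "degree (a l) + vec_degree (vs ! l) = D" by (auto simp: S_def)
  define c where "c i = (if a i \<noteq> 0 \<and> degree (a i) + vec_degree (vs ! i) = D then lead_coeff (a i) else 0)" for i
  have "c l \<noteq> 0" using l by (simp add: c_def)
  have "\<exists>j<p. (\<Sum>i<length vs. c i * coeff (vs ! i $ j) (vec_degree (vs ! i))) \<noteq> 0"
  proof (rule ccontr)
    assume *: "\<not> ?thesis"
    have "c l = 0" by (rule lead_indepD[where c = c, OF assms(1) _ l(1)]) (use * in blast)
    with \<open>c l \<noteq> 0\<close> show False by simp
  qed
  then obtain j where j: "j < p"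
    "(\<Sum>i<length vs. c i * coeff (vs ! i $ j) (vec_degree (vs ! i))) \<noteq> 0" by (elim exE conjE)
  have "coeff (a i * vs ! i $ j) D = c i * coeff (vs ! i $ j) (vec_degree (vs ! i))" if i: "i < length vs" for i
  proof -
    have deg: "degree (vs ! i $ j) \<le> vec_degree (vs ! i)"
      using degree_le_vec_degree assms(2) i j(1) by (meson nth_mem subsetD)
    show ?thesis
    proof (cases "a i \<noteq> 0 \<and> degree (a i) + vec_degree (vs ! i) = D")
      case True
      then show ?thesis using coeff_mult_at_bound[OF deg, of "a i"] by (simp add: c_def)
    next
      case False
      then have "a i = 0 \<or> degree (a i * vs ! i $ j) < D"
        using D[OF i] deg degree_mult_le[of "a i" "vs ! i $ j"] by linarith
      then show ?thesis using False by (auto simp: c_def coeff_eq_0)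
    qed
  qed
  then have "coeff (\<Sum>i<length vs. a i * vs ! i $ j) D \<noteq> 0"
    using j(2) by (simp add: coeff_sum)
  then have "(\<Sum>i<length vs. a i * vs ! i $ j) \<noteq> 0" "D \<le> degree (\<Sum>i<length vs. a i * vs ! i $ j)"
    by (auto intro: le_degree)
  then show ?thesis using D[OF assms(3,4)] j(1) by (intro exI[of _ j]) auto
qed

lemma lead_indep_imp_vecs_indep:
  "lead_indep p vs \<Longrightarrow> set vs \<subseteq> carrier_vec p \<Longrightarrow> vecs_indep p vs"
  unfolding vecs_indep_def
proof (intro allI impI, rule ccontr)
  fix a i assume *: "lead_indep p vs" "set vs \<subseteq> carrier_vec p" "i < length vs" "a i \<noteq> 0"
    and 0: "\<forall>j<p. (\<Sum>i<length vs. a i * vs ! i $ j) = 0"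
  from lead_indep_degree_bound[where a = a and k = i, OF *] obtain j where "j < p" "(\<Sum>i<length vs. a i * vs ! i $ j) \<noteq> 0"
    by (elim exE conjE)
  with 0 show False by simp
qed

text \<open>At a root of the denominator \<open>q\<close> the coefficients must vanish, so the root cancels.\<close>

lemma eval_indep_polynomial_coeffs:
  fixes vs :: "'a::alg_closed_field poly vec list"
  assumes "eval_indep p vs" "q \<noteq> 0"
    and "\<And>j. j < p \<Longrightarrow> q * w $ j = (\<Sum>i<length vs. a i * vs ! i $ j)"
  shows "\<exists>b. \<forall>j<p. w $ j = (\<Sum>i<length vs. b i * vs ! i $ j)"
  using assms(2,3)
proof (induction "degree q" arbitrary: q a)
  case 0
  then obtain c where c: "q = [:c:]" "c \<noteq> 0" by (auto elim!: degree_eq_zeroE)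
  have "w $ j = (\<Sum>i<length vs. smult (inverse c) (a i) * vs ! i $ j)" if "j < p" for j
  proof -
    have "w $ j = smult (inverse c) (q * w $ j)" using c by simp
    then show ?thesis using 0(3)[OF that] by (simp add: smult_sum2)
  qed
  then show ?case by (intro exI[of _ "\<lambda>i. smult (inverse c) (a i)"]) simp
next
  case (Suc k)
  then obtain x where x: "poly q x = 0" using alg_closed_imp_poly_has_root[of q] by auto
  have x0: "(\<Sum>i<length vs. poly (a i) x * poly (vs ! i $ j) x) = 0" if "j < p" for j
    using arg_cong[OF Suc.prems(2)[OF that], of "\<lambda>q. poly q x"] x by (simp add: poly_sum)
  have "\<forall>i<length vs. poly (a i) x = 0"
    by (intro allI impI eval_indepD[OF assms(1) x0])
  then have "\<forall>i<length vs. \<exists>b. a i = [:-x, 1:] * b" unfolding poly_eq_0_iff_dvd dvd_def .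
  then obtain b where b: "\<And>i. i < length vs \<Longrightarrow> a i = [:-x, 1:] * b i" by metis
  from x obtain r where r: "q = [:-x, 1:] * r" by (auto simp: poly_eq_0_iff_dvd elim!: dvdE)
  then have r0: "r \<noteq> 0" using Suc.prems(1) by auto
  then have "degree q = Suc (degree r)"
    by (simp add: r degree_mult_eq del: mult_pCons_left)
  then have k: "k = degree r" using Suc.hyps(2) by simp
  have "r * w $ j = (\<Sum>i<length vs. b i * vs ! i $ j)" if "j < p" for j
  proof -
    have "[:-x, 1:] * (r * w $ j) = q * w $ j" unfolding r by (rule mult.assoc[symmetric])
    also have "\<dots> = (\<Sum>i<length vs. a i * vs ! i $ j)" by (rule Suc.prems(2)[OF that])
    also have "\<dots> = [:-x, 1:] * (\<Sum>i<length vs. b i * vs ! i $ j)"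
      unfolding sum_distrib_left by (intro sum.cong refl) (simp only: lessThan_iff b mult.assoc)
    finally show ?thesis by (subst (asm) mult_cancel_left) auto
  qed
  then show ?case by (rule Suc.hyps(1)[OF k r0])
qed

text \<open>Both halves of reducedness enter: full rank at finite points removes the denominator
  \<open>q\<close>, and the predictable degree property then excludes basis vectors of degree above
  that of \<open>w\<close>.\<close>

lemma reduced_basis_coeffs:
  fixes vs :: "'a::alg_closed_field poly vec list"
  assumes red: "lead_indep p vs" "eval_indep p vs" and vs: "maximal_indep p W vs" "set vs \<subseteq> carrier_vec p"
    and w: "w \<in> W" "w \<in> carrier_vec p"
  shows "\<exists>a. (\<forall>j<p. w $ j = (\<Sum>i<length vs. a i * vs ! i $ j)) \<and>
    (\<forall>i<length vs. a i \<noteq> 0 \<longrightarrow> vec_degree (vs ! i) \<le> vec_degree w)"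
proof -
  from maximal_indep_dependent[OF vs(1) w(1)] obtain q b where
    qb: "q \<noteq> 0" "\<forall>j<p. q * w $ j = (\<Sum>i<length vs. b i * vs ! i $ j)" by (elim exE conjE)
  from eval_indep_polynomial_coeffs[OF red(2) qb(1) qb(2)[rule_format]] obtain a where
    a: "\<forall>j<p. w $ j = (\<Sum>i<length vs. a i * vs ! i $ j)" ..
  show ?thesis
  proof (intro exI[of _ a] conjI allI impI)
    fix i assume i: "i < length vs" "a i \<noteq> 0"
    from lead_indep_degree_bound[where a = a and k = i, OF red(1) vs(2) i] obtain j where j: "j < p"
      "degree (a i) + vec_degree (vs ! i) \<le> degree (\<Sum>i<length vs. a i * vs ! i $ j)" by (elim exE conjE)
    then have "vec_degree (vs ! i) \<le> degree (w $ j)" using a by simp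
    also have "\<dots> \<le> vec_degree w" by (rule degree_le_vec_degree[OF w(2) j(1)])
    finally show "vec_degree (vs ! i) \<le> vec_degree w" .
  qed (use a in simp)
qed

text \<open>If \<open>ws ! j\<close> had smaller degree, the \<open>j + 1\<close> vectors up to
  \<open>ws ! j\<close> would all be combinations of the first \<open>j\<close> vectors of
  \<open>vs\<close>, contradicting their independence.\<close>

lemma reduced_basis_degrees_le:
  fixes vs ws :: "'a::alg_closed_field poly vec list"
  assumes red: "lead_indep p vs" "eval_indep p vs" and W: "W \<subseteq> carrier_vec p"
    and vs: "maximal_indep p W vs" "sorted (map vec_degree vs)"
    and ws: "set ws \<subseteq> W" "vecs_indep p ws" "sorted (map vec_degree ws)"
    and j: "j < length vs" "j < length ws"
  shows "vec_degree (vs ! j) \<le> vec_degree (ws ! j)"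
proof (rule ccontr)
  assume "\<not> ?thesis"
  then have less: "vec_degree (ws ! j) < vec_degree (vs ! j)" by simp
  let ?P = "\<lambda>k a. (\<forall>l<p. ws ! k $ l = (\<Sum>i<length vs. a i * vs ! i $ l)) \<and> (\<forall>i<length vs. a i \<noteq> 0 \<longrightarrow> i < j)"
  have vsW: "set vs \<subseteq> carrier_vec p" using vs(1) W by (auto simp: maximal_indep_def)
  have "\<forall>k\<in>{..j}. \<exists>a. ?P k a"
  proof
    fix k assume k: "k \<in> {..j}"
    then have wk: "ws ! k \<in> W" using ws(1) j by (meson atMost_iff le_less_trans nth_mem subsetD)
    from reduced_basis_coeffs[OF red vs(1) vsW wk subsetD[OF W wk]] obtain a where
      a: "\<forall>l<p. ws ! k $ l = (\<Sum>i<length vs. a i * vs ! i $ l)"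
      "\<forall>i<length vs. a i \<noteq> 0 \<longrightarrow> vec_degree (vs ! i) \<le> vec_degree (ws ! k)" by (elim exE conjE)
    have "i < j" if i: "i < length vs" "a i \<noteq> 0" for i
    proof (rule ccontr)
      assume "\<not> i < j"
      then have "vec_degree (vs ! j) \<le> vec_degree (vs ! i)"
        using sorted_nth_mono[OF vs(2), of j i] i by simp
      moreover have "vec_degree (ws ! k) \<le> vec_degree (ws ! j)"
        using sorted_nth_mono[OF ws(3), of k j] k j by simp
      ultimately show False using a(2) i less by fastforce
    qed
    then show "\<exists>a. ?P k a" using a(1) by (intro exI[of _ a]) simp
  qed
  from bchoice[OF this] obtain a where a: "\<forall>k\<in>{..j}. ?P k (a k)" ..
  have card: "card {..<j} < card {..j}" by simp
  from exists_linear_relation[OF finite_lessThan finite_atMost card, of a] obtain b where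
    b: "\<exists>k\<in>{..j}. b k \<noteq> 0" "\<forall>i\<in>{..<j}. (\<Sum>k\<le>j. b k * a k i) = 0" by (elim exE conjE)
  have b0: "(\<Sum>k\<le>j. b k * a k i) = 0" if "i < length vs" for i
  proof (cases "i < j")
    case False
    then have "a k i = 0" if "k \<le> j" for k using a that \<open>i < length vs\<close> by auto
    then show ?thesis by simp
  qed (use b(2) in simp)
  define c where "c k = (if k \<le> j then b k else 0)" for k
  have c0: "(\<Sum>k<length ws. c k * ws ! k $ l) = 0" if l: "l < p" for l
  proof -
    have "(\<Sum>k<length ws. c k * ws ! k $ l) = (\<Sum>k\<le>j. b k * ws ! k $ l)"
      using j(2) by (intro sum.mono_neutral_cong_right) (auto simp: c_def)
    also have "\<dots> = (\<Sum>k\<le>j. \<Sum>i<length vs. b k * (a k i * vs ! i $ l))"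
      using a l by (intro sum.cong refl) (simp add: sum_distrib_left)
    also have "\<dots> = (\<Sum>i<length vs. (\<Sum>k\<le>j. b k * a k i) * vs ! i $ l)"
      by (subst sum.swap) (simp add: sum_distrib_right mult.assoc)
    finally show ?thesis using b0 by simp
  qed
  have "c k = 0" if "k < length ws" for k by (rule vecs_indepD[where a = c, OF ws(2) c0 that])
  then have "b k = 0" if "k \<le> j" for k using that j(2) by (metis c_def le_less_trans)
  then show False using b(1) by auto
qed

lemma maximal_indep_length_eq:
  "maximal_indep p W vs \<Longrightarrow> maximal_indep p W ws \<Longrightarrow> length vs = length ws"
  unfolding maximal_indep_def by (blast intro: le_antisym)

lemma basis_order_update:
  "i < length vs \<Longrightarrow> vec_degree w < vec_degree (vs ! i) \<Longrightarrow> basis_order (vs[i := w]) < basis_order vs"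
  using member_le_sum_list[of "vec_degree (vs ! i)" "map vec_degree vs"]
  unfolding basis_order_def by (auto simp: map_update sum_list_update)

text \<open>If the basis is not reduced, a basis vector of largest degree in the offending relation can be
  replaced by one of smaller degree.\<close>

lemma not_minimal_if_smaller_combination:
  fixes vs :: "'a::field poly vec list"
  assumes W: "saturated p W" and vs: "maximal_indep p W vs"
    and i: "i < length vs" "a i \<noteq> 0" and q: "q \<noteq> 0" and w: "w \<in> carrier_vec p"
    and rel: "\<And>j. j < p \<Longrightarrow> q * w $ j = (\<Sum>k<length vs. a k * vs ! k $ j)"
    and deg: "\<And>j. j < p \<Longrightarrow> w $ j = 0 \<or> degree (w $ j) < vec_degree (vs ! i)"
  shows "\<exists>us. maximal_indep p W us \<and> basis_order us < basis_order vs"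
proof -
  have vsW: "set vs \<subseteq> W" "vecs_indep p vs" using vs by (auto simp: maximal_indep_def)
  have "w \<in> W" by (rule saturatedD[where a = a, OF W vsW(1) w q rel])
  moreover have "vecs_indep p (vs[i := w])" by (rule vecs_indep_replace[where a = a, OF vsW(2) i q rel])
  ultimately have us: "maximal_indep p W (vs[i := w])"
    using vs set_update_subset_insert[of vs i w] unfolding maximal_indep_def by auto
  have "\<exists>j<p. w $ j \<noteq> 0"
  proof (rule ccontr)
    assume *: "\<not> ?thesis"
    have "a i = 0"
      by (rule vecs_indepD[where a = a, OF vsW(2) _ i(1)]) (use * rel in fastforce)
    with i(2) show False by simp
  qed
  \<comment> \<open>\<open>w\<close> has a nonzero coordinate of degree below that of
    \<open>vs ! i\<close>, so this degree is positive and the truncated subtraction of 1 is a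
    genuine decrease.\<close>
  then have D: "0 < vec_degree (vs ! i)" "0 < p" using deg by fastforce+
  have "vec_degree w \<le> vec_degree (vs ! i) - 1"
    using deg D by (intro vec_degree_leI[OF w]) fastforce+
  then have "basis_order (vs[i := w]) < basis_order vs" using D i(1) by (intro basis_order_update) auto
  with us show ?thesis by blast
qed

lemma exists_index_max_degree:
  fixes f :: "nat \<Rightarrow> nat"
  assumes "i < (N :: nat)" "Q i"
  shows "\<exists>k. k < N \<and> Q k \<and> (\<forall>l<N. Q l \<longrightarrow> f l \<le> f k)"
proof -
  let ?S = "{l. l < N \<and> Q l}"
  have "finite ?S" "?S \<noteq> {}" using assms by auto
  then obtain k where "k \<in> ?S" "\<And>l. l \<in> ?S \<Longrightarrow> f l \<le> f k"
    using obtains_MAX[of ?S f] Max_ge[of "f ` ?S"] by (metis (no_types, lifting) finite_imageI imageI)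
  then show ?thesis by auto
qed

lemma minimal_imp_lead_indep:
  fixes vs :: "'a::field poly vec list"
  assumes W: "saturated p W" and vs: "maximal_indep p W vs"
    and min: "\<And>ws. maximal_indep p W ws \<Longrightarrow> basis_order vs \<le> basis_order ws"
  shows "lead_indep p vs"
  unfolding lead_indep_def
proof (intro allI impI, rule ccontr)
  fix c l assume rel: "\<forall>j<p. (\<Sum>i<length vs. c i * coeff (vs ! i $ j) (vec_degree (vs ! i))) = 0"
    and l: "l < length vs" "c l \<noteq> 0"
  from exists_index_max_degree[of l "length vs" "\<lambda>l. c l \<noteq> 0" "\<lambda>l. vec_degree (vs ! l)", OF l]
  obtain i where i: "i < length vs" "c i \<noteq> 0"
    and "\<forall>l<length vs. c l \<noteq> 0 \<longrightarrow> vec_degree (vs ! l) \<le> vec_degree (vs ! i)" by (elim exE conjE)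
  then have max: "\<And>l. l < length vs \<Longrightarrow> c l \<noteq> 0 \<Longrightarrow> vec_degree (vs ! l) \<le> vec_degree (vs ! i)" by simp
  have vsW: "set vs \<subseteq> carrier_vec p" using vs W by (auto simp: maximal_indep_def saturated_def)
  let ?D = "vec_degree (vs ! i)"
  \<comment> \<open>Shifting each vector by a power of \<open>X\<close> aligns the leading vectors
    at degree \<open>?D\<close>, where the relation \<open>c\<close> cancels them. As
    \<open>i\<close> has maximal degree among the vectors that occur, no exponent is truncated for
    these, and \<open>a i\<close> is the constant \<open>c i\<close>.\<close>
  define a where "a k = monom (c k) (?D - vec_degree (vs ! k))" for k
  define w where "w = vec p (\<lambda>j. \<Sum>k<length vs. a k * vs ! k $ j)"
  have deg_w: "w $ j = 0 \<or> degree (w $ j) < ?D" if j: "j < p" for j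
  proof -
    have deg: "degree (vs ! k $ j) \<le> vec_degree (vs ! k)" if "k < length vs" for k
      by (rule degree_le_vec_degree[OF subsetD[OF vsW nth_mem[OF that]] j])
    have "degree (a k * vs ! k $ j) \<le> ?D \<and>
        coeff (a k * vs ! k $ j) ?D = c k * coeff (vs ! k $ j) (vec_degree (vs ! k))"
      if k: "k < length vs" for k
    proof (cases "c k = 0")
      case False
      then have D: "?D = degree (a k) + vec_degree (vs ! k)" "lead_coeff (a k) = c k"
        using max[OF k] by (simp_all add: a_def degree_monom_eq)
      then show ?thesis using coeff_mult_at_bound[OF deg[OF k], of "a k"] deg[OF k]
        by (metis add_left_mono degree_mult_le order_trans)
    qed (simp add: a_def)
    then have "degree (w $ j) \<le> ?D" "coeff (w $ j) ?D = 0"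
      using j rel by (auto simp: w_def coeff_sum intro!: degree_sum_le)
    then show ?thesis by (metis le_neq_implies_less leading_coeff_0_iff)
  qed
  have "\<exists>us. maximal_indep p W us \<and> basis_order us < basis_order vs"
    by (rule not_minimal_if_smaller_combination[where a = a and q = 1 and w = w, OF W vs i(1) _ _ _ _ deg_w])
      (use i in \<open>auto simp: a_def w_def\<close>)
  then show False using min by (auto simp: not_le[symmetric])
qed

lemma minimal_imp_eval_indep:
  fixes vs :: "'a::field poly vec list"
  assumes W: "saturated p W" and vs: "maximal_indep p W vs"
    and min: "\<And>ws. maximal_indep p W ws \<Longrightarrow> basis_order vs \<le> basis_order ws"
  shows "eval_indep p vs"
  unfolding eval_indep_def
proof (intro allI impI, rule ccontr)
  fix x c l assume rel: "\<forall>j<p. (\<Sum>i<length vs. c i * poly (vs ! i $ j) x) = 0"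
    and l: "l < length vs" "c l \<noteq> 0"
  from exists_index_max_degree[of l "length vs" "\<lambda>l. c l \<noteq> 0" "\<lambda>l. vec_degree (vs ! l)", OF l]
  obtain i where i: "i < length vs" "c i \<noteq> 0"
    and "\<forall>l<length vs. c l \<noteq> 0 \<longrightarrow> vec_degree (vs ! l) \<le> vec_degree (vs ! i)" by (elim exE conjE)
  then have max: "\<And>l. l < length vs \<Longrightarrow> c l \<noteq> 0 \<Longrightarrow> vec_degree (vs ! l) \<le> vec_degree (vs ! i)" by simp
  have vsW: "set vs \<subseteq> carrier_vec p" using vs W by (auto simp: maximal_indep_def saturated_def)
  let ?D = "vec_degree (vs ! i)" and ?a = "\<lambda>k. [:c k:]"
  define u where "u j = (\<Sum>k<length vs. ?a k * vs ! k $ j)" for j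
  \<comment> \<open>The combination \<open>u\<close> vanishes at \<open>x\<close>, so dividing by
    \<open>X - x\<close> lowers the degree; saturation keeps the quotient \<open>w\<close> in
    \<open>W\<close>.\<close>
  define w where "w = vec p (\<lambda>j. u j div [:-x, 1:])"
  have w: "[:-x, 1:] * w $ j = u j" if "j < p" for j
  proof -
    have "poly (u j) x = 0" using rel that by (simp add: u_def poly_sum)
    then have "[:-x, 1:] dvd u j" by (simp add: poly_eq_0_iff_dvd)
    then have "[:-x, 1:] * (u j div [:-x, 1:]) = u j" by (rule dvd_mult_div_cancel)
    then show ?thesis using that by (simp only: w_def index_vec)
  qed
  have deg_w: "w $ j = 0 \<or> degree (w $ j) < ?D" if j: "j < p" for j
  proof -
    have "degree (?a k * vs ! k $ j) \<le> ?D" if k: "k < length vs" for k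
    proof (cases "c k = 0")
      case False
      then have "degree (?a k * vs ! k $ j) = degree (vs ! k $ j)" by simp
      also have "\<dots> \<le> vec_degree (vs ! k)"
        by (rule degree_le_vec_degree[OF subsetD[OF vsW nth_mem[OF k]] j])
      finally show ?thesis using max[OF k False] by simp
    qed simp
    then have "degree (u j) \<le> ?D" unfolding u_def by (intro degree_sum_le) auto
    moreover have "degree (u j) = Suc (degree (w $ j))" if "w $ j \<noteq> 0"
      using that by (simp add: w[OF j, symmetric] degree_mult_eq del: mult_pCons_left)
    ultimately show ?thesis by (cases "w $ j = 0") auto
  qed
  have "\<exists>us. maximal_indep p W us \<and> basis_order us < basis_order vs"
    by (rule not_minimal_if_smaller_combination[where a = ?a and q = "[:-x, 1:]" and w = w, OF W vs i(1) _ _ _ _ deg_w])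
      (use i w in \<open>auto simp: w_def u_def simp del: mult_pCons_left\<close>)
  then show False using min by (auto simp: not_le[symmetric])
qed

lemma exists_reduced_basis:
  fixes W :: "'a::field poly vec set"
  assumes W: "saturated p W"
  obtains vs where "maximal_indep p W vs" "lead_indep p vs" "eval_indep p vs" "sorted (map vec_degree vs)"
proof -
  from exists_maximal_indep obtain us0 where "maximal_indep p W us0" ..
  then obtain us where us: "maximal_indep p W us"
    "\<And>ws. maximal_indep p W ws \<Longrightarrow> basis_order us \<le> basis_order ws"
    using ex_has_least_nat[of "maximal_indep p W" us0 basis_order] by metis
  let ?vs = "sort_key vec_degree us"
  have vs: "maximal_indep p W ?vs" using maximal_indep_mset[OF us(1)] by simp
  have "basis_order ?vs = basis_order us"
    unfolding basis_order_def by (metis mset_map mset_sort sum_mset_sum_list)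
  then have min: "basis_order ?vs \<le> basis_order ws" if "maximal_indep p W ws" for ws
    using us(2)[OF that] by simp
  show ?thesis
    using that[OF vs minimal_imp_lead_indep[OF W vs min] minimal_imp_eval_indep[OF W vs min]] by simp
qed

lemma sum_list_mono_eq:
  fixes xs ys :: "nat list"
  assumes "length xs = length ys" "\<And>i. i < length xs \<Longrightarrow> xs ! i \<le> ys ! i" "sum_list ys \<le> sum_list xs"
  shows "xs = ys"
proof (rule nth_equalityI)
  fix i assume i: "i < length xs"
  show "xs ! i = ys ! i"
  proof (rule ccontr)
    assume "xs ! i \<noteq> ys ! i"
    then have "(\<Sum>i<length xs. xs ! i) < (\<Sum>i<length xs. ys ! i)"
      using i assms(2) by (intro sum_strict_mono_ex1) (auto intro!: bexI[of _ i] simp: less_le)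
    then show False using assms(1,3) by (simp add: sum_list_sum_nth atLeast0LessThan)
  qed
qed (use assms in simp)

text \<open>A reduced basis is smallest at every sorted position, not only in total order. Equality
  of the sums therefore forces equality of the degree lists, which is the uniqueness behind the
  \<open>THE\<close> in \<open>minimal_indices\<close>.\<close>

lemma minimal_indices_eq_reduced:
  fixes vs :: "'a::alg_closed_field poly vec list"
  assumes basis: "\<And>ws. poly_basis p V ws \<longleftrightarrow> sorted (map vec_degree ws) \<and> maximal_indep p W ws"
    and W: "W \<subseteq> carrier_vec p"
    and vs: "maximal_indep p W vs" "lead_indep p vs" "eval_indep p vs" "sorted (map vec_degree vs)"
  shows "minimal_indices p V = map vec_degree vs"
proof -
  have le: "length vs = length ws \<and> (\<forall>j<length vs. vec_degree (vs ! j) \<le> vec_degree (ws ! j))"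
    if "poly_basis p V ws" for ws
  proof (intro conjI allI impI)
    from that basis have ws: "sorted (map vec_degree ws)" "maximal_indep p W ws" by auto
    then show len: "length vs = length ws" using maximal_indep_length_eq[OF vs(1)] by blast
    fix j assume "j < length vs"
    then show "vec_degree (vs ! j) \<le> vec_degree (ws ! j)"
      using reduced_basis_degrees_le[OF vs(2,3) W vs(1,4) _ _ ws(1)] ws(2) len
      by (simp add: maximal_indep_def)
  qed
  have "basis_order vs \<le> basis_order ws" if "poly_basis p V ws" for ws
    using le[OF that] unfolding basis_order_def sum_list_sum_nth by (auto intro!: sum_mono)
  moreover have "poly_basis p V vs" unfolding basis using vs by simp
  ultimately have min: "minimal_basis p V vs" unfolding minimal_basis_def by blast
  have eq: "map vec_degree ws = map vec_degree vs" if "minimal_basis p V ws" for ws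
  proof (rule sum_list_mono_eq[symmetric])
    have "poly_basis p V ws" using that by (simp add: minimal_basis_def)
    from le[OF this] show "length (map vec_degree vs) = length (map vec_degree ws)"
      "\<And>i. i < length (map vec_degree vs) \<Longrightarrow> map vec_degree vs ! i \<le> map vec_degree ws ! i" by auto
    have "basis_order ws \<le> basis_order vs" using that min unfolding minimal_basis_def by blast
    then show "sum_list (map vec_degree ws) \<le> sum_list (map vec_degree vs)" unfolding basis_order_def .
  qed
  show ?thesis
    unfolding minimal_indices_def
  proof (rule the_equality)
    show "\<exists>us. minimal_basis p V us \<and> map vec_degree vs = map vec_degree us" using min by blast
  next
    fix ks assume "\<exists>us. minimal_basis p V us \<and> ks = map vec_degree us"
    then obtain us where "minimal_basis p V us" "ks = map vec_degree us" by (elim exE conjE)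
    then show "ks = map vec_degree vs" using eq by simp
  qed
qed

section \<open>Polynomial bases of kernels\<close>

lemma fract_as_quotient:
  fixes x :: "'b::idom fract"
  obtains s b where "s \<noteq> 0" "x * to_fract s = to_fract b"
proof (cases x rule: Fract_cases)
  case (Fract a b)
  then have "x * to_fract b = to_fract a" by (simp add: to_fract_def eq_fract)
  then show ?thesis using that Fract by blast
qed

lemma common_denominator:
  fixes f :: "'i \<Rightarrow> 'b::idom fract"
  assumes "finite I"
  shows "\<exists>s b. s \<noteq> 0 \<and> (\<forall>i\<in>I. f i * to_fract s = to_fract (b i))"
  using assms
proof (induction I)
  case empty
  then show ?case by (intro exI[of _ 1]) auto
next
  case (insert k I)
  then obtain s b where sb: "s \<noteq> 0" "\<forall>i\<in>I. f i * to_fract s = to_fract (b i)" by (elim exE conjE)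
  from fract_as_quotient[of "f k"] obtain s' b' where sb': "s' \<noteq> 0" "f k * to_fract s' = to_fract b'" .
  have "f i * to_fract (s * s') = to_fract ((b(k := b' * s) )i * (if i = k then 1 else s'))"
    if "i \<in> insert k I" for i
  proof (cases "i = k")
    case True
    have "f k * to_fract (s * s') = (f k * to_fract s') * to_fract s" by simp
    then show ?thesis using True sb' by simp
  next
    case False
    have "f i * to_fract (s * s') = (f i * to_fract s) * to_fract s'" by simp
    then show ?thesis using False that sb by simp
  qed
  then show ?case using sb(1) sb'(1)
    by (intro exI[of _ "s * s'"] exI[of _ "\<lambda>i. (b(k := b' * s)) i * (if i = k then 1 else s')"]) auto
qed

definition poly_points :: "nat \<Rightarrow> 'b::idom fract vec set \<Rightarrow> 'b vec set" where
  "poly_points p V = {w \<in> carrier_vec p. map_vec to_fract w \<in> V}"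

lemma in_mat_kernel_iff:
  assumes "R \<in> carrier_mat m p" "u \<in> carrier_vec p"
  shows "u \<in> mat_kernel R \<longleftrightarrow> (\<forall>l<m. (\<Sum>j<p. R $$ (l, j) * u $ j) = 0)"
proof -
  have "(R *\<^sub>v u) $ l = (\<Sum>j<p. R $$ (l, j) * u $ j)" if "l < m" for l
    using that assms by (simp add: scalar_prod_def atLeast0LessThan)
  moreover have "R *\<^sub>v u = 0\<^sub>v m \<longleftrightarrow> (\<forall>l<m. (R *\<^sub>v u) $ l = 0)"
    using assms(1) by (auto intro!: eq_vecI simp del: index_mult_mat_vec)
  ultimately show ?thesis using assms by (simp add: mat_kernel[OF assms(1)] del: index_mult_mat_vec)
qed

lemma saturated_poly_points:
  fixes R :: "'b::idom fract mat"
  assumes R: "R \<in> carrier_mat m p"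
  shows "saturated p (poly_points p (mat_kernel R))"
  unfolding saturated_def
proof (intro conjI allI impI)
  show "poly_points p (mat_kernel R) \<subseteq> carrier_vec p" by (auto simp: poly_points_def)
  fix vs a and q :: 'b and w assume vs: "set vs \<subseteq> poly_points p (mat_kernel R)" and w: "w \<in> carrier_vec p" and q: "q \<noteq> 0"
    and eq: "\<forall>j<p. q * w $ j = (\<Sum>i<length vs. a i * vs ! i $ j)"
  have v: "(\<Sum>j<p. R $$ (l, j) * to_fract (vs ! i $ j)) = 0" if "i < length vs" "l < m" for i l
  proof -
    have "vs ! i \<in> poly_points p (mat_kernel R)" using vs that by auto
    then show ?thesis using in_mat_kernel_iff[OF R, of "map_vec to_fract (vs ! i)"] that by (auto simp: poly_points_def)
  qed
  have "(\<Sum>j<p. R $$ (l, j) * to_fract (w $ j)) = 0" if l: "l < m" for l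
  proof -
    have "to_fract q * (\<Sum>j<p. R $$ (l, j) * to_fract (w $ j)) = (\<Sum>j<p. R $$ (l, j) * to_fract (q * w $ j))"
      by (simp add: sum_distrib_left mult_ac)
    also have "\<dots> = (\<Sum>j<p. \<Sum>i<length vs. R $$ (l, j) * to_fract (a i * vs ! i $ j))"
      using eq by (intro sum.cong refl) (simp add: to_fract_sum sum_distrib_left del: to_fract_mult)
    also have "\<dots> = (\<Sum>i<length vs. to_fract (a i) * (\<Sum>j<p. R $$ (l, j) * to_fract (vs ! i $ j)))"
      by (subst sum.swap) (simp add: sum_distrib_left mult_ac)
    also have "\<dots> = 0" using v[OF _ l] by simp
    finally show ?thesis using q by simp
  qed
  then show "w \<in> poly_points p (mat_kernel R)"
    using in_mat_kernel_iff[OF R, of "map_vec to_fract w"] w by (simp add: poly_points_def)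
qed

lemma vecs_indep_distinct:
  assumes "vecs_indep p vs"
  shows "distinct vs"
proof (rule ccontr)
  assume "\<not> distinct vs"
  then obtain k l where kl: "k < length vs" "l < length vs" "k \<noteq> l" "vs ! k = vs ! l"
    by (auto simp: distinct_conv_nth)
  let ?a = "\<lambda>i. if i = k then 1 else if i = l then - 1 else (0 :: 'a)"
  have "(\<Sum>i<length vs. ?a i * vs ! i $ j) = 0" for j
  proof -
    have "(\<Sum>i<length vs. ?a i * vs ! i $ j) = (\<Sum>i<length vs. (if i = k then vs ! k $ j else 0) - (if i = l then vs ! l $ j else 0))"
      using kl by (intro sum.cong) auto
    then show ?thesis using kl by (simp add: sum_subtractf)
  qed
  then have "?a k = 0" by (rule vecs_indepD[where a = ?a, OF assms _ kl(1)])
  then show False by simp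
qed

lemma to_fract_relation:
  fixes vs :: "'b::idom vec list" and r :: "nat \<Rightarrow> 'b fract"
  shows "\<exists>s b. s \<noteq> 0 \<and> (\<forall>i<length vs. r i * to_fract s = to_fract (b i)) \<and>
    (\<forall>j. to_fract s * (\<Sum>i<length vs. r i * to_fract (vs ! i $ j)) = to_fract (\<Sum>i<length vs. b i * vs ! i $ j))"
proof -
  from common_denominator[of "{..<length vs}" r] obtain s b where
    sb: "s \<noteq> 0" "\<forall>i\<in>{..<length vs}. r i * to_fract s = to_fract (b i)" by auto
  have "to_fract s * (\<Sum>i<length vs. r i * to_fract (vs ! i $ j)) = to_fract (\<Sum>i<length vs. b i * vs ! i $ j)" for j
    unfolding to_fract_sum sum_distrib_left to_fract_mult
    using sb(2) by (intro sum.cong refl) (metis mult.assoc mult.commute)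
  then show ?thesis using sb by (intro exI[of _ s] exI[of _ b]) auto
qed

text \<open>Bridge from bases over the rational functions to independence with polynomial
  coefficients; \<open>to_fract_relation\<close> and \<open>common_denominator\<close> clear the
  denominators.\<close>

lemma poly_basis_mat_kernel_iff:
  fixes R :: "'a::field poly fract mat"
  assumes R: "R \<in> carrier_mat m p"
  shows "poly_basis p (mat_kernel R) vs \<longleftrightarrow>
    sorted (map vec_degree vs) \<and> maximal_indep p (poly_points p (mat_kernel R)) vs"
proof -
  interpret kernel m p R by (unfold_locales) (rule R)
  let ?W = "poly_points p (mat_kernel R)" and ?S = "map_vec to_fract ` set vs"
  define f where "f i = map_vec to_fract (vs ! i)" for i
  have S: "?S = f ` {..<length vs}"
  proof -
    have "set vs = (\<lambda>i. vs ! i) ` {..<length vs}" by (auto simp: set_conv_nth)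
    then show ?thesis by (simp add: f_def image_image)
  qed
  have inj: "inj_on f {..<length vs}" if "distinct vs" "set vs \<subseteq> ?W"
  proof (rule inj_onI)
    fix i l assume il: "i \<in> {..<length vs}" "l \<in> {..<length vs}" "f i = f l"
    then have "vs ! i \<in> carrier_vec p" "vs ! l \<in> carrier_vec p"
      using that(2) by (auto simp: poly_points_def subset_iff)
    then have "vs ! i = vs ! l" using il(3) unfolding f_def
      by (metis carrier_vecD eq_vecI index_map_vec to_fract_eq_iff)
    then show "i = l" using il that(1) by (simp add: nth_eq_iff_index_eq)
  qed
  have comb: "lincomb \<alpha> ?S $ j = (\<Sum>i<length vs. \<alpha> (f i) * to_fract (vs ! i $ j))"
    if "distinct vs" "set vs \<subseteq> ?W" "j < p" for \<alpha> j
  proof -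
    have "?S \<subseteq> mat_kernel R" using that(2) by (auto simp: poly_points_def)
    then have "lincomb \<alpha> ?S $ j = (\<Sum>x\<in>?S. \<alpha> x * x $ j)" using that(3) by (intro lincomb_index)
    also have "\<dots> = (\<Sum>i<length vs. \<alpha> (f i) * f i $ j)" unfolding S by (rule sum.reindex_cong[OF inj[OF that(1,2)]]) auto
    also have "\<dots> = (\<Sum>i<length vs. \<alpha> (f i) * to_fract (vs ! i $ j))"
    proof (intro sum.cong refl)
      fix i assume "i \<in> {..<length vs}"
      then have "vs ! i \<in> ?W" using that(2) by auto
      then show "\<alpha> (f i) * f i $ j = \<alpha> (f i) * to_fract (vs ! i $ j)"
        using that(3) by (auto simp: f_def poly_points_def)
    qed
    finally show ?thesis .
  qed
  have carrier: "lincomb \<alpha> ?S \<in> carrier_vec p" if "set vs \<subseteq> ?W" for \<alpha>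
  proof -
    have "?S \<subseteq> mat_kernel R" using that by (auto simp: poly_points_def)
    then show ?thesis using lincomb_same[of ?S \<alpha>] mat_kernel_carrier[OF R] NC.lincomb_dim[of ?S \<alpha>]
      by (metis List.finite_set carrier_vecI finite_imageI order_trans)
  qed
  show ?thesis
  proof
    assume "poly_basis p (mat_kernel R) vs"
    then have vs: "set vs \<subseteq> carrier_vec p" "distinct vs" "sorted (map vec_degree vs)" and basis: "Ker.basis ?S"
      by (auto simp: poly_basis_def)
    from basis have indpt: "\<not> Ker.lin_dep ?S" and span: "Ker.span ?S = mat_kernel R" and sub: "?S \<subseteq> mat_kernel R"
      by (auto simp: Ker.basis_def)
    have vsW: "set vs \<subseteq> ?W" using vs sub by (auto simp: poly_points_def)
    have ind: "vecs_indep p vs" unfolding vecs_indep_def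
    proof (intro allI impI, rule ccontr)
      fix a k assume rel: "\<forall>j<p. (\<Sum>i<length vs. a i * vs ! i $ j) = 0" and k: "k < length vs" "a k \<noteq> 0"
      \<comment> \<open>\<open>lincomb\<close> takes coefficients indexed by vectors, while
        relations here are indexed by positions; injectivity of \<open>f\<close> translates between
        the two.\<close>
      define \<alpha> where "\<alpha> x = to_fract (a (the_inv_into {..<length vs} f x))" for x
      have \<alpha>: "\<alpha> (f i) = to_fract (a i)" if i: "i < length vs" for i
        using the_inv_into_f_f[OF inj[OF vs(2) vsW], of i] i by (simp add: \<alpha>_def)
      have "lincomb \<alpha> ?S = 0\<^sub>v p"
      proof (rule eq_vecI)
        fix j assume "j < dim_vec (0\<^sub>v p :: 'a poly fract vec)"
        then have j: "j < p" by simp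
        have "lincomb \<alpha> ?S $ j = to_fract (\<Sum>i<length vs. a i * vs ! i $ j)"
          unfolding comb[OF vs(2) vsW j] to_fract_sum to_fract_mult by (intro sum.cong refl) (simp add: \<alpha>)
        then show "lincomb \<alpha> ?S $ j = 0\<^sub>v p $ j" using rel j by simp
      qed (use carrier[OF vsW] in auto)
      moreover have "f k \<in> ?S" "\<alpha> (f k) \<noteq> 0" using k S by (auto simp: \<alpha>)
      ultimately have "Ker.lin_dep ?S" unfolding Ker.lin_dep_def by blast
      with indpt show False by contradiction
    qed
    have "\<exists>q a. q \<noteq> 0 \<and> (\<forall>j<p. q * w $ j = (\<Sum>i<length vs. a i * vs ! i $ j))" if w: "w \<in> ?W" for w
    proof -
      have "map_vec to_fract w \<in> Ker.span ?S" using w span by (simp add: poly_points_def)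
      then obtain \<alpha> where \<alpha>: "map_vec to_fract w = lincomb \<alpha> ?S"
        using Ker.finite_span[of ?S] sub by auto
      from to_fract_relation[of vs "\<lambda>i. \<alpha> (f i)"] obtain s b where sb: "s \<noteq> 0"
        "\<forall>j. to_fract s * (\<Sum>i<length vs. \<alpha> (f i) * to_fract (vs ! i $ j)) = to_fract (\<Sum>i<length vs. b i * vs ! i $ j)"
        by (elim exE conjE)
      have "s * w $ j = (\<Sum>i<length vs. b i * vs ! i $ j)" if j: "j < p" for j
      proof -
        have "to_fract (w $ j) = lincomb \<alpha> ?S $ j" using w j by (auto simp: \<alpha>[symmetric] poly_points_def)
        then have "to_fract (s * w $ j) = to_fract (\<Sum>i<length vs. b i * vs ! i $ j)"
          unfolding to_fract_mult comb[OF vs(2) vsW j] using sb(2) by simp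
        then show ?thesis by (simp only: to_fract_eq_iff)
      qed
      then show ?thesis using sb(1) by (intro exI[of _ s] exI[of _ b]) simp
    qed
    then have "maximal_indep p ?W vs" by (rule maximal_indepI_span[OF vsW ind])
    with vs(3) show "sorted (map vec_degree vs) \<and> maximal_indep p ?W vs" by simp
  next
    assume "sorted (map vec_degree vs) \<and> maximal_indep p ?W vs"
    then have sorted: "sorted (map vec_degree vs)" and max: "maximal_indep p ?W vs"
      and vsW: "set vs \<subseteq> ?W" and ind: "vecs_indep p vs"
      by (auto simp: maximal_indep_def)
    have dist: "distinct vs" using ind by (rule vecs_indep_distinct)
    have sub: "?S \<subseteq> mat_kernel R" using vsW by (auto simp: poly_points_def)
    have "\<not> Ker.lin_dep ?S"
    proof
      assume "Ker.lin_dep ?S"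
      then obtain \<alpha> v where \<alpha>: "lincomb \<alpha> ?S = 0\<^sub>v p" "v \<in> ?S" "\<alpha> v \<noteq> 0"
        using Ker.finite_lin_dep[of ?S] sub by auto
      from to_fract_relation[of vs "\<lambda>i. \<alpha> (f i)"] obtain s b where sb: "s \<noteq> 0"
        "\<forall>i<length vs. \<alpha> (f i) * to_fract s = to_fract (b i)"
        "\<forall>j. to_fract s * (\<Sum>i<length vs. \<alpha> (f i) * to_fract (vs ! i $ j)) = to_fract (\<Sum>i<length vs. b i * vs ! i $ j)"
        by (elim exE conjE)
      have b0: "(\<Sum>i<length vs. b i * vs ! i $ j) = 0" if j: "j < p" for j
      proof -
        have "to_fract (\<Sum>i<length vs. b i * vs ! i $ j) = to_fract s * lincomb \<alpha> ?S $ j"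
          unfolding comb[OF dist vsW j] by (rule sb(3)[rule_format, symmetric])
        also have "\<dots> = 0" unfolding \<alpha>(1) using j by simp
        finally show ?thesis by (simp only: to_fract_eq_0_iff)
      qed
      from \<alpha>(2) S obtain i where i: "i < length vs" "v = f i" by auto
      have "b i = 0" by (rule vecs_indepD[where a = b, OF ind b0 i(1)])
      then show False using sb(1,2) i \<alpha>(3) by fastforce
    qed
    moreover have "Ker.span ?S = mat_kernel R"
    proof
      show "Ker.span ?S \<subseteq> mat_kernel R" using Ker.span_is_subset2[of ?S] sub by simp
      show "mat_kernel R \<subseteq> Ker.span ?S"
      proof
        fix u assume u: "u \<in> mat_kernel R"
        then have uc: "u \<in> carrier_vec p" using mat_kernel_carrier[OF R] by auto
        from common_denominator[of "{..<p}" "\<lambda>j. u $ j"] obtain s b where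
          sb: "s \<noteq> 0" "\<forall>j\<in>{..<p}. u $ j * to_fract s = to_fract (b j)" by auto
        define w where "w = vec p b"
        have w_eq: "map_vec to_fract w = to_fract s \<cdot>\<^sub>v u"
          using sb uc by (intro eq_vecI) (auto simp: w_def mult.commute)
        then have "w \<in> ?W" using mat_kernel_smult[OF R u, of "to_fract s"] by (simp add: poly_points_def w_def)
        from maximal_indep_dependent[OF max this] obtain q a where
          qa: "q \<noteq> 0" "\<forall>j<p. q * w $ j = (\<Sum>i<length vs. a i * vs ! i $ j)" by (elim exE conjE)
        \<comment> \<open>Since \<open>w\<close> is \<open>s\<close> times \<open>u\<close> and
          \<open>q * w\<close> has coefficients \<open>a\<close>, the coefficients of
          \<open>u\<close> are \<open>a / (q * s)\<close>.\<close>
        define \<alpha> where "\<alpha> x = to_fract (a (the_inv_into {..<length vs} f x)) / to_fract (q * s)" for x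
        have \<alpha>: "\<alpha> (f i) = to_fract (a i) / to_fract (q * s)" if i: "i < length vs" for i
          using the_inv_into_f_f[OF inj[OF dist vsW], of i] i by (simp add: \<alpha>_def)
        have "u = lincomb \<alpha> ?S"
        proof (rule eq_vecI)
          fix j assume "j < dim_vec (lincomb \<alpha> ?S)"
          then have j: "j < p" using carrier[OF vsW, of \<alpha>] by simp
          have "lincomb \<alpha> ?S $ j = (\<Sum>i<length vs. to_fract (a i * vs ! i $ j) / to_fract (q * s))"
            unfolding comb[OF dist vsW j] by (intro sum.cong) (auto simp: \<alpha>)
          also have "\<dots> = to_fract (q * w $ j) / to_fract (q * s)"
            using qa(2) j by (simp add: to_fract_sum sum_divide_distrib del: to_fract_mult)
          also have "\<dots> = to_fract (w $ j) / to_fract s" using qa(1) by simp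
          also have "to_fract (w $ j) = u $ j * to_fract s" using sb(2) j by (simp add: w_def)
          finally show "u $ j = lincomb \<alpha> ?S $ j" using sb(1) by simp
        qed (use uc carrier[OF vsW, of \<alpha>] in simp)
        then show "u \<in> Ker.span ?S" using Ker.finite_span[of ?S] sub by auto
      qed
    qed
    ultimately have "Ker.basis ?S" using sub by (simp add: Ker.basis_def)
    then show "poly_basis p (mat_kernel R) vs"
      using sorted dist vsW by (auto simp: poly_basis_def poly_points_def)
  qed
qed

section \<open>Minimal indices under rational transformation\<close>

text \<open>It provides polynomial kernel vectors, the columns of \<open>e I - L P\<close>. Being a
  polynomial identity, it survives the substitution of \<open>n / d\<close>.\<close>

lemma exists_generalized_inverse:
  fixes P :: "'a::field poly mat"
  assumes P: "P \<in> carrier_mat m p"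
  shows "\<exists>L e. L \<in> carrier_mat p m \<and> e \<noteq> 0 \<and> P * L * P = e \<cdot>\<^sub>m P"
proof -
  from exists_smith_diagonal[OF P] obtain ds where len: "length ds = min m p"
    and eqv: "smith_equiv m p P (rect_diag m p ds)" by (elim exE conjE)
  from eqv obtain A B where AB: "unimodular m A" "unimodular p B" "A * P * B = rect_diag m p ds" by (rule smith_equivE)
  note Ac = unimodular_carrier[OF AB(1)] and Bc = unimodular_carrier[OF AB(2)]
  \<comment> \<open>A common multiple of the nonzero invariant polynomials, so that the quotients
    \<open>e div q\<close> invert the Smith diagonal up to the factor \<open>e\<close>. At zero
    entries both sides of the identity for \<open>es\<close> below vanish.\<close>
  define e where "e = prod_list (filter (\<lambda>q. q \<noteq> 0) ds)"
  define es where "es = map (\<lambda>q. e div q) ds"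
  let ?D = "rect_diag m p ds" and ?E = "rect_diag p m es"
  define L where "L = B * ?E * A"
  have Lc: "L \<in> carrier_mat p m" using Ac Bc by (auto simp: L_def)
  have e: "e \<noteq> 0" by (auto simp: e_def prod_list_zero_iff)
  have es: "ds ! i * es ! i * ds ! i = e * ds ! i" if "i < length ds" for i
  proof (cases "ds ! i = 0")
    case False
    then have "ds ! i \<in> set (filter (\<lambda>q. q \<noteq> 0) ds)" using that by simp
    then have "ds ! i dvd e" unfolding e_def by (rule prod_list_dvd)
    then show ?thesis using that by (simp add: es_def)
  qed simp
  have DED: "?D * ?E * ?D = e \<cdot>\<^sub>m ?D"
  proof (rule eq_matI)
    fix i j assume "i < dim_row (e \<cdot>\<^sub>m ?D)" "j < dim_col (e \<cdot>\<^sub>m ?D)"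
    then have ij: "i < m" "j < p" by auto
    have "(?D * ?E * ?D) $$ (i, j) = (\<Sum>k<min p m. ?D $$ (i, k) * es ! k * ?D $$ (k, j))"
      by (rule mult_rect_diag_index[OF rect_diag_carrier rect_diag_carrier ij])
    also have "\<dots> = (\<Sum>k<min p m. if k = i then if i = j then ds ! i * es ! i * ds ! i else 0 else 0)"
      using ij by (intro sum.cong) auto
    also have "\<dots> = (e \<cdot>\<^sub>m ?D) $$ (i, j)" using ij es[of i] len by auto
    finally show "(?D * ?E * ?D) $$ (i, j) = (e \<cdot>\<^sub>m ?D) $$ (i, j)" .
  qed auto
  have PLP: "P * L * P \<in> carrier_mat m p" using P Lc by auto
  have eP: "e \<cdot>\<^sub>m P \<in> carrier_mat m p" using P by auto
  have Ec: "?E \<in> carrier_mat p m" by simp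
  have "A * (P * L * P) * B = (A * P) * L * (P * B)"
    using mult_mat_assoc5[OF Ac P Lc P Bc] .
  also have "\<dots> = (A * P) * (B * ?E * A) * (P * B)" by (simp only: L_def)
  also have "\<dots> = (A * P * B) * ?E * (A * (P * B))"
    by (rule mult_mat_assoc5[OF mult_carrier_mat[OF Ac P] Bc Ec Ac mult_carrier_mat[OF P Bc]])
  also have "A * (P * B) = A * P * B" by (rule assoc_mult_mat[OF Ac P Bc, symmetric])
  also have "(A * P * B) * ?E * (A * P * B) = e \<cdot>\<^sub>m (A * P * B)" unfolding AB(3) by (rule DED)
  also have "\<dots> = A * (e \<cdot>\<^sub>m P) * B"
    using mult_smult_distrib[OF Ac P, of e] mult_smult_assoc_mat[OF mult_carrier_mat[OF Ac P] Bc, of e] by simp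
  finally have "A * (P * L * P) * B = A * (e \<cdot>\<^sub>m P) * B" .
  then have eq: "(det A * det B) \<cdot>\<^sub>m (P * L * P) = (det A * det B) \<cdot>\<^sub>m (e \<cdot>\<^sub>m P)"
    using adj_mult_mult_adj[OF PLP Ac Bc] adj_mult_mult_adj[OF eP Ac Bc] by metis
  have det: "det A * det B \<noteq> 0" using AB(1,2) by (auto simp: unimodular_def)
  have "P * L * P = e \<cdot>\<^sub>m P"
  proof (rule eq_matI)
    fix i j assume ij: "i < dim_row (e \<cdot>\<^sub>m P)" "j < dim_col (e \<cdot>\<^sub>m P)"
    then have "det A * det B * (P * L * P) $$ (i, j) = ((det A * det B) \<cdot>\<^sub>m (P * L * P)) $$ (i, j)"
      using PLP eP by (intro index_smult_mat(1)[symmetric]) auto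
    also have "\<dots> = det A * det B * (e \<cdot>\<^sub>m P) $$ (i, j)"
      unfolding eq using ij by (intro index_smult_mat(1)) auto
    finally show "(P * L * P) $$ (i, j) = (e \<cdot>\<^sub>m P) $$ (i, j)"
      using det by (subst (asm) mult_cancel_left) auto
  qed (use PLP eP in auto)
  with Lc e show ?thesis by blast
qed

lemma exists_nonroot:
  fixes d :: "'a::alg_closed_field poly"
  assumes "d \<noteq> 0"
  obtains y where "poly d y \<noteq> 0"
proof -
  \<comment> \<open>\<open>pCons 1 d\<close> is \<open>1 + X d(X)\<close>, which is nonconstant
    because \<open>d\<close> is nonzero; at a root \<open>y\<close> one has
    \<open>y d(y) = -1\<close>.\<close>
  have "degree (pCons 1 d) > 0" using assms by simp
  then obtain y where "poly (pCons 1 d) y = 0" using alg_closed_imp_poly_has_root by blast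
  then have "poly d y \<noteq> 0" by auto
  then show ?thesis by (rule that)
qed

text \<open>A nonconstant \<open>n / d\<close> is transcendental over the field:
  \<open>order_homogenize\<close>, used at a point where \<open>d\<close> does not vanish, shows
  that a nonzero \<open>q\<close> has a nonzero homogenization.\<close>

lemma ratfun_eval_eq_0_iff:
  fixes n d q :: "'a::alg_closed_field poly"
  assumes "d \<noteq> 0" "\<And>x. n \<noteq> smult x d"
  shows "ratfun_eval n d q = 0 \<longleftrightarrow> q = 0"
proof
  assume 0: "ratfun_eval n d q = 0"
  from exists_nonroot[OF assms(1)] obtain y where y: "poly d y \<noteq> 0" .
  have "to_fract (homogenize n d (degree q) q) = 0"
    unfolding to_fract_homogenize[OF assms(1) order_refl] 0 by simp
  then have "homogenize n d (degree q) q = 0" by (simp only: to_fract_eq_0_iff)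
  then show "q = 0" using order_homogenize(1)[OF y assms(2) _ order_refl] by blast
qed (simp add: ratfun_eval_hom.hom_zero)

lemma degree_homogenize_le:
  assumes "degree n \<le> G" "degree d \<le> G"
  shows "degree (homogenize n d N q) \<le> N * G"
  unfolding homogenize_def
proof (rule degree_sum_le)
  fix k assume "k \<in> {..N}"
  then have "k * G + (N - k) * G = N * G" by (simp flip: add_mult_distrib)
  moreover have "degree (n ^ k) \<le> k * G" "degree (d ^ (N - k)) \<le> (N - k) * G"
    using assms by (auto intro!: order.trans[OF degree_power_le] simp: mult.commute)
  ultimately have "degree (n ^ k * d ^ (N - k)) \<le> N * G"
    using degree_mult_le[of "n ^ k" "d ^ (N - k)"] by linarith
  then show "degree (smult (coeff q k) (n ^ k * d ^ (N - k))) \<le> N * G"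
    by (rule order.trans[OF degree_smult_le])
qed simp

text \<open>The coefficient at the grade is the value of the reversal at 0, so it evaluates the form
  of \<open>q\<close> at \<open>(coeff n G, coeff d G)\<close>, the image of infinity under
  \<open>(n : d)\<close>.\<close>

lemma coeff_homogenize_top:
  assumes "degree n \<le> G" "degree d \<le> G"
  shows "coeff (homogenize n d N q) (N * G) = (\<Sum>k\<le>N. coeff q k * (coeff n G ^ k * coeff d G ^ (N - k)))"
proof -
  have "coeff (homogenize n d N q) (N * G) = poly (rev_poly (N * G) (homogenize n d N q)) 0"
    by (rule poly_rev_poly_0[symmetric])
  then show ?thesis by (simp only: rev_poly_homogenize[OF assms] poly_homogenize[of "rev_poly G n"] poly_rev_poly_0)
qed

text \<open>The two independence conditions together say that the homogenized basis matrix has full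
  column rank at every point of the projective line, a condition stable under substitution.\<close>

lemma homogeneous_indepD:
  fixes vs :: "'a::field poly vec list"
  assumes red: "lead_indep p vs" "eval_indep p vs" and vs: "set vs \<subseteq> carrier_vec p"
    and ne: "\<alpha> \<noteq> 0 \<or> \<delta> \<noteq> 0"
    and rel: "\<And>j. j < p \<Longrightarrow>
      (\<Sum>i<length vs. c i * (\<Sum>k\<le>vec_degree (vs ! i). coeff (vs ! i $ j) k * (\<alpha> ^ k * \<delta> ^ (vec_degree (vs ! i) - k)))) = 0"
    and i: "i < length vs"
  shows "c i = 0"
proof (cases "\<delta> = 0")
  case False
  let ?c = "\<lambda>i. c i * \<delta> ^ vec_degree (vs ! i)"
  have "(\<Sum>i<length vs. ?c i * poly (vs ! i $ j) (\<alpha> / \<delta>)) = 0" if j: "j < p" for j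
  proof -
    have "(\<Sum>k\<le>vec_degree (vs ! i). coeff (vs ! i $ j) k * (\<alpha> ^ k * \<delta> ^ (vec_degree (vs ! i) - k))) =
        \<delta> ^ vec_degree (vs ! i) * poly (vs ! i $ j) (\<alpha> / \<delta>)" if "i < length vs" for i
      by (rule homogeneous_sum_eq[OF False degree_le_vec_degree[OF subsetD[OF vs nth_mem[OF that]] j]])
    then show ?thesis using rel[OF j] by (simp add: mult.assoc)
  qed
  then have "?c i = 0" by (rule eval_indepD[where c = ?c, OF red(2) _ i])
  then show ?thesis using False by simp
next
  case True
  then have \<alpha>: "\<alpha> \<noteq> 0" using ne by simp
  let ?c = "\<lambda>i. c i * \<alpha> ^ vec_degree (vs ! i)"
  have "(\<Sum>i<length vs. ?c i * coeff (vs ! i $ j) (vec_degree (vs ! i))) = 0" if j: "j < p" for j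
  proof -
    have "(\<Sum>k\<le>N. coeff q k * (\<alpha> ^ k * \<delta> ^ (N - k))) = \<alpha> ^ N * coeff q N" for N and q :: "'a poly"
    proof -
      have "(\<Sum>k\<le>N. coeff q k * (\<alpha> ^ k * \<delta> ^ (N - k))) = (\<Sum>k\<le>N. if k = N then \<alpha> ^ N * coeff q N else 0)"
        using True by (intro sum.cong) auto
      then show ?thesis by simp
    qed
    then show ?thesis using rel[OF j] by (simp add: mult.assoc)
  qed
  then have "?c i = 0" by (rule lead_indepD[where c = ?c, OF red(1) _ i])
  then show ?thesis using \<alpha> by simp
qed

definition homogenize_vec :: "'a::field poly \<Rightarrow> 'a poly \<Rightarrow> 'a poly vec \<Rightarrow> 'a poly vec" where
  "homogenize_vec n d v = map_vec (homogenize n d (vec_degree v)) v"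

text \<open>A point \<open>y\<close> is sent to \<open>(n(y), d(y))\<close> and infinity to the
  coefficients at \<open>G\<close>; neither pair is \<open>(0, 0)\<close>, by coprimality and by the
  choice of \<open>G\<close>. Full rank for \<open>vs\<close> at the image point is full rank for
  the homogenized vectors at the original point.\<close>

lemma homogenize_vec_reduced:
  fixes vs :: "'a::field poly vec list"
  assumes red: "lead_indep p vs" "eval_indep p vs" and vs: "set vs \<subseteq> carrier_vec p" and p: "0 < p"
    and cop: "coprime n d" and G: "G = max (degree n) (degree d)" "1 \<le> G"
  shows "map vec_degree (map (homogenize_vec n d) vs) = map (\<lambda>\<beta>. G * \<beta>) (map vec_degree vs)"
    and "lead_indep p (map (homogenize_vec n d) vs)" and "eval_indep p (map (homogenize_vec n d) vs)"
proof -
  let ?h = "homogenize_vec n d"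
  have deg: "degree n \<le> G" "degree d \<le> G" using G by auto
  have lead: "coeff n G \<noteq> 0 \<or> coeff d G \<noteq> 0" using coeff_max_degree_nonzero G by auto
  have hc: "?h (vs ! i) \<in> carrier_vec p" "vs ! i \<in> carrier_vec p" if "i < length vs" for i
    using subsetD[OF vs nth_mem[OF that]] by (auto simp: homogenize_vec_def)
  have hj: "?h (vs ! i) $ j = homogenize n d (vec_degree (vs ! i)) (vs ! i $ j)" if "i < length vs" "j < p" for i j
    using hc(2)[OF that(1)] that(2) by (simp add: homogenize_vec_def)
  have vdeg: "vec_degree (?h (vs ! i)) = vec_degree (vs ! i) * G" if i: "i < length vs" for i
  proof (rule antisym)
    show "vec_degree (?h (vs ! i)) \<le> vec_degree (vs ! i) * G"
      using hj[OF i] degree_homogenize_le[OF deg] by (intro vec_degree_leI[OF hc(1)[OF i] p]) simp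
    have "\<exists>j<p. coeff (?h (vs ! i) $ j) (vec_degree (vs ! i) * G) \<noteq> 0"
    proof (rule ccontr)
      assume *: "\<not> ?thesis"
      \<comment> \<open>A unit coefficient vector turns the rank condition at the image of infinity
        into the statement that this one column is nonzero there, so no degree is lost.\<close>
      let ?c = "\<lambda>k. if k = i then 1 else 0 :: 'a"
      have "?c i = 0"
      proof (rule homogeneous_indepD[where c = ?c, OF red vs lead _ i])
        fix j assume j: "j < p"
        have "(\<Sum>k<length vs. ?c k * (\<Sum>l\<le>vec_degree (vs ! k). coeff (vs ! k $ j) l *
            (coeff n G ^ l * coeff d G ^ (vec_degree (vs ! k) - l)))) =
          (\<Sum>k<length vs. if k = i then coeff (?h (vs ! i) $ j) (vec_degree (vs ! i) * G) else 0)"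
          by (intro sum.cong refl) (simp add: hj[OF i j] coeff_homogenize_top[OF deg])
        also have "\<dots> = 0" using * j by simp
        finally show "(\<Sum>k<length vs. ?c k * (\<Sum>l\<le>vec_degree (vs ! k). coeff (vs ! k $ j) l *
            (coeff n G ^ l * coeff d G ^ (vec_degree (vs ! k) - l)))) = 0" .
      qed
      then show False by simp
    qed
    then obtain j where j: "j < p" "coeff (?h (vs ! i) $ j) (vec_degree (vs ! i) * G) \<noteq> 0" by blast
    then have "vec_degree (vs ! i) * G \<le> degree (?h (vs ! i) $ j)" by (intro le_degree)
    also have "\<dots> \<le> vec_degree (?h (vs ! i))" by (rule degree_le_vec_degree[OF hc(1)[OF i] j(1)])
    finally show "vec_degree (vs ! i) * G \<le> vec_degree (?h (vs ! i))" .
  qed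
  then show "map vec_degree (map ?h vs) = map (\<lambda>\<beta>. G * \<beta>) (map vec_degree vs)"
    by (intro nth_equalityI) (auto simp: mult.commute)
  show "lead_indep p (map ?h vs)"
    unfolding lead_indep_def
  proof (intro allI impI)
    fix c i assume rel: "\<forall>j<p. (\<Sum>i<length (map ?h vs). c i * coeff (map ?h vs ! i $ j) (vec_degree (map ?h vs ! i))) = 0"
      and i: "i < length (map ?h vs)"
    show "c i = 0"
    proof (rule homogeneous_indepD[where c = c, OF red vs lead])
      fix j assume j: "j < p"
      have "(\<Sum>i<length vs. c i * (\<Sum>k\<le>vec_degree (vs ! i). coeff (vs ! i $ j) k *
          (coeff n G ^ k * coeff d G ^ (vec_degree (vs ! i) - k)))) =
        (\<Sum>i<length (map ?h vs). c i * coeff (map ?h vs ! i $ j) (vec_degree (map ?h vs ! i)))"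
        by (rule sum.cong) (simp_all add: vdeg hj[OF _ j] coeff_homogenize_top[OF deg])
      then show "(\<Sum>i<length vs. c i * (\<Sum>k\<le>vec_degree (vs ! i). coeff (vs ! i $ j) k *
          (coeff n G ^ k * coeff d G ^ (vec_degree (vs ! i) - k)))) = 0" using rel j by simp
    qed (use i in simp)
  qed
  show "eval_indep p (map ?h vs)"
    unfolding eval_indep_def
  proof (intro allI impI)
    fix x c i assume rel: "\<forall>j<p. (\<Sum>i<length (map ?h vs). c i * poly (map ?h vs ! i $ j) x) = 0"
      and i: "i < length (map ?h vs)"
    show "c i = 0"
    proof (rule homogeneous_indepD[where c = c, OF red vs coprime_no_common_root[OF cop, of x]])
      fix j assume j: "j < p"
      have "(\<Sum>i<length vs. c i * (\<Sum>k\<le>vec_degree (vs ! i). coeff (vs ! i $ j) k *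
          (poly n x ^ k * poly d x ^ (vec_degree (vs ! i) - k)))) =
        (\<Sum>i<length (map ?h vs). c i * poly (map ?h vs ! i $ j) x)"
        by (rule sum.cong) (simp_all add: hj[OF _ j] poly_homogenize)
      then show "(\<Sum>i<length vs. c i * (\<Sum>k\<le>vec_degree (vs ! i). coeff (vs ! i $ j) k *
          (poly n x ^ k * poly d x ^ (vec_degree (vs ! i) - k)))) = 0" using rel j by simp
    qed (use i in simp)
  qed
qed

lemma in_poly_kernel_iff:
  fixes P :: "'b::idom mat"
  assumes "P \<in> carrier_mat m p"
  shows "w \<in> poly_points p (mat_kernel (map_mat to_fract P)) \<longleftrightarrow>
    w \<in> carrier_vec p \<and> (\<forall>l<m. (\<Sum>j<p. P $$ (l, j) * w $ j) = 0)"
proof (cases "w \<in> carrier_vec p")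
  case True
  have "(\<Sum>j<p. map_mat to_fract P $$ (l, j) * map_vec to_fract w $ j) = to_fract (\<Sum>j<p. P $$ (l, j) * w $ j)"
    if "l < m" for l
    unfolding to_fract_sum to_fract_mult using that assms True by (intro sum.cong) auto
  then have "(\<Sum>j<p. map_mat to_fract P $$ (l, j) * map_vec to_fract w $ j) = 0 \<longleftrightarrow> (\<Sum>j<p. P $$ (l, j) * w $ j) = 0"
    if "l < m" for l
    using that by (simp only: to_fract_eq_0_iff)
  moreover have "w \<in> poly_points p (mat_kernel (map_mat to_fract P)) \<longleftrightarrow>
      (\<forall>l<m. (\<Sum>j<p. map_mat to_fract P $$ (l, j) * map_vec to_fract w $ j) = 0)"
    using in_mat_kernel_iff[of "map_mat to_fract P" m p "map_vec to_fract w"] assms True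
    by (simp only: poly_points_def mem_Collect_eq map_carrier_mat map_carrier_vec simp_thms)
  ultimately show ?thesis using True by blast
qed (simp add: poly_points_def)

text \<open>The columns of \<open>e I - L P\<close> lie in the kernel of \<open>P\<close> and are
  polynomial combinations of \<open>vs\<close>. After substitution of \<open>n / d\<close>, a vector
  \<open>x\<close> in the kernel of the image of \<open>P\<close> satisfies
  \<open>e x = (e I - L P) x\<close> with all matrices replaced by their images. This writes
  \<open>x\<close> as a combination of the images of \<open>vs\<close>, which are the homogenized
  vectors up to powers of \<open>d\<close>.\<close>

lemma homogenize_vec_maximal_indep:
  fixes n d :: "'a::alg_closed_field poly" and P Q :: "'a poly mat"
  assumes pos: "0 < p" and d: "d \<noteq> 0" and cop: "coprime n d"
    and G: "G = max (degree n) (degree d)" "1 \<le> G"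
    and P: "P \<in> carrier_mat m p" and Q: "Q \<in> carrier_mat m p" and PQ: "is_rational_transform n d g P Q"
    and vs: "maximal_indep p (poly_points p (mat_kernel (map_mat to_fract P))) vs"
    and red: "lead_indep p vs" "eval_indep p vs"
  shows "maximal_indep p (poly_points p (mat_kernel (map_mat to_fract Q))) (map (homogenize_vec n d) vs)"
proof (rule maximal_indepI_span)
  let ?h = "homogenize_vec n d" and ?\<phi> = "ratfun_eval n d"
  let ?W = "poly_points p (mat_kernel (map_mat to_fract P))"
  have vsW: "set vs \<subseteq> ?W" using vs by (simp add: maximal_indep_def)
  have vsc: "set vs \<subseteq> carrier_vec p" using vsW by (auto simp: poly_points_def)
  note red' = homogenize_vec_reduced[OF red vsc pos cop G]
  have hc: "set (map ?h vs) \<subseteq> carrier_vec p" using vsc by (auto simp: homogenize_vec_def)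
  have hj: "to_fract (?h (vs ! i) $ j) = to_fract d ^ vec_degree (vs ! i) * ?\<phi> (vs ! i $ j)"
    if "i < length vs" "j < p" for i j
  proof -
    have v: "vs ! i \<in> carrier_vec p" using subsetD[OF vsc nth_mem[OF that(1)]] .
    then show ?thesis
      using that(2) to_fract_homogenize[OF d degree_le_vec_degree[OF v that(2)]] by (simp add: homogenize_vec_def)
  qed
  have PQ': "to_fract (Q $$ (l, j)) = to_fract d ^ g * ?\<phi> (P $$ (l, j))" if "l < m" "j < p" for l j
    using PQ[unfolded is_rational_transform_def, THEN arg_cong, of "\<lambda>M. M $$ (l, j)"] P Q that by simp
  show "vecs_indep p (map ?h vs)" by (rule lead_indep_imp_vecs_indep[OF red'(2) hc])
  show "set (map ?h vs) \<subseteq> poly_points p (mat_kernel (map_mat to_fract Q))"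
  proof
    fix w assume w: "w \<in> set (map ?h vs)"
    then obtain i where i: "i < length vs" "w = ?h (vs ! i)" by (auto simp: in_set_conv_nth)
    have "vs ! i \<in> ?W" using subsetD[OF vsW nth_mem[OF i(1)]] .
    then have ker: "(\<Sum>j<p. P $$ (l, j) * vs ! i $ j) = 0" if "l < m" for l
      using in_poly_kernel_iff[OF P] that by blast
    have "(\<Sum>j<p. Q $$ (l, j) * w $ j) = 0" if l: "l < m" for l
    proof -
      have "to_fract (\<Sum>j<p. Q $$ (l, j) * w $ j) =
          (\<Sum>j<p. to_fract d ^ (g + vec_degree (vs ! i)) * ?\<phi> (P $$ (l, j) * vs ! i $ j))"
        unfolding to_fract_sum to_fract_mult i(2)
        by (intro sum.cong refl) (simp add: PQ' l hj[OF i(1)] power_add ratfun_eval_hom.hom_mult)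
      also have "\<dots> = to_fract d ^ (g + vec_degree (vs ! i)) * ?\<phi> (\<Sum>j<p. P $$ (l, j) * vs ! i $ j)"
        by (simp add: sum_distrib_left ratfun_eval_hom.hom_sum)
      finally show ?thesis
        by (simp only: ker[OF l] ratfun_eval_hom.hom_zero mult_zero_right to_fract_eq_0_iff)
    qed
    then show "w \<in> poly_points p (mat_kernel (map_mat to_fract Q))"
      using in_poly_kernel_iff[OF Q] w hc by blast
  qed
  from exists_generalized_inverse[OF P] obtain L e where
    L: "L \<in> carrier_mat p m" and e: "e \<noteq> 0" and PLP: "P * L * P = e \<cdot>\<^sub>m P" by (elim exE conjE)
  have LP: "L * P \<in> carrier_mat p p" using L P by auto
  define u where "u k = vec p (\<lambda>j. (if j = k then e else 0) - (L * P) $$ (j, k))" for k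
  have uW: "u k \<in> ?W" if k: "k < p" for k
  proof -
    have "(\<Sum>j<p. P $$ (l, j) * u k $ j) = 0" if l: "l < m" for l
    proof -
      have "(\<Sum>j<p. P $$ (l, j) * u k $ j) =
          (\<Sum>j<p. (if j = k then e * P $$ (l, k) else 0) - P $$ (l, j) * (L * P) $$ (j, k))"
        by (intro sum.cong refl) (auto simp: u_def algebra_simps simp del: index_mult_mat)
      also have "\<dots> = e * P $$ (l, k) - (P * (L * P)) $$ (l, k)"
        using k mat_mult_index[OF P LP l k] by (simp add: sum_subtractf)
      also have "P * (L * P) = e \<cdot>\<^sub>m P" using PLP assoc_mult_mat[OF P L P] by simp
      finally show ?thesis using P l k by simp
    qed
    then show ?thesis using in_poly_kernel_iff[OF P, of "u k"] by (simp add: u_def)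
  qed
  have "\<forall>k\<in>{..<p}. \<exists>a. \<forall>j<p. u k $ j = (\<Sum>i<length vs. a i * vs ! i $ j)"
  proof
    fix k assume "k \<in> {..<p}"
    then have k: "u k \<in> ?W" "u k \<in> carrier_vec p" using uW by (auto simp: u_def)
    from reduced_basis_coeffs[OF red vs vsc k] obtain a where "\<forall>j<p. u k $ j = (\<Sum>i<length vs. a i * vs ! i $ j)"
      by (elim exE conjE)
    then show "\<exists>a. \<forall>j<p. u k $ j = (\<Sum>i<length vs. a i * vs ! i $ j)" by (intro exI[of _ a])
  qed
  from bchoice[OF this] obtain a where a: "\<forall>k\<in>{..<p}. \<forall>j<p. u k $ j = (\<Sum>i<length vs. a k i * vs ! i $ j)" ..
  \<comment> \<open>Nonconstancy of \<open>n / d\<close> enters here: it keeps the scalar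
    \<open>e\<close> from becoming zero under substitution.\<close>
  have \<phi>e: "?\<phi> e \<noteq> 0" using e ratfun_eval_eq_0_iff[OF d coprime_not_smult[OF cop]] G by simp
  fix w assume "w \<in> poly_points p (mat_kernel (map_mat to_fract Q))"
  then have ker: "(\<Sum>j<p. Q $$ (l, j) * w $ j) = 0" if "l < m" for l
    using in_poly_kernel_iff[OF Q] that by blast
  define x where "x j = to_fract (w $ j)" for j
  have Px: "(\<Sum>k<p. ?\<phi> (P $$ (l, k)) * x k) = 0" if l: "l < m" for l
  proof -
    have "to_fract d ^ g * (\<Sum>k<p. ?\<phi> (P $$ (l, k)) * x k) = to_fract (\<Sum>k<p. Q $$ (l, k) * w $ k)"
      unfolding to_fract_sum to_fract_mult sum_distrib_left
      by (intro sum.cong refl) (simp add: PQ' l x_def)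
    then show ?thesis using ker[OF l] d by simp
  qed
  \<comment> \<open>The power of \<open>d\<close> undoes the homogenization of
    \<open>vs ! i\<close>, and the image of \<open>e\<close> is the scalar from the generalized
    inverse.\<close>
  define r where "r i = (\<Sum>k<p. ?\<phi> (a k i) * x k) / to_fract d ^ vec_degree (vs ! i) / ?\<phi> e" for i
  have x: "x j = (\<Sum>i<length (map ?h vs). r i * to_fract (map ?h vs ! i $ j))" if j: "j < p" for j
  proof -
    have "?\<phi> e * x j = (\<Sum>k<p. ?\<phi> (if j = k then e else 0) * x k)"
      using j by (simp add: if_distrib[of ?\<phi>] if_distrib[of "\<lambda>t. t * _"] ratfun_eval_hom.hom_zero cong: if_cong)
    also have "\<dots> = (\<Sum>k<p. ?\<phi> (u k $ j) * x k + ?\<phi> ((L * P) $$ (j, k)) * x k)"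
    proof (intro sum.cong refl)
      fix k
      have "(if j = k then e else 0) = u k $ j + (L * P) $$ (j, k)" using j by (simp add: u_def del: index_mult_mat)
      then show "?\<phi> (if j = k then e else 0) * x k = ?\<phi> (u k $ j) * x k + ?\<phi> ((L * P) $$ (j, k)) * x k"
        by (simp only: ratfun_eval_hom.hom_add distrib_right)
    qed
    also have "\<dots> = (\<Sum>k<p. ?\<phi> (u k $ j) * x k) + (\<Sum>k<p. ?\<phi> ((L * P) $$ (j, k)) * x k)"
      by (rule sum.distrib)
    also have "(\<Sum>k<p. ?\<phi> ((L * P) $$ (j, k)) * x k) = (\<Sum>k<p. \<Sum>l<m. ?\<phi> (L $$ (j, l)) * (?\<phi> (P $$ (l, k)) * x k))"
    proof (intro sum.cong refl)
      fix k assume "k \<in> {..<p}"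
      then show "?\<phi> ((L * P) $$ (j, k)) * x k = (\<Sum>l<m. ?\<phi> (L $$ (j, l)) * (?\<phi> (P $$ (l, k)) * x k))"
        using mat_mult_index[OF L P j, of k]
        by (simp add: ratfun_eval_hom.hom_sum ratfun_eval_hom.hom_mult sum_distrib_right mult.assoc del: index_mult_mat)
    qed
    also have "\<dots> = (\<Sum>l<m. ?\<phi> (L $$ (j, l)) * (\<Sum>k<p. ?\<phi> (P $$ (l, k)) * x k))"
      by (subst sum.swap) (simp add: sum_distrib_left)
    also have "\<dots> = 0" using Px by simp
    also have "(\<Sum>k<p. ?\<phi> (u k $ j) * x k) = (\<Sum>k<p. \<Sum>i<length vs. ?\<phi> (a k i) * ?\<phi> (vs ! i $ j) * x k)"
      using a j by (intro sum.cong refl) (simp add: ratfun_eval_hom.hom_sum ratfun_eval_hom.hom_mult sum_distrib_right)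
    also have "\<dots> = (\<Sum>i<length vs. (\<Sum>k<p. ?\<phi> (a k i) * x k) * ?\<phi> (vs ! i $ j))"
      by (subst sum.swap) (simp add: sum_distrib_left sum_distrib_right mult_ac)
    also have "\<dots> = (\<Sum>i<length vs. ?\<phi> e * (r i * to_fract (?h (vs ! i) $ j)))"
      using \<phi>e d by (intro sum.cong refl) (simp add: r_def hj j)
    finally have "?\<phi> e * x j = ?\<phi> e * (\<Sum>i<length vs. r i * to_fract (?h (vs ! i) $ j))"
      by (simp add: sum_distrib_left)
    then show ?thesis using \<phi>e by simp
  qed
  from to_fract_relation[of "map ?h vs" r] obtain s b where sb: "s \<noteq> 0"
    "\<forall>j. to_fract s * (\<Sum>i<length (map ?h vs). r i * to_fract (map ?h vs ! i $ j)) =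
      to_fract (\<Sum>i<length (map ?h vs). b i * map ?h vs ! i $ j)"
    by (elim exE conjE)
  have "s * w $ j = (\<Sum>i<length (map ?h vs). b i * map ?h vs ! i $ j)" if j: "j < p" for j
  proof -
    have "to_fract (s * w $ j) = to_fract (\<Sum>i<length (map ?h vs). b i * map ?h vs ! i $ j)"
      unfolding to_fract_mult x_def[symmetric] x[OF j] using sb(2) by blast
    then show ?thesis by (simp only: to_fract_eq_iff)
  qed
  then show "\<exists>q a. q \<noteq> 0 \<and> (\<forall>j<p. q * w $ j = (\<Sum>i<length (map ?h vs). a i * map ?h vs ! i $ j))"
    using sb(1) by (intro exI[of _ s] exI[of _ b]) simp
qed

lemma right_minimal_indices_transform:
  fixes n d :: "'a::alg_closed_field poly" and P Q :: "'a poly mat"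
  assumes pos: "0 < p" and d: "d \<noteq> 0" and cop: "coprime n d"
    and G: "G = max (degree n) (degree d)" "1 \<le> G"
    and P: "P \<in> carrier_mat m p" and Q: "Q \<in> carrier_mat m p" and PQ: "is_rational_transform n d g P Q"
  shows "right_minimal_indices Q = map (\<lambda>\<beta>. G * \<beta>) (right_minimal_indices P)"
proof -
  let ?W = "\<lambda>P. poly_points p (mat_kernel (map_mat to_fract P))"
  have c: "map_mat to_fract P \<in> carrier_mat m p" "map_mat to_fract Q \<in> carrier_mat m p" using P Q by auto
  from exists_reduced_basis[OF saturated_poly_points[OF c(1)]] obtain vs where
    vs: "maximal_indep p (?W P) vs" "lead_indep p vs" "eval_indep p vs" "sorted (map vec_degree vs)" by metis
  have Wc: "?W P \<subseteq> carrier_vec p" for P :: "'a poly mat" by (auto simp: poly_points_def)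
  have "set vs \<subseteq> carrier_vec p" using vs(1) Wc by (auto simp: maximal_indep_def)
  note red = homogenize_vec_reduced[OF vs(2,3) this pos cop G]
  note hvs = homogenize_vec_maximal_indep[OF pos d cop G P Q PQ vs(1-3)]
  have "sorted (map vec_degree (map (homogenize_vec n d) vs))"
    unfolding red(1) using vs(4) by (simp add: sorted_iff_nth_mono)
  from minimal_indices_eq_reduced[OF poly_basis_mat_kernel_iff[OF c(2)] Wc hvs red(2,3) this]
  have "right_minimal_indices Q = map vec_degree (map (homogenize_vec n d) vs)"
    using Q by (simp add: right_minimal_indices_def)
  moreover from minimal_indices_eq_reduced[OF poly_basis_mat_kernel_iff[OF c(1)] Wc vs]
  have "right_minimal_indices P = map vec_degree vs"
    using P by (simp add: right_minimal_indices_def)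
  ultimately show ?thesis using red(1) by simp
qed

section \<open>Left minimal indices by transposition, and the final assembly\<close>

lemma left_minimal_indices_eq_transpose:
  "left_minimal_indices P = right_minimal_indices (transpose_mat P)"
proof -
  have "transpose_mat (map_mat to_fract P) = map_mat to_fract (transpose_mat P)" by (intro eq_matI) auto
  then show ?thesis by (simp add: left_minimal_indices_def right_minimal_indices_def)
qed

lemma is_rational_transform_transpose:
  assumes "is_rational_transform n d g P Q"
  shows "is_rational_transform n d g (transpose_mat P) (transpose_mat Q)"
proof -
  have "map_mat to_fract (transpose_mat Q) = transpose_mat (map_mat to_fract Q)" by (intro eq_matI) auto
  also have "\<dots> = to_fract d ^ g \<cdot>\<^sub>m map_mat (ratfun_eval n d) (transpose_mat P)"
    using assms unfolding is_rational_transform_def by (intro eq_matI) auto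
  finally show ?thesis unfolding is_rational_transform_def .
qed

lemma left_minimal_indices_transform:
  fixes n d :: "'a::alg_closed_field poly" and P Q :: "'a poly mat"
  assumes "0 < m" "d \<noteq> 0" "coprime n d" "G = max (degree n) (degree d)" "1 \<le> G"
    and "P \<in> carrier_mat m p" "Q \<in> carrier_mat m p" "is_rational_transform n d g P Q"
  shows "left_minimal_indices Q = map (\<lambda>\<gamma>. G * \<gamma>) (left_minimal_indices P)"
  unfolding left_minimal_indices_eq_transpose
  by (rule right_minimal_indices_transform[OF assms(1-5) _ _ is_rational_transform_transpose[OF assms(8)]])
    (use assms(6,7) in auto)

theorem theorem4p1:
  fixes n d :: "'a::alg_closed_field poly" and P Q :: "'a poly mat" and m p g G :: nat
  assumes "0 < m" and "0 < p"
    and "n \<noteq> 0" and "d \<noteq> 0" and "coprime n d"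
    and "G = max (degree n) (degree d)" and "1 \<le> G"
    and "P \<in> carrier_mat m p" and "has_grade g P"
    and "Q \<in> carrier_mat m p" and "is_rational_transform n d g P Q"
  shows
    "(\<forall>x0 y0. char_value g P x0 \<longrightarrow> y0 \<in> fibre n d x0 \<longrightarrow>
        char_value (g * G) Q y0 \<and>
        elem_divs (g * G) Q y0 = {#fibre_mult n d x0 y0 * l. l \<in># elem_divs g P x0#})
     \<and>
     (\<forall>y0. char_value (g * G) Q y0 \<longrightarrow>
        (let x0 = ratfun_value n d y0; m0 = fibre_mult n d x0 y0 in
          char_value g P x0 \<and>
          (\<forall>k \<in># elem_divs (g * G) Q y0. m0 dvd k) \<and>
          elem_divs g P x0 = {#k div m0. k \<in># elem_divs (g * G) Q y0#}))
     \<and>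
     (\<forall>\<beta>s. right_minimal_indices P = \<beta>s \<longleftrightarrow> right_minimal_indices Q = map (\<lambda>\<beta>. G * \<beta>) \<beta>s)
     \<and>
     (\<forall>\<gamma>s. left_minimal_indices P = \<gamma>s \<longleftrightarrow> left_minimal_indices Q = map (\<lambda>\<gamma>. G * \<gamma>) \<gamma>s)"
proof -
  have Q: "Q = homogenize_mat n d g P"
    by (rule rational_transform_eq_homogenize[OF assms(4,9,11)])
  have ed: "elem_divs (g * G) Q y0 = {#fibre_mult n d x0 y0 * l. l \<in># elem_divs g P x0#}"
    if "y0 \<in> fibre n d x0" for x0 y0
    unfolding Q by (rule elem_divs_homogenize[OF assms(1-9) that])
  have pos: "0 < fibre_mult n d x0 y0" if "y0 \<in> fibre n d x0" for x0 y0
    using fibre_mult_pos[OF assms(3-5) _ that] assms(6,7) by simp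
  have val: "y0 \<in> fibre n d (ratfun_value n d y0)" for y0
    unfolding ratfun_value_def by (rule theI'[OF ex1_fibre]) (use assms(5-7) in auto)
  \<comment> \<open>The indices of \<open>Q\<close> are computed from those of \<open>P\<close>;
    injectivity of multiplication by \<open>G\<close>, which is at least 1, supplies the converse
    implications in (3) and (4).\<close>
  have inj: "inj (\<lambda>\<beta>. G * \<beta>)" using assms(7) by (auto simp: inj_on_def)
  have 1: "\<forall>x0 y0. char_value g P x0 \<longrightarrow> y0 \<in> fibre n d x0 \<longrightarrow> char_value (g * G) Q y0 \<and>
      elem_divs (g * G) Q y0 = {#fibre_mult n d x0 y0 * l. l \<in># elem_divs g P x0#}"
    by (simp add: char_value_iff ed)
  have 2: "\<forall>y0. char_value (g * G) Q y0 \<longrightarrow>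
      (let x0 = ratfun_value n d y0; m0 = fibre_mult n d x0 y0 in
        char_value g P x0 \<and> (\<forall>k \<in># elem_divs (g * G) Q y0. m0 dvd k) \<and>
        elem_divs g P x0 = {#k div m0. k \<in># elem_divs (g * G) Q y0#})"
    unfolding Let_def
  proof (intro allI impI)
    fix y0 assume c: "char_value (g * G) Q y0"
    let ?x0 = "ratfun_value n d y0"
    let ?m0 = "fibre_mult n d ?x0 y0"
    \<comment> \<open>Scaling by the positive \<open>?m0\<close> is undone by integer division, so
      the multiset identity of (1) already yields the converse.\<close>
    have "(\<lambda>k. k div ?m0) \<circ> (\<lambda>l. ?m0 * l) = id" using pos[OF val[of y0]] by auto
    then have "{#k div ?m0. k \<in># {#?m0 * l. l \<in># elem_divs g P ?x0#}#} = elem_divs g P ?x0"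
      by (simp only: multiset.map_comp multiset.map_id)
    then show "char_value g P ?x0 \<and> (\<forall>k \<in># elem_divs (g * G) Q y0. ?m0 dvd k) \<and>
        elem_divs g P ?x0 = {#k div ?m0. k \<in># elem_divs (g * G) Q y0#}"
      using c by (simp add: char_value_iff ed[OF val])
  qed
  show ?thesis
    using 1 2 right_minimal_indices_transform[OF assms(2,4-8,10,11)]
      left_minimal_indices_transform[OF assms(1,4-8,10,11)] inj_map_eq_map[OF inj]
    by metis
qed

end
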